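(* Let $n\ge1$ and let $k$ be a field containing a primitive $n$-th root of unity $q$ such that $q^{\frac{n(n-1)}{2}}=1$. Let $C_n=\langle\sigma\rangle$ be the cyclic group of order $n$ generated by $\sigma$ and let $F:C_n\times C_n\to k^*$ be given by $F(\sigma^a,\sigma^b)=q^{-\frac{(a-1)ab}{2}}$ for $0\le a,b\le n-1$. Then $k[C_n]$ is a commutative and cocommutative weak braided Hopf algebra in ${\rm Vect}^{C_n}_{F^{-1}}$ via the structure $$\sigma^a\bullet\sigma^b=q^{-\frac{(a-1)ab}{2}}\sigma^{a+b},\qquad \underline{\Delta}(\sigma^a)=\frac1n\sum_{l=0}^{n-1}q^{\frac{(l-1)l(a-l)}{2}}\,\sigma^l\otimes\sigma^{a-l},$$ for all $0\le a,b\le n-1$. The unit is $e$, the counit is given by $\underline{\varepsilon}(\sigma^a)=n\,\delta_{a,0}$ for $0\le a\le n-1$, and the antipode is the identity on $k[C_n]$.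
   Context: $k^*=k\setminus\{0\}$. For a finite abelian group $G$ with unit $e$, ${\rm Vect}^G$ is the category of $G$-graded $k$-vector spaces and grading-preserving linear maps, with the usual graded tensor product and unit $k$ in degree $e$. $k[G]$ is graded by $|x|=x$ for $x\in G$. For $F:G\times G\to k^*$ with $F(e,x)=F(y,e)$ for all $x,y$, ${\rm Vect}^G_{F^{-1}}$ is ${\rm Vect}^G$ with trivial unit constraints, associativity $(v\otimes w)\otimes z\mapsto\phi(|v|,|w|,|z|)\,v\otimes(w\otimes z)$, where $\phi(x,y,z)=F(y,z)^{-1}F(xy,z)F(x,yz)^{-1}F(x,y)$, and braiding $c(v\otimes w)=F(|v|,|w|)F(|w|,|v|)^{-1}\,w\otimes v$. This is a symmetric monoidal category. A weak braided Hopf algebra in a symmetric monoidal category (braiding $c$, unit object $\underline 1$; associativity constraints inserted where needed) is an object $B$ that is an associative unital algebra $(B,m,\eta)$ and a coassociative counital coalgebra $(B,\Delta,\varepsilon)$ in the category, together with a morphism $S:B\to B$ (antipode), such that, writing $B$ also for ${\rm Id}_B$: (1) $\Delta m=(m\otimes m)(B\otimes c\otimes B)(\Delta\otimes\Delta)$; (2) $\varepsilon m(m\otimes B)=(\varepsilon m\otimes\varepsilon m)(B\otimes\Delta\otimes B)=(\varepsilon m\otimes\varepsilon m)(B\otimes c\Delta\otimes B)$; (3) $(\Delta\otimes B)\Delta\eta=(B\otimes m\otimes B)(\Delta\eta\otimes\Delta\eta)=(B\otimes mc\otimes B)(\Delta\eta\otimes\Delta\eta)$; (4) $m(B\otimes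 S)\Delta=(\varepsilon m\otimes B)(B\otimes c)(\Delta\eta\otimes B)$, $\ m(S\otimes B)\Delta=(B\otimes\varepsilon m)(c\otimes B)(B\otimes\Delta\eta)$, $\ m(m\otimes B)(S\otimes B\otimes S)(\Delta\otimes B)\Delta=S$. It is commutative if $mc=m$ and cocommutative if $c\Delta=\Delta$. Here $m(x\otimes y)=x\bullet y$, $\Delta=\underline\Delta$, $\varepsilon=\underline\varepsilon$, extended linearly. *)

theory Defs
  imports
    Complex_Main
    "HOL-Algebra.Generated_Groups"
    "HOL-Library.Function_Algebras"
begin

section \<open>Symmetric monoidal categories\<close>

record ('o, 'm) smc =
  Obj :: "'o set"
  Hom :: "'o \<Rightarrow> 'o \<Rightarrow> 'm set"
  Comp :: "'m \<Rightarrow> 'm \<Rightarrow> 'm"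
  Ident :: "'o \<Rightarrow> 'm"
  TensO :: "'o \<Rightarrow> 'o \<Rightarrow> 'o"
  TensA :: "'m \<Rightarrow> 'm \<Rightarrow> 'm"
  UnitO :: "'o"
  Assoc :: "'o \<Rightarrow> 'o \<Rightarrow> 'o \<Rightarrow> 'm"
  AssocInv :: "'o \<Rightarrow> 'o \<Rightarrow> 'o \<Rightarrow> 'm"
  LUnit :: "'o \<Rightarrow> 'm"
  LUnitInv :: "'o \<Rightarrow> 'm"
  RUnit :: "'o \<Rightarrow> 'm"
  RUnitInv :: "'o \<Rightarrow> 'm"
  Braid :: "'o \<Rightarrow> 'o \<Rightarrow> 'm"

locale smc_data =
  fixes C :: "('o, 'm) smc"
begin

abbreviation comp_arr :: "'m \<Rightarrow> 'm \<Rightarrow> 'm"  (infixr "\<odot>" 65)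
  where "g \<odot> f \<equiv> Comp C g f"
abbreviation tens_arr :: "'m \<Rightarrow> 'm \<Rightarrow> 'm"  (infixr "\<boxtimes>" 70)
  where "f \<boxtimes> g \<equiv> TensA C f g"
abbreviation tens_obj :: "'o \<Rightarrow> 'o \<Rightarrow> 'o"  (infixr "\<otimes>\<^sub>o" 70)
  where "A \<otimes>\<^sub>o B \<equiv> TensO C A B"
abbreviation idt :: "'o \<Rightarrow> 'm" where "idt \<equiv> Ident C"
abbreviation unit_obj :: "'o"  ("\<I>") where "\<I> \<equiv> UnitO C"
abbreviation assoc :: "'o \<Rightarrow> 'o \<Rightarrow> 'o \<Rightarrow> 'm"  ("\<a>") where "\<a> \<equiv> Assoc C"
abbreviation assoc' :: "'o \<Rightarrow> 'o \<Rightarrow> 'o \<Rightarrow> 'm"  ("\<a>''") where "\<a>' \<equiv> AssocInv C"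
abbreviation lunit :: "'o \<Rightarrow> 'm"  ("\<l>") where "\<l> \<equiv> LUnit C"
abbreviation lunit' :: "'o \<Rightarrow> 'm"  ("\<l>''") where "\<l>' \<equiv> LUnitInv C"
abbreviation runit :: "'o \<Rightarrow> 'm"  ("\<r>") where "\<r> \<equiv> RUnit C"
abbreviation runit' :: "'o \<Rightarrow> 'm"  ("\<r>''") where "\<r>' \<equiv> RUnitInv C"
abbreviation braid :: "'o \<Rightarrow> 'o \<Rightarrow> 'm"  ("\<c>") where "\<c> \<equiv> Braid C"

end

locale symmetric_monoidal_category = smc_data C for C :: "('o, 'm) smc" +
  assumes unit_in: "\<I> \<in> Obj C"
    and tens_in: "A \<in> Obj C \<Longrightarrow> B \<in> Obj C \<Longrightarrow> A \<otimes>\<^sub>o B \<in> Obj C"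
    and ident_in: "A \<in> Obj C \<Longrightarrow> idt A \<in> Hom C A A"
    and comp_in: "A \<in> Obj C \<Longrightarrow> B \<in> Obj C \<Longrightarrow> D \<in> Obj C \<Longrightarrow>
          f \<in> Hom C A B \<Longrightarrow> g \<in> Hom C B D \<Longrightarrow> g \<odot> f \<in> Hom C A D"
    and ident_left: "A \<in> Obj C \<Longrightarrow> B \<in> Obj C \<Longrightarrow> f \<in> Hom C A B \<Longrightarrow> idt B \<odot> f = f"
    and ident_right: "A \<in> Obj C \<Longrightarrow> B \<in> Obj C \<Longrightarrow> f \<in> Hom C A B \<Longrightarrow> f \<odot> idt A = f"
    and comp_assoc: "A \<in> Obj C \<Longrightarrow> B \<in> Obj C \<Longrightarrow> D \<in> Obj C \<Longrightarrow> E \<in> Obj C \<Longrightarrow>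
          f \<in> Hom C A B \<Longrightarrow> g \<in> Hom C B D \<Longrightarrow> h \<in> Hom C D E \<Longrightarrow>
          (h \<odot> g) \<odot> f = h \<odot> (g \<odot> f)"
    and tens_arr_in: "A \<in> Obj C \<Longrightarrow> B \<in> Obj C \<Longrightarrow> A' \<in> Obj C \<Longrightarrow> B' \<in> Obj C \<Longrightarrow>
          f \<in> Hom C A B \<Longrightarrow> f' \<in> Hom C A' B' \<Longrightarrow> f \<boxtimes> f' \<in> Hom C (A \<otimes>\<^sub>o A') (B \<otimes>\<^sub>o B')"
    and tens_ident: "A \<in> Obj C \<Longrightarrow> B \<in> Obj C \<Longrightarrow> idt A \<boxtimes> idt B = idt (A \<otimes>\<^sub>o B)"
    and tens_comp: "A \<in> Obj C \<Longrightarrow> B \<in> Obj C \<Longrightarrow> D \<in> Obj C \<Longrightarrow>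
          A' \<in> Obj C \<Longrightarrow> B' \<in> Obj C \<Longrightarrow> D' \<in> Obj C \<Longrightarrow>
          f \<in> Hom C A B \<Longrightarrow> g \<in> Hom C B D \<Longrightarrow> f' \<in> Hom C A' B' \<Longrightarrow> g' \<in> Hom C B' D' \<Longrightarrow>
          (g \<odot> f) \<boxtimes> (g' \<odot> f') = (g \<boxtimes> g') \<odot> (f \<boxtimes> f')"
    and assoc_in: "A \<in> Obj C \<Longrightarrow> B \<in> Obj C \<Longrightarrow> D \<in> Obj C \<Longrightarrow>
          \<a> A B D \<in> Hom C ((A \<otimes>\<^sub>o B) \<otimes>\<^sub>o D) (A \<otimes>\<^sub>o (B \<otimes>\<^sub>o D))"
    and assoc'_in: "A \<in> Obj C \<Longrightarrow> B \<in> Obj C \<Longrightarrow> D \<in> Obj C \<Longrightarrow>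
          \<a>' A B D \<in> Hom C (A \<otimes>\<^sub>o (B \<otimes>\<^sub>o D)) ((A \<otimes>\<^sub>o B) \<otimes>\<^sub>o D)"
    and assoc_inv: "A \<in> Obj C \<Longrightarrow> B \<in> Obj C \<Longrightarrow> D \<in> Obj C \<Longrightarrow>
          \<a> A B D \<odot> \<a>' A B D = idt (A \<otimes>\<^sub>o (B \<otimes>\<^sub>o D)) \<and>
          \<a>' A B D \<odot> \<a> A B D = idt ((A \<otimes>\<^sub>o B) \<otimes>\<^sub>o D)"
    and assoc_natural: "A \<in> Obj C \<Longrightarrow> B \<in> Obj C \<Longrightarrow> D \<in> Obj C \<Longrightarrow>
          A' \<in> Obj C \<Longrightarrow> B' \<in> Obj C \<Longrightarrow> D' \<in> Obj C \<Longrightarrow>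
          f \<in> Hom C A A' \<Longrightarrow> g \<in> Hom C B B' \<Longrightarrow> h \<in> Hom C D D' \<Longrightarrow>
          \<a> A' B' D' \<odot> ((f \<boxtimes> g) \<boxtimes> h) = (f \<boxtimes> (g \<boxtimes> h)) \<odot> \<a> A B D"
    and lunit_in: "A \<in> Obj C \<Longrightarrow> \<l> A \<in> Hom C (\<I> \<otimes>\<^sub>o A) A \<and> \<l>' A \<in> Hom C A (\<I> \<otimes>\<^sub>o A)"
    and lunit_inv: "A \<in> Obj C \<Longrightarrow> \<l> A \<odot> \<l>' A = idt A \<and> \<l>' A \<odot> \<l> A = idt (\<I> \<otimes>\<^sub>o A)"
    and lunit_natural: "A \<in> Obj C \<Longrightarrow> B \<in> Obj C \<Longrightarrow> f \<in> Hom C A B \<Longrightarrow>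
          \<l> B \<odot> (idt \<I> \<boxtimes> f) = f \<odot> \<l> A"
    and runit_in: "A \<in> Obj C \<Longrightarrow> \<r> A \<in> Hom C (A \<otimes>\<^sub>o \<I>) A \<and> \<r>' A \<in> Hom C A (A \<otimes>\<^sub>o \<I>)"
    and runit_inv: "A \<in> Obj C \<Longrightarrow> \<r> A \<odot> \<r>' A = idt A \<and> \<r>' A \<odot> \<r> A = idt (A \<otimes>\<^sub>o \<I>)"
    and runit_natural: "A \<in> Obj C \<Longrightarrow> B \<in> Obj C \<Longrightarrow> f \<in> Hom C A B \<Longrightarrow>
          \<r> B \<odot> (f \<boxtimes> idt \<I>) = f \<odot> \<r> A"
    and pentagon: "A \<in> Obj C \<Longrightarrow> B \<in> Obj C \<Longrightarrow> D \<in> Obj C \<Longrightarrow> E \<in> Obj C \<Longrightarrow>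
          (idt A \<boxtimes> \<a> B D E) \<odot> \<a> A (B \<otimes>\<^sub>o D) E \<odot> (\<a> A B D \<boxtimes> idt E)
            = \<a> A B (D \<otimes>\<^sub>o E) \<odot> \<a> (A \<otimes>\<^sub>o B) D E"
    and triangle: "A \<in> Obj C \<Longrightarrow> B \<in> Obj C \<Longrightarrow>
          (idt A \<boxtimes> \<l> B) \<odot> \<a> A \<I> B = \<r> A \<boxtimes> idt B"
    and braid_in: "A \<in> Obj C \<Longrightarrow> B \<in> Obj C \<Longrightarrow> \<c> A B \<in> Hom C (A \<otimes>\<^sub>o B) (B \<otimes>\<^sub>o A)"
    and braid_natural: "A \<in> Obj C \<Longrightarrow> B \<in> Obj C \<Longrightarrow> A' \<in> Obj C \<Longrightarrow> B' \<in> Obj C \<Longrightarrow>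
          f \<in> Hom C A A' \<Longrightarrow> g \<in> Hom C B B' \<Longrightarrow> \<c> A' B' \<odot> (f \<boxtimes> g) = (g \<boxtimes> f) \<odot> \<c> A B"
    and hexagon: "A \<in> Obj C \<Longrightarrow> B \<in> Obj C \<Longrightarrow> D \<in> Obj C \<Longrightarrow>
          \<a> B D A \<odot> \<c> A (B \<otimes>\<^sub>o D) \<odot> \<a> A B D
            = (idt B \<boxtimes> \<c> A D) \<odot> \<a> B A D \<odot> (\<c> A B \<boxtimes> idt D)"
    and symmetric: "A \<in> Obj C \<Longrightarrow> B \<in> Obj C \<Longrightarrow> \<c> B A \<odot> \<c> A B = idt (A \<otimes>\<^sub>o B)"


section \<open>Weak braided Hopf algebras\<close>

context smc_data
begin

text \<open>
  The associativity constraints needed to apply a morphism to the two middle factors of a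
  fourfold tensor product: \<open>mid_in\<close> goes from \<open>(A \<otimes> B) \<otimes> (D \<otimes> E)\<close> to \<open>(A \<otimes> (B \<otimes> D)) \<otimes> E\<close>,
  and \<open>mid_out\<close> is its inverse.
\<close>

definition mid_in :: "'o \<Rightarrow> 'o \<Rightarrow> 'o \<Rightarrow> 'o \<Rightarrow> 'm" where
  "mid_in A B D E = (\<a> A B D \<boxtimes> idt E) \<odot> \<a>' (A \<otimes>\<^sub>o B) D E"

definition mid_out :: "'o \<Rightarrow> 'o \<Rightarrow> 'o \<Rightarrow> 'o \<Rightarrow> 'm" where
  "mid_out A B D E = \<a> (A \<otimes>\<^sub>o B) D E \<odot> (\<a>' A B D \<boxtimes> idt E)"

end

text \<open>
  All threefold tensor products below are bracketed to the left, and the unit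
  constraints are inserted as well.
\<close>

locale weak_braided_Hopf_algebra = symmetric_monoidal_category C for C :: "('o, 'm) smc" +
  fixes B :: 'o and m \<eta> \<Delta> \<epsilon> S :: 'm
  assumes B_in: "B \<in> Obj C"
    and mult_in: "m \<in> Hom C (B \<otimes>\<^sub>o B) B"
    and unit_arr_in: "\<eta> \<in> Hom C \<I> B"
    and comult_in: "\<Delta> \<in> Hom C B (B \<otimes>\<^sub>o B)"
    and counit_in: "\<epsilon> \<in> Hom C B \<I>"
    and antipode_in: "S \<in> Hom C B B"
    and mult_assoc: "m \<odot> (m \<boxtimes> idt B) = m \<odot> (idt B \<boxtimes> m) \<odot> \<a> B B B"
    and mult_unit_left: "m \<odot> (\<eta> \<boxtimes> idt B) = \<l> B"
    and mult_unit_right: "m \<odot> (idt B \<boxtimes> \<eta>) = \<r> B"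
    and comult_coassoc: "\<a> B B B \<odot> (\<Delta> \<boxtimes> idt B) \<odot> \<Delta> = (idt B \<boxtimes> \<Delta>) \<odot> \<Delta>"
    and counit_left: "\<l> B \<odot> (\<epsilon> \<boxtimes> idt B) \<odot> \<Delta> = idt B"
    and counit_right: "\<r> B \<odot> (idt B \<boxtimes> \<epsilon>) \<odot> \<Delta> = idt B"
    and comult_mult: "\<Delta> \<odot> m
          = (m \<boxtimes> m) \<odot> mid_out B B B B \<odot> ((idt B \<boxtimes> \<c> B B) \<boxtimes> idt B) \<odot> mid_in B B B B \<odot> (\<Delta> \<boxtimes> \<Delta>)"
    and counit_mult: "\<epsilon> \<odot> m \<odot> (m \<boxtimes> idt B)
          = \<l> \<I> \<odot> ((\<epsilon> \<odot> m) \<boxtimes> (\<epsilon> \<odot> m)) \<odot> mid_out B B B B \<odot> ((idt B \<boxtimes> \<Delta>) \<boxtimes> idt B)"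
    and counit_mult_braided: "\<epsilon> \<odot> m \<odot> (m \<boxtimes> idt B)
          = \<l> \<I> \<odot> ((\<epsilon> \<odot> m) \<boxtimes> (\<epsilon> \<odot> m)) \<odot> mid_out B B B B \<odot> ((idt B \<boxtimes> (\<c> B B \<odot> \<Delta>)) \<boxtimes> idt B)"
    and comult_unit: "(\<Delta> \<boxtimes> idt B) \<odot> \<Delta> \<odot> \<eta>
          = ((idt B \<boxtimes> m) \<boxtimes> idt B) \<odot> mid_in B B B B \<odot> ((\<Delta> \<odot> \<eta>) \<boxtimes> (\<Delta> \<odot> \<eta>)) \<odot> \<l>' \<I>"
    and comult_unit_braided: "(\<Delta> \<boxtimes> idt B) \<odot> \<Delta> \<odot> \<eta>
          = ((idt B \<boxtimes> (m \<odot> \<c> B B)) \<boxtimes> idt B) \<odot> mid_in B B B B \<odot> ((\<Delta> \<odot> \<eta>) \<boxtimes> (\<Delta> \<odot> \<eta>)) \<odot> \<l>' \<I>"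
    and antipode_left: "m \<odot> (idt B \<boxtimes> S) \<odot> \<Delta>
          = \<l> B \<odot> ((\<epsilon> \<odot> m) \<boxtimes> idt B) \<odot> \<a>' B B B \<odot> (idt B \<boxtimes> \<c> B B) \<odot> \<a> B B B
              \<odot> ((\<Delta> \<odot> \<eta>) \<boxtimes> idt B) \<odot> \<l>' B"
    and antipode_right: "m \<odot> (S \<boxtimes> idt B) \<odot> \<Delta>
          = \<r> B \<odot> (idt B \<boxtimes> (\<epsilon> \<odot> m)) \<odot> \<a> B B B \<odot> (\<c> B B \<boxtimes> idt B) \<odot> \<a>' B B B
              \<odot> (idt B \<boxtimes> (\<Delta> \<odot> \<eta>)) \<odot> \<r>' B"
    and antipode_conv: "m \<odot> (m \<boxtimes> idt B) \<odot> ((S \<boxtimes> idt B) \<boxtimes> S) \<odot> (\<Delta> \<boxtimes> idt B) \<odot> \<Delta> = S"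

definition (in smc_data) commutative_mult :: "'o \<Rightarrow> 'm \<Rightarrow> bool" where
  "commutative_mult B m \<longleftrightarrow> m \<odot> \<c> B B = m"

definition (in smc_data) cocommutative_comult :: "'o \<Rightarrow> 'm \<Rightarrow> bool" where
  "cocommutative_comult B \<Delta> \<longleftrightarrow> \<c> B B \<odot> \<Delta> = \<Delta>"


section \<open>Graded vector spaces\<close>

text \<open>
  Vector spaces are realised as subspaces of the function space \<open>k\<^sup>L\<close>, where the index set \<open>L\<close>
  carries a pairing, so that tensor products can be formed without leaving the universe:
  the pure tensor of \<open>v\<close> and \<open>w\<close> is the function \<open>(i, j) \<mapsto> v i * w j\<close>. Over a field the span of
  the pure tensors of two subspaces is their tensor product (this needs no finiteness of supports),
  and every vector space \<open>V\<close> embeds into a function space.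
\<close>

datatype 'a label = Triv | Base 'a | Join "'a label" "'a label"

type_synonym ('a, 'k) lvec = "'a label \<Rightarrow> 'k"

definition lscale :: "'k::field \<Rightarrow> ('a, 'k) lvec \<Rightarrow> ('a, 'k) lvec"  (infixr "*\<^sub>l" 75) where
  "c *\<^sub>l v = (\<lambda>i. c * v i)"

global_interpretation lv: vector_space "lscale :: 'k::field \<Rightarrow> ('a, 'k) lvec \<Rightarrow> ('a, 'k) lvec"
  by unfold_locales (auto simp: lscale_def algebra_simps)

definition lbasis :: "'a label \<Rightarrow> ('a, 'k::field) lvec" where
  "lbasis l = (\<lambda>i. if i = l then 1 else 0)"

definition ltensor :: "('a, 'k::field) lvec \<Rightarrow> ('a, 'k) lvec \<Rightarrow> ('a, 'k) lvec"
  (infixr "\<otimes>\<^sub>l" 70) where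
  "v \<otimes>\<^sub>l w = (\<lambda>l. case l of Join i j \<Rightarrow> v i * w j | _ \<Rightarrow> 0)"

text \<open>
  A graded space is the family of its homogeneous components, which are trivial outside the grading
  group and have a direct sum; \<open>G\<close> is meant to be finite.
\<close>

type_synonym ('g, 'a, 'k) gspace = "'g \<Rightarrow> ('a, 'k) lvec set"

definition gspaces :: "('g, 'b) monoid_scheme \<Rightarrow> ('g, 'a, 'k::field) gspace set" where
  "gspaces G = {V. (\<forall>x. lv.subspace (V x)) \<and> (\<forall>x. x \<notin> carrier G \<longrightarrow> V x = {0}) \<and>
     (\<forall>f. (\<forall>x \<in> carrier G. f x \<in> V x) \<and> (\<Sum>x \<in> carrier G. f x) = 0 \<longrightarrow> (\<forall>x \<in> carrier G. f x = 0))}"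

definition gtotal :: "('g, 'a, 'k::field) gspace \<Rightarrow> ('a, 'k) lvec set" where
  "gtotal V = lv.span (\<Union>x. V x)"

definition gtensor :: "('g, 'b) monoid_scheme \<Rightarrow>
    ('g, 'a, 'k::field) gspace \<Rightarrow> ('g, 'a, 'k) gspace \<Rightarrow> ('g, 'a, 'k) gspace" where
  "gtensor G V W = (\<lambda>z. lv.span {v \<otimes>\<^sub>l w | v w x y.
     x \<in> carrier G \<and> y \<in> carrier G \<and> x \<otimes>\<^bsub>G\<^esub> y = z \<and> v \<in> V x \<and> w \<in> W y})"

definition gunit :: "('g, 'b) monoid_scheme \<Rightarrow> ('g, 'a, 'k::field) gspace" where
  "gunit G = (\<lambda>x. if x = \<one>\<^bsub>G\<^esub> then lv.span {lbasis Triv} else {0})"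

definition group_alg :: "('g, 'b) monoid_scheme \<Rightarrow> ('g, 'g, 'k::field) gspace" where
  "group_alg G = (\<lambda>x. if x \<in> carrier G then lv.span {lbasis (Base x)} else {0})"

record ('g, 'a, 'k) garrow =
  gdom :: "('g, 'a, 'k) gspace"
  gcod :: "('g, 'a, 'k) gspace"
  gmap :: "('a, 'k) lvec \<Rightarrow> ('a, 'k) lvec"

definition ghom :: "('g, 'b) monoid_scheme \<Rightarrow>
    ('g, 'a, 'k::field) gspace \<Rightarrow> ('g, 'a, 'k) gspace \<Rightarrow> ('g, 'a, 'k) garrow set" where
  "ghom G V W = {f. gdom f = V \<and> gcod f = W \<and> gmap f \<in> extensional (gtotal V) \<and>
     (\<forall>v \<in> gtotal V. \<forall>w \<in> gtotal V. gmap f (v + w) = gmap f v + gmap f w) \<and>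
     (\<forall>c. \<forall>v \<in> gtotal V. gmap f (c *\<^sub>l v) = c *\<^sub>l gmap f v) \<and>
     (\<forall>x \<in> carrier G. \<forall>v \<in> V x. gmap f v \<in> W x)}"

definition gcomp :: "('g, 'a, 'k::field) garrow \<Rightarrow> ('g, 'a, 'k) garrow \<Rightarrow> ('g, 'a, 'k) garrow" where
  "gcomp g f = \<lparr>gdom = gdom f, gcod = gcod g, gmap = compose (gtotal (gdom f)) (gmap g) (gmap f)\<rparr>"

definition gident :: "('g, 'a, 'k::field) gspace \<Rightarrow> ('g, 'a, 'k) garrow" where
  "gident V = \<lparr>gdom = V, gcod = V, gmap = (\<lambda>v \<in> gtotal V. v)\<rparr>"

definition gtensor_arr :: "('g, 'b) monoid_scheme \<Rightarrow>
    ('g, 'a, 'k::field) garrow \<Rightarrow> ('g, 'a, 'k) garrow \<Rightarrow> ('g, 'a, 'k) garrow" where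
  "gtensor_arr G f g = (THE h. h \<in> ghom G (gtensor G (gdom f) (gdom g)) (gtensor G (gcod f) (gcod g)) \<and>
     (\<forall>v \<in> gtotal (gdom f). \<forall>w \<in> gtotal (gdom g). gmap h (v \<otimes>\<^sub>l w) = gmap f v \<otimes>\<^sub>l gmap g w))"

text \<open>Associators, unitors and braiding, for general scalar weights on homogeneous elements.\<close>

definition gassoc :: "('g, 'b) monoid_scheme \<Rightarrow> ('g \<Rightarrow> 'g \<Rightarrow> 'g \<Rightarrow> 'k::field) \<Rightarrow>
    ('g, 'a, 'k) gspace \<Rightarrow> ('g, 'a, 'k) gspace \<Rightarrow> ('g, 'a, 'k) gspace \<Rightarrow> ('g, 'a, 'k) garrow" where
  "gassoc G \<phi> U V W = (THE h. h \<in> ghom G (gtensor G (gtensor G U V) W) (gtensor G U (gtensor G V W)) \<and>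
     (\<forall>x \<in> carrier G. \<forall>y \<in> carrier G. \<forall>z \<in> carrier G. \<forall>u \<in> U x. \<forall>v \<in> V y. \<forall>w \<in> W z.
        gmap h ((u \<otimes>\<^sub>l v) \<otimes>\<^sub>l w) = \<phi> x y z *\<^sub>l (u \<otimes>\<^sub>l (v \<otimes>\<^sub>l w))))"

definition gassoc_inv :: "('g, 'b) monoid_scheme \<Rightarrow> ('g \<Rightarrow> 'g \<Rightarrow> 'g \<Rightarrow> 'k::field) \<Rightarrow>
    ('g, 'a, 'k) gspace \<Rightarrow> ('g, 'a, 'k) gspace \<Rightarrow> ('g, 'a, 'k) gspace \<Rightarrow> ('g, 'a, 'k) garrow" where
  "gassoc_inv G \<phi> U V W = (THE h. h \<in> ghom G (gtensor G U (gtensor G V W)) (gtensor G (gtensor G U V) W) \<and>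
     (\<forall>x \<in> carrier G. \<forall>y \<in> carrier G. \<forall>z \<in> carrier G. \<forall>u \<in> U x. \<forall>v \<in> V y. \<forall>w \<in> W z.
        gmap h (u \<otimes>\<^sub>l (v \<otimes>\<^sub>l w)) = inverse (\<phi> x y z) *\<^sub>l ((u \<otimes>\<^sub>l v) \<otimes>\<^sub>l w)))"

definition glunit :: "('g, 'b) monoid_scheme \<Rightarrow> ('g, 'a, 'k::field) gspace \<Rightarrow> ('g, 'a, 'k) garrow" where
  "glunit G V = (THE h. h \<in> ghom G (gtensor G (gunit G) V) V \<and>
     (\<forall>v \<in> gtotal V. gmap h (lbasis Triv \<otimes>\<^sub>l v) = v))"

definition glunit_inv :: "('g, 'b) monoid_scheme \<Rightarrow> ('g, 'a, 'k::field) gspace \<Rightarrow> ('g, 'a, 'k) garrow" where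
  "glunit_inv G V = \<lparr>gdom = V, gcod = gtensor G (gunit G) V, gmap = (\<lambda>v \<in> gtotal V. lbasis Triv \<otimes>\<^sub>l v)\<rparr>"

definition grunit :: "('g, 'b) monoid_scheme \<Rightarrow> ('g, 'a, 'k::field) gspace \<Rightarrow> ('g, 'a, 'k) garrow" where
  "grunit G V = (THE h. h \<in> ghom G (gtensor G V (gunit G)) V \<and>
     (\<forall>v \<in> gtotal V. gmap h (v \<otimes>\<^sub>l lbasis Triv) = v))"

definition grunit_inv :: "('g, 'b) monoid_scheme \<Rightarrow> ('g, 'a, 'k::field) gspace \<Rightarrow> ('g, 'a, 'k) garrow" where
  "grunit_inv G V = \<lparr>gdom = V, gcod = gtensor G V (gunit G), gmap = (\<lambda>v \<in> gtotal V. v \<otimes>\<^sub>l lbasis Triv)\<rparr>"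

definition gbraid :: "('g, 'b) monoid_scheme \<Rightarrow> ('g \<Rightarrow> 'g \<Rightarrow> 'k::field) \<Rightarrow>
    ('g, 'a, 'k) gspace \<Rightarrow> ('g, 'a, 'k) gspace \<Rightarrow> ('g, 'a, 'k) garrow" where
  "gbraid G r V W = (THE h. h \<in> ghom G (gtensor G V W) (gtensor G W V) \<and>
     (\<forall>x \<in> carrier G. \<forall>y \<in> carrier G. \<forall>v \<in> V x. \<forall>w \<in> W y.
        gmap h (v \<otimes>\<^sub>l w) = r x y *\<^sub>l (w \<otimes>\<^sub>l v)))"

definition twist_assoc :: "('g, 'b) monoid_scheme \<Rightarrow> ('g \<Rightarrow> 'g \<Rightarrow> 'k::field) \<Rightarrow> 'g \<Rightarrow> 'g \<Rightarrow> 'g \<Rightarrow> 'k" where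
  "twist_assoc G F x y z =
     inverse (F y z) * F (x \<otimes>\<^bsub>G\<^esub> y) z * inverse (F x (y \<otimes>\<^bsub>G\<^esub> z)) * F x y"

text \<open>\<open>Vect_twist G F\<close> is the category usually denoted \<open>Vect\<close> with superscript \<open>G\<close> and subscript
  \<open>F\<close> to the power \<open>-1\<close>.\<close>

definition Vect_twist :: "('g, 'b) monoid_scheme \<Rightarrow> ('g \<Rightarrow> 'g \<Rightarrow> 'k::field) \<Rightarrow>
    (('g, 'a, 'k) gspace, ('g, 'a, 'k) garrow) smc" where
  "Vect_twist G F = \<lparr>
     Obj = gspaces G, Hom = ghom G, Comp = gcomp, Ident = gident,
     TensO = gtensor G, TensA = gtensor_arr G, UnitO = gunit G,
     Assoc = gassoc G (twist_assoc G F), AssocInv = gassoc_inv G (twist_assoc G F),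
     LUnit = glunit G, LUnitInv = glunit_inv G, RUnit = grunit G, RUnitInv = grunit_inv G,
     Braid = gbraid G (\<lambda>x y. F x y * inverse (F y x))\<rparr>"

end

theory Submission
  imports "HOL-Computational_Algebra.Polynomial" "HOL-Algebra.Multiplicative_Group" Defs
begin

text \<open>The scalars in the statement disappear after a change of generators. For homogeneous \<open>v\<close>, \<open>w\<close> of
  degrees \<open>x\<close>, \<open>y\<close> put \<open>v \<odot> w = F(x, y)\<^sup>-\<^sup>1 v \<otimes> w\<close> (\<open>twtensor\<close>). The associator
  \<open>\<phi>(x, y, z) = F(y, z)\<^sup>-\<^sup>1 F(xy, z) F(x, yz)\<^sup>-\<^sup>1 F(x, y)\<close> is exactly what turns \<open>(u \<odot> v) \<odot> w\<close> into
  \<open>u \<odot> (v \<odot> w)\<close>, the braiding \<open>F(x, y) F(y, x)\<^sup>-\<^sup>1\<close> turns \<open>v \<odot> w\<close> into \<open>w \<odot> v\<close>, and, since \<open>F\<close> is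
  normalized, the unit constraints delete the basis vector of the unit object. So on these elements every structure morphism
  acts as in the untwisted category of graded vector spaces, and the coherence axioms, as well as the
  axioms of a weak Hopf algebra, become identities between bracketings of homogeneous elements
  (\<open>Vect_twist_symmetric_monoidal\<close>).

  In the new notation the structure on the group algebra is \<open>m(x \<odot> y) = xy\<close>,
  \<open>\<Delta>(x) = N\<^sup>-\<^sup>1 (\<Sum>uv=x. u \<odot> v)\<close> and \<open>\<epsilon>(x) = N \<delta>\<close>, with \<open>N\<close> the order of the group. This is
  the Frobenius algebra structure of a group algebra, rescaled so that \<open>m \<Delta> = id\<close>, and the axioms follow
  by reindexing sums over the group. The result holds for every finite abelian group, every normalized
  nowhere vanishing \<open>F\<close> and every field in which \<open>N\<close> is invertible
  (\<open>group_algebra_weak_braided_Hopf\<close>).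

  For the cyclic group it remains to see that \<open>F\<close> is normalized, that the formula for
  \<open>F(\<sigma>\<^sup>a, \<sigma>\<^sup>b)\<close> is valid for all integers \<open>b\<close>, which matters for the factor \<open>\<sigma>\<^sup>a\<^sup>-\<^sup>l\<close> of the
  coproduct, and that \<open>n\<close> is invertible in a field with a primitive \<open>n\<close>-th root of unity
  (\<open>primitive_root_order_nonzero\<close>).

  Tensor products, associators and braidings are given by definite descriptions of morphisms. Their
  existence rests on two facts of linear algebra: a linear map on a subspace extends to the whole function
  space (\<open>llinear_extend\<close>), and linear maps between function spaces have tensor products
  (\<open>llinear_tensor_map\<close>).\<close>

section \<open>Linear maps between function spaces\<close>

(* Vectors are functions; sums of vectors are not to be rewritten pointwise. *)
declare plus_fun_apply [simp del] zero_fun_apply [simp del]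

abbreviation llinear :: "(('a, 'k::field) lvec \<Rightarrow> ('a, 'k) lvec) \<Rightarrow> bool" where
  "llinear \<equiv> Vector_Spaces.linear lscale lscale"

interpretation lvp: vector_space_pair
  "lscale :: 'k::field \<Rightarrow> ('a, 'k) lvec \<Rightarrow> ('a, 'k) lvec"
  "lscale :: 'k::field \<Rightarrow> ('a, 'k) lvec \<Rightarrow> ('a, 'k) lvec"
  by unfold_locales

lemma llinearI:
  assumes "\<And>v w. L (v + w) = L v + L w" and "\<And>c v. L (c *\<^sub>l v) = c *\<^sub>l L v"
  shows "llinear L"
  using assms by unfold_locales auto

lemma llinear_id: "llinear (\<lambda>v. v)"
  by (rule llinearI) auto

lemma llinear_compose:
  assumes L: "llinear L" and M: "llinear M"
  shows "llinear (\<lambda>v. M (L v))"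
  by (rule llinearI)
    (simp_all only: lvp.linear_add[OF L] lvp.linear_add[OF M] lvp.linear_scale[OF L] lvp.linear_scale[OF M])

lemma llinear_zero: "llinear (\<lambda>v. 0)"
  by (rule llinearI) auto

lemma llinear_scale:
  assumes L: "llinear L"
  shows "llinear (\<lambda>v. c *\<^sub>l L v)"
  by (rule lvp.linear_compose_scale_right[OF L])

lemma llinear_coordinate: "llinear (\<lambda>v. v i *\<^sub>l w)"
  by (rule llinearI) (auto simp: lscale_def plus_fun_apply zero_fun_apply algebra_simps)

lemma llinear_sum: "(\<And>x. x \<in> A \<Longrightarrow> llinear (L x)) \<Longrightarrow> llinear (\<lambda>v. \<Sum>x\<in>A. L x v)"
  by (rule lvp.linear_compose_sum) auto

text \<open>Morphisms are linear maps on the total space of a graded space only. Working with an extension to the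
  whole function space avoids membership conditions when maps are composed and tensored.\<close>

lemma llinear_extend:
  assumes S: "lv.subspace S"
    and add: "\<And>v w. v \<in> S \<Longrightarrow> w \<in> S \<Longrightarrow> f (v + w) = f v + f w"
    and scale: "\<And>c v. v \<in> S \<Longrightarrow> f (c *\<^sub>l v) = c *\<^sub>l f v"
  obtains L where "llinear L" and "\<And>v. v \<in> S \<Longrightarrow> L v = f v"
proof -
  obtain B where B: "B \<subseteq> S" "lv.independent B" "S \<subseteq> lv.span B"
    by (rule lv.basis_exists[of S])
  obtain L where L: "llinear L" "\<forall>x\<in>B. L x = f x"
    using lvp.linear_independent_extend[OF B(2), of f] by (elim exE conjE)
  have f0: "f 0 = 0"
    using scale[of 0 0] lv.subspace_0[OF S] by simp
  have "v \<in> S \<and> L v = f v" if "v \<in> lv.span B" for v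
    using that
  proof (induction rule: lv.span_induct_alt)
    case base
    then show ?case by (simp add: f0 lvp.linear_0[OF L(1)] lv.subspace_0[OF S])
  next
    case (step c x y)
    then have "x \<in> S" "L x = f x" using B(1) L(2) by auto
    then show ?case using step
      by (simp add: add scale lvp.linear_add[OF L(1)] lvp.linear_scale[OF L(1)]
        lv.subspace_add[OF S] lv.subspace_scale[OF S])
  qed
  then show thesis by (intro that[OF L(1)]) (use B(3) in auto)
qed

lemma ltensor_add_left: "(v + v') \<otimes>\<^sub>l w = v \<otimes>\<^sub>l w + v' \<otimes>\<^sub>l w"
  and ltensor_add_right: "v \<otimes>\<^sub>l (w + w') = v \<otimes>\<^sub>l w + v \<otimes>\<^sub>l w'"
  and ltensor_scale_left: "(c *\<^sub>l v) \<otimes>\<^sub>l w = c *\<^sub>l (v \<otimes>\<^sub>l w)"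
  and ltensor_scale_right: "v \<otimes>\<^sub>l (c *\<^sub>l w) = c *\<^sub>l (v \<otimes>\<^sub>l w)"
  by (auto simp: ltensor_def lscale_def plus_fun_apply zero_fun_apply algebra_simps fun_eq_iff split: label.split)

lemma llinear_ltensor_left: "llinear (\<lambda>v. v \<otimes>\<^sub>l w)"
  and llinear_ltensor_right: "llinear (\<lambda>w. v \<otimes>\<^sub>l w)"
  by (auto intro!: llinearI simp: ltensor_add_left ltensor_add_right
      ltensor_scale_left ltensor_scale_right)

lemma ltensor_zero [simp]: "0 \<otimes>\<^sub>l w = 0" "v \<otimes>\<^sub>l 0 = 0"
  using lvp.linear_0[OF llinear_ltensor_left[of w]] lvp.linear_0[OF llinear_ltensor_right[of v]]
  by simp_all

text \<open>No bases are needed here: \<open>L \<otimes> id\<close> applies \<open>L\<close> to every column \<open>\<lambda>i. f (Join i j)\<close> of a function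
  \<open>f\<close>, which makes sense, and is linear, also for functions that are not sums of pure tensors.\<close>

lemma llinear_tensor_map:
  assumes L: "llinear L" and M: "llinear M"
  shows "\<exists>H. llinear H \<and> (\<forall>v w. H (v \<otimes>\<^sub>l w) = L v \<otimes>\<^sub>l M w)"
proof -
  (* P is L on columns and Q is M on rows. *)
  define P where "P f = (\<lambda>l. case l of Join i j \<Rightarrow> L (\<lambda>i'. f (Join i' j)) i | _ \<Rightarrow> 0)" for f
  define Q where "Q f = (\<lambda>l. case l of Join i j \<Rightarrow> M (\<lambda>j'. f (Join i j')) j | _ \<Rightarrow> 0)" for f
  have "llinear P"
  proof (rule llinearI)
    show "P (v + w) = P v + P w" for v w
      using lvp.linear_add[OF L]
      by (auto simp: P_def fun_eq_iff plus_fun_def split: label.split)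
    show "P (c *\<^sub>l v) = c *\<^sub>l P v" for c v
      using lvp.linear_scale[OF L]
      by (auto simp: P_def fun_eq_iff lscale_def plus_fun_apply zero_fun_apply split: label.split)
  qed
  moreover have "llinear Q"
  proof (rule llinearI)
    show "Q (v + w) = Q v + Q w" for v w
      using lvp.linear_add[OF M]
      by (auto simp: Q_def fun_eq_iff plus_fun_def split: label.split)
    show "Q (c *\<^sub>l v) = c *\<^sub>l Q v" for c v
      using lvp.linear_scale[OF M]
      by (auto simp: Q_def fun_eq_iff lscale_def plus_fun_apply zero_fun_apply split: label.split)
  qed
  ultimately have "llinear (\<lambda>f. P (Q f))"
    by (simp add: llinear_compose[of Q P])
  moreover have "P (v \<otimes>\<^sub>l w) = L v \<otimes>\<^sub>l w" for v w
  proof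
    fix l
    have "L (\<lambda>i'. v i' * w j) i = L v i * w j" for i j
      using fun_cong[OF lvp.linear_scale[OF L, of "w j" v], of i]
      by (simp add: lscale_def plus_fun_apply zero_fun_apply mult.commute)
    then show "P (v \<otimes>\<^sub>l w) l = (L v \<otimes>\<^sub>l w) l"
      by (cases l) (simp_all add: P_def ltensor_def)
  qed
  moreover have "Q (v \<otimes>\<^sub>l w) = v \<otimes>\<^sub>l M w" for v w
  proof
    fix l
    have "M (\<lambda>j'. v i * w j') j = v i * M w j" for i j
      using fun_cong[OF lvp.linear_scale[OF M, of "v i" w], of j]
      by (simp add: lscale_def plus_fun_apply zero_fun_apply)
    then show "Q (v \<otimes>\<^sub>l w) l = (v \<otimes>\<^sub>l M w) l"
      by (cases l) (simp_all add: Q_def ltensor_def)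
  qed
  ultimately show ?thesis by (intro exI[of _ "\<lambda>f. P (Q f)"]) simp
qed

text \<open>The symmetry and the reassociation of tensors permute labels, hence arise by reading off a function
  along a partial map of labels.\<close>

lemma llinear_relabel: "llinear (\<lambda>v l. case h l of Some i \<Rightarrow> v i | None \<Rightarrow> 0)"
  by (rule llinearI) (auto simp: lscale_def plus_fun_apply zero_fun_apply fun_eq_iff split: option.split)

lemma llinear_swap:
  "\<exists>H. llinear H \<and> (\<forall>v w. H (v \<otimes>\<^sub>l w) = w \<otimes>\<^sub>l v)"
proof (intro exI conjI allI)
  let ?h = "\<lambda>l. case l of Join i j \<Rightarrow> Some (Join j i) | _ \<Rightarrow> None"
  show "llinear (\<lambda>v l. case ?h l of Some i \<Rightarrow> v i | None \<Rightarrow> 0)"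
    by (rule llinear_relabel)
  show "(\<lambda>l. case ?h l of Some i \<Rightarrow> (v \<otimes>\<^sub>l w) i | None \<Rightarrow> 0) = w \<otimes>\<^sub>l v" for v w :: "('a, 'b) lvec"
    by (auto simp: ltensor_def fun_eq_iff split: label.split)
qed

lemma llinear_assoc:
  "\<exists>H. llinear H \<and> (\<forall>u v w. H ((u \<otimes>\<^sub>l v) \<otimes>\<^sub>l w) = u \<otimes>\<^sub>l (v \<otimes>\<^sub>l w))"
proof (intro exI conjI allI)
  let ?h = "\<lambda>l. case l of Join i (Join j k) \<Rightarrow> Some (Join (Join i j) k) | _ \<Rightarrow> None"
  show "llinear (\<lambda>v l. case ?h l of Some i \<Rightarrow> v i | None \<Rightarrow> 0)"
    by (rule llinear_relabel)
  show "(\<lambda>l. case ?h l of Some i \<Rightarrow> ((u \<otimes>\<^sub>l v) \<otimes>\<^sub>l w) i | None \<Rightarrow> 0) = u \<otimes>\<^sub>l (v \<otimes>\<^sub>l w)"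
    for u v w :: "('a, 'b) lvec"
    by (auto simp: ltensor_def fun_eq_iff split: label.split)
qed

lemma llinear_assoc_inv:
  "\<exists>H. llinear H \<and> (\<forall>u v w. H (u \<otimes>\<^sub>l (v \<otimes>\<^sub>l w)) = (u \<otimes>\<^sub>l v) \<otimes>\<^sub>l w)"
proof (intro exI conjI allI)
  let ?h = "\<lambda>l. case l of Join (Join i j) k \<Rightarrow> Some (Join i (Join j k)) | _ \<Rightarrow> None"
  show "llinear (\<lambda>v l. case ?h l of Some i \<Rightarrow> v i | None \<Rightarrow> 0)"
    by (rule llinear_relabel)
  show "(\<lambda>l. case ?h l of Some i \<Rightarrow> (u \<otimes>\<^sub>l (v \<otimes>\<^sub>l w)) i | None \<Rightarrow> 0) = (u \<otimes>\<^sub>l v) \<otimes>\<^sub>l w"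
    for u v w :: "('a, 'b) lvec"
    by (auto simp: ltensor_def fun_eq_iff split: label.split)
qed

lemma llinear_cancel_left_unit:
  "\<exists>H. llinear H \<and> (\<forall>v. H (lbasis Triv \<otimes>\<^sub>l v) = v)"
proof (intro exI conjI allI)
  show "llinear (\<lambda>v i. v (Join Triv i))"
    by (auto intro!: llinearI simp: lscale_def plus_fun_apply zero_fun_apply)
  show "(\<lambda>i. (lbasis Triv \<otimes>\<^sub>l v) (Join Triv i)) = v" for v :: "('a, 'b) lvec"
    by (auto simp: ltensor_def lbasis_def)
qed

lemma llinear_cancel_right_unit:
  "\<exists>H. llinear H \<and> (\<forall>v. H (v \<otimes>\<^sub>l lbasis Triv) = v)"
proof (intro exI conjI allI)
  show "llinear (\<lambda>v i. v (Join i Triv))"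
    by (auto intro!: llinearI simp: lscale_def plus_fun_apply zero_fun_apply)
  show "(\<lambda>i. (v \<otimes>\<^sub>l lbasis Triv) (Join i Triv)) = v" for v :: "('a, 'b) lvec"
    by (auto simp: ltensor_def lbasis_def)
qed

section \<open>Graded spaces and their morphisms\<close>

lemma gspaces_subspace: "V \<in> gspaces G \<Longrightarrow> lv.subspace (V x)"
  and gspaces_outside: "V \<in> gspaces G \<Longrightarrow> x \<notin> carrier G \<Longrightarrow> V x = {0}"
  unfolding gspaces_def mem_Collect_eq by (elim conjE allE[of _ x], simp)+

lemma gspaces_direct:
  assumes "V \<in> gspaces G" and "\<And>x. x \<in> carrier G \<Longrightarrow> f x \<in> V x"
    and "(\<Sum>x\<in>carrier G. f x) = 0" and "x \<in> carrier G"
  shows "f x = 0"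
  using assms(1) unfolding gspaces_def mem_Collect_eq
  by (elim conjE allE[of _ f]) (simp add: assms(2-4))

lemma gtotal_subspace: "lv.subspace (gtotal V)"
  by (simp add: gtotal_def)

lemma in_gtotal: "v \<in> V x \<Longrightarrow> v \<in> gtotal V"
  unfolding gtotal_def by (rule lv.span_base) auto

lemma gtotal_minimal: "lv.subspace S \<Longrightarrow> (\<And>x. V x \<subseteq> S) \<Longrightarrow> gtotal V \<subseteq> S"
  unfolding gtotal_def by (intro lv.span_minimal) auto

definition garr ::
  "('g, 'a, 'k::field) gspace \<Rightarrow> ('g, 'a, 'k) gspace \<Rightarrow> (('a, 'k) lvec \<Rightarrow> ('a, 'k) lvec) \<Rightarrow> ('g, 'a, 'k) garrow"
  where "garr V W L = \<lparr>gdom = V, gcod = W, gmap = restrict L (gtotal V)\<rparr>"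

lemma gmap_garr: "v \<in> gtotal V \<Longrightarrow> gmap (garr V W L) v = L v"
  by (simp add: garr_def)

lemma garr_in_ghom:
  assumes L: "llinear L" and deg: "\<And>x v. x \<in> carrier G \<Longrightarrow> v \<in> V x \<Longrightarrow> L v \<in> W x"
  shows "garr V W L \<in> ghom G V W"
  unfolding ghom_def mem_Collect_eq
proof (intro conjI ballI allI)
  show "gmap (garr V W L) (v + w) = gmap (garr V W L) v + gmap (garr V W L) w"
    if "v \<in> gtotal V" "w \<in> gtotal V" for v w
    using that lv.subspace_add[OF gtotal_subspace that]
    by (simp add: gmap_garr lvp.linear_add[OF L])
  show "gmap (garr V W L) (c *\<^sub>l v) = c *\<^sub>l gmap (garr V W L) v" if "v \<in> gtotal V" for c v
    using that lv.subspace_scale[OF gtotal_subspace that]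
    by (simp add: gmap_garr lvp.linear_scale[OF L])
  show "gmap (garr V W L) v \<in> W x" if "x \<in> carrier G" "v \<in> V x" for x v
    using deg[OF that] by (simp add: gmap_garr in_gtotal[of v V, OF that(2)])
qed (simp_all add: garr_def)

lemma ghom_llinear:
  assumes "f \<in> ghom G V W"
  obtains L where "llinear L" and "\<And>v. v \<in> gtotal V \<Longrightarrow> gmap f v = L v"
proof (rule llinear_extend[OF gtotal_subspace[of V], of "gmap f"])
  show "gmap f (v + w) = gmap f v + gmap f w" if "v \<in> gtotal V" "w \<in> gtotal V" for v w
    using assms that by (simp add: ghom_def)
  show "gmap f (c *\<^sub>l v) = c *\<^sub>l gmap f v" if "v \<in> gtotal V" for c v
    using assms that by (simp add: ghom_def)
qed (metis that)

lemma ghom_degree: "f \<in> ghom G V W \<Longrightarrow> x \<in> carrier G \<Longrightarrow> v \<in> V x \<Longrightarrow> gmap f v \<in> W x"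
  by (simp add: ghom_def)

lemma ghom_gdom: "f \<in> ghom G V W \<Longrightarrow> gdom f = V"
  and ghom_gcod: "f \<in> ghom G V W \<Longrightarrow> gcod f = W"
  by (simp_all add: ghom_def)

lemma ghom_scale: "f \<in> ghom G V W \<Longrightarrow> v \<in> gtotal V \<Longrightarrow> gmap f (c *\<^sub>l v) = c *\<^sub>l gmap f v"
  by (simp add: ghom_def)

lemma ghom_sum:
  assumes f: "f \<in> ghom G V W" and v: "\<And>i. i \<in> I \<Longrightarrow> v i \<in> gtotal V"
  shows "gmap f (\<Sum>i\<in>I. v i) = (\<Sum>i\<in>I. gmap f (v i))"
proof -
  obtain L where L: "llinear L" "\<And>v. v \<in> gtotal V \<Longrightarrow> gmap f v = L v"
    using ghom_llinear[OF f] by metis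
  have "(\<Sum>i\<in>I. v i) \<in> gtotal V"
    by (rule lv.subspace_sum[OF gtotal_subspace]) (rule v)
  then show ?thesis
    using v by (simp add: L(2) lvp.linear_sum[OF L(1)])
qed

text \<open>Elements outside the homogeneous components need no check, because morphisms are linear and extensional.\<close>

lemma ghom_eqI:
  assumes V: "V \<in> gspaces G" and f: "f \<in> ghom G V W" and g: "g \<in> ghom G V W"
    and eq: "\<And>x v. x \<in> carrier G \<Longrightarrow> v \<in> V x \<Longrightarrow> gmap f v = gmap g v"
  shows "f = g"
proof -
  obtain L where L: "llinear L" "\<And>v. v \<in> gtotal V \<Longrightarrow> gmap f v = L v"
    using ghom_llinear[OF f] by metis
  obtain M where M: "llinear M" "\<And>v. v \<in> gtotal V \<Longrightarrow> gmap g v = M v"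
    using ghom_llinear[OF g] by metis
  have "L b = M b" if b: "b \<in> (\<Union>x. V x)" for b
  proof -
    obtain x where x: "b \<in> V x" using b by auto
    show ?thesis
    proof (cases "x \<in> carrier G")
      case True
      then show ?thesis using eq[OF True x] L(2) M(2) in_gtotal[of b V, OF x] by simp
    next
      case False
      then have "b = 0" using gspaces_outside[OF V] x by auto
      then show ?thesis by (simp add: lvp.linear_0[OF L(1)] lvp.linear_0[OF M(1)])
    qed
  qed
  then have "L v = M v" if "v \<in> gtotal V" for v
    using that unfolding gtotal_def by (rule lvp.linear_eq_on[OF L(1) M(1), rotated])
  then have "gmap f = gmap g"
    using f g L(2) M(2) by (intro extensionalityI[of _ "gtotal V"]) (auto simp: ghom_def)
  then show ?thesis
    using f g by (simp add: ghom_def)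
qed

lemma ghom_gtotal:
  assumes f: "f \<in> ghom G V W" and V: "V \<in> gspaces G" and v: "v \<in> gtotal V"
  shows "gmap f v \<in> gtotal W"
proof -
  obtain L where L: "llinear L" "\<And>v. v \<in> gtotal V \<Longrightarrow> gmap f v = L v"
    using ghom_llinear[OF f] by metis
  have "V x \<subseteq> {v. L v \<in> gtotal W}" for x
  proof (cases "x \<in> carrier G")
    case True
    show ?thesis
    proof
      fix v assume v: "v \<in> V x"
      have "L v \<in> W x"
        using ghom_degree[OF f True v] L(2)[OF in_gtotal[of v V, OF v]] by simp
      then show "v \<in> {v. L v \<in> gtotal W}" by (simp add: in_gtotal)
    qed
  next
    case False
    then show ?thesis
      by (simp add: gspaces_outside[OF V] lvp.linear_0[OF L(1)] lv.subspace_0[OF gtotal_subspace])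
  qed
  then have "gtotal V \<subseteq> {v. L v \<in> gtotal W}"
    by (intro gtotal_minimal lvp.linear_subspace_linear_preimage[OF L(1)] gtotal_subspace)
  then show ?thesis using v L(2)[OF v] by auto
qed

lemma gmap_gcomp: "f \<in> ghom G U V \<Longrightarrow> v \<in> gtotal U \<Longrightarrow> gmap (gcomp g f) v = gmap g (gmap f v)"
  by (simp add: gcomp_def ghom_gdom compose_def)

lemma gcomp_in_ghom:
  assumes f: "f \<in> ghom G U V" and g: "g \<in> ghom G V W" and U: "U \<in> gspaces G"
  shows "gcomp g f \<in> ghom G U W"
  unfolding ghom_def mem_Collect_eq
proof (intro conjI ballI allI)
  show "gmap (gcomp g f) (v + w) = gmap (gcomp g f) v + gmap (gcomp g f) w"
    if "v \<in> gtotal U" "w \<in> gtotal U" for v w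
    using that lv.subspace_add[OF gtotal_subspace that] ghom_gtotal[OF f U] f g
    by (simp add: gmap_gcomp[OF f]) (simp add: ghom_def)
  show "gmap (gcomp g f) (c *\<^sub>l v) = c *\<^sub>l gmap (gcomp g f) v" if "v \<in> gtotal U" for c v
    using that lv.subspace_scale[OF gtotal_subspace that] ghom_gtotal[OF f U] f g
    by (simp add: gmap_gcomp[OF f]) (simp add: ghom_def)
  show "gmap (gcomp g f) v \<in> W x" if "x \<in> carrier G" "v \<in> U x" for x v
    using ghom_degree[OF g that(1) ghom_degree[OF f that]]
    by (simp add: gmap_gcomp[OF f] in_gtotal[of v U, OF that(2)])
  show "gmap (gcomp g f) \<in> extensional (gtotal U)"
    by (simp add: gcomp_def ghom_gdom[OF f])
  show "gdom (gcomp g f) = U" "gcod (gcomp g f) = W"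
    by (simp_all add: gcomp_def ghom_gdom[OF f] ghom_gcod[OF g])
qed

lemma gident_garr: "gident V = garr V V (\<lambda>v. v)"
  by (simp add: gident_def garr_def)

lemma gident_in_ghom: "gident V \<in> ghom G V V"
  unfolding gident_garr by (rule garr_in_ghom) (auto intro: llinear_id)

text \<open>Applying \<open>p x\<close> to a relation \<open>(\<Sum>x. f x) = 0\<close> isolates \<open>f x\<close>. For a tensor product
  projections are easier to come by than a proof of directness.\<close>

lemma gspacesI:
  assumes "\<And>x. lv.subspace (V x)" and "\<And>x. x \<notin> carrier G \<Longrightarrow> V x = {0}"
    and fin: "finite (carrier G)"
    and p: "\<And>x. x \<in> carrier G \<Longrightarrow> llinear (p x)"
      "\<And>x y v. x \<in> carrier G \<Longrightarrow> y \<in> carrier G \<Longrightarrow> v \<in> V y \<Longrightarrow> p x v = (if x = y then v else 0)"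
  shows "V \<in> gspaces G"
proof -
  have "f x = 0" if f: "\<forall>x\<in>carrier G. f x \<in> V x" "(\<Sum>x\<in>carrier G. f x) = 0" and x: "x \<in> carrier G" for f x
  proof -
    have "0 = p x (\<Sum>y\<in>carrier G. f y)"
      by (simp add: f(2) lvp.linear_0[OF p(1)[OF x]])
    also have "\<dots> = (\<Sum>y\<in>carrier G. if x = y then f y else 0)"
      using f(1) x by (simp add: lvp.linear_sum[OF p(1)[OF x]] p(2) cong: sum.cong)
    also have "\<dots> = f x" using x fin by simp
    finally show ?thesis by simp
  qed
  then show ?thesis using assms(1,2) by (auto simp: gspaces_def)
qed

text \<open>The homogeneous components of a vector of the total space are unique and therefore depend linearly on it.\<close>

lemma gspaces_projections:
  assumes V: "V \<in> gspaces G" and fin: "finite (carrier G)"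
  obtains p where "\<And>x. x \<in> carrier G \<Longrightarrow> llinear (p x)"
    and "\<And>x y v. x \<in> carrier G \<Longrightarrow> y \<in> carrier G \<Longrightarrow> v \<in> V y \<Longrightarrow> p x v = (if x = y then v else 0)"
proof -
  define D where "D v f \<longleftrightarrow> (\<forall>x\<in>carrier G. f x \<in> V x) \<and> v = (\<Sum>x\<in>carrier G. f x)" for v f
  note sub = gspaces_subspace[OF V]
  have uniq: "f x = g x" if "D v f" "D v g" "x \<in> carrier G" for v f g x
    using gspaces_direct[OF V, of "\<lambda>x. f x - g x" x] that lv.subspace_diff[OF sub]
    by (simp add: D_def sum_subtractf)
  have D0: "D 0 (\<lambda>x. 0)"
    using lv.subspace_0[OF sub] by (simp add: D_def)
  have Dadd: "D (v + w) (\<lambda>x. f x + g x)" if "D v f" "D w g" for v w f g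
    using that lv.subspace_add[OF sub] by (simp add: D_def sum.distrib)
  have Dscale: "D (c *\<^sub>l v) (\<lambda>x. c *\<^sub>l f x)" if "D v f" for c v f
    using that lv.subspace_scale[OF sub] by (simp add: D_def lv.scale_sum_right)
  have Dhom: "D v (\<lambda>x. if x = y then v else 0)" if "y \<in> carrier G" "v \<in> V y" for y v
    using that lv.subspace_0[OF sub] fin by (auto simp: D_def)
  have "lv.subspace {v. \<exists>f. D v f}"
  proof (rule lv.subspaceI)
    show "0 \<in> {v. \<exists>f. D v f}" using D0 by blast
  next
    fix v w assume "v \<in> {v. \<exists>f. D v f}" "w \<in> {v. \<exists>f. D v f}"
    then obtain f g where "D v f" "D w g" by blast
    from Dadd[OF this] show "v + w \<in> {v. \<exists>f. D v f}" by blast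
  next
    fix c v assume "v \<in> {v. \<exists>f. D v f}"
    then obtain f where "D v f" by blast
    from Dscale[OF this] show "c *\<^sub>l v \<in> {v. \<exists>f. D v f}" by blast
  qed
  moreover have "V x \<subseteq> {v. \<exists>f. D v f}" for x
  proof (cases "x \<in> carrier G")
    case True
    then show ?thesis using Dhom by blast
  next
    case False
    then show ?thesis using gspaces_outside[OF V] D0 by auto
  qed
  ultimately have "gtotal V \<subseteq> {v. \<exists>f. D v f}"
    by (rule gtotal_minimal)
  then have ex: "\<exists>f. D v f" if "v \<in> gtotal V" for v
    using that by blast
  define c where "c v = (SOME f. D v f)" for v
  have c: "D v (c v)" if "v \<in> gtotal V" for v
    unfolding c_def by (rule someI_ex[OF ex[OF that]])
  have c_eq: "c v x = f x" if "v \<in> gtotal V" "D v f" "x \<in> carrier G" for v f x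
    using uniq[OF c[OF that(1)] that(2,3)] .
  have "\<exists>L. llinear L \<and> (\<forall>v\<in>gtotal V. L v = c v x)" if x: "x \<in> carrier G" for x
  proof -
    have add: "c (v + w) x = c v x + c w x" if "v \<in> gtotal V" "w \<in> gtotal V" for v w
      by (rule c_eq[OF lv.subspace_add[OF gtotal_subspace that] Dadd[OF c[OF that(1)] c[OF that(2)]] x])
    have scale: "c (a *\<^sub>l v) x = a *\<^sub>l c v x" if "v \<in> gtotal V" for a v
      by (rule c_eq[OF lv.subspace_scale[OF gtotal_subspace that] Dscale[OF c[OF that]] x])
    show ?thesis
      using llinear_extend[OF gtotal_subspace add scale] by metis
  qed
  then have "\<exists>p. \<forall>x\<in>carrier G. llinear (p x) \<and> (\<forall>v\<in>gtotal V. p x v = c v x)"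
    by (intro bchoice ballI)
  then obtain p where p: "\<forall>x\<in>carrier G. llinear (p x) \<and> (\<forall>v\<in>gtotal V. p x v = c v x)"
    by (elim exE)
  show thesis
  proof (rule that[of p])
    show "llinear (p x)" if "x \<in> carrier G" for x using p that by simp
    show "p x v = (if x = y then v else 0)" if "x \<in> carrier G" "y \<in> carrier G" "v \<in> V y" for x y v
      using p that c_eq[OF in_gtotal[of v V y] Dhom[OF that(2,3)] that(1)] in_gtotal[of v V y]
      by simp
  qed
qed

section \<open>Tensor products of graded spaces\<close>

lemma gtensor_subspace: "lv.subspace (gtensor G V W z)"
  by (simp add: gtensor_def)

lemma gtensor_mem:
  "x \<in> carrier G \<Longrightarrow> y \<in> carrier G \<Longrightarrow> x \<otimes>\<^bsub>G\<^esub> y = z \<Longrightarrow> v \<in> V x \<Longrightarrow> w \<in> W y \<Longrightarrow>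
    v \<otimes>\<^sub>l w \<in> gtensor G V W z"
  unfolding gtensor_def by (rule lv.span_base) blast

text \<open>The two induction principles for tensor products: what a linear map does on homogeneous pure tensors
  determines it, and controls where it goes, on each homogeneous component.\<close>

lemma gtensor_map_into:
  assumes L: "llinear L" and S: "lv.subspace S"
    and gen: "\<And>x y v w. x \<in> carrier G \<Longrightarrow> y \<in> carrier G \<Longrightarrow> x \<otimes>\<^bsub>G\<^esub> y = z \<Longrightarrow>
      v \<in> V x \<Longrightarrow> w \<in> W y \<Longrightarrow> L (v \<otimes>\<^sub>l w) \<in> S"
    and t: "t \<in> gtensor G V W z"
  shows "L t \<in> S"
proof -
  have "gtensor G V W z \<subseteq> {t. L t \<in> S}"
    unfolding gtensor_def
  proof (rule lv.span_minimal)
    show "lv.subspace {t. L t \<in> S}" by (rule lvp.linear_subspace_linear_preimage[OF L S])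
  qed (use gen in blast)
  then show ?thesis using t by blast
qed

lemma gtensor_map_eq:
  assumes L: "llinear L" and M: "llinear M"
    and gen: "\<And>x y v w. x \<in> carrier G \<Longrightarrow> y \<in> carrier G \<Longrightarrow> x \<otimes>\<^bsub>G\<^esub> y = z \<Longrightarrow>
      v \<in> V x \<Longrightarrow> w \<in> W y \<Longrightarrow> L (v \<otimes>\<^sub>l w) = M (v \<otimes>\<^sub>l w)"
    and t: "t \<in> gtensor G V W z"
  shows "L t = M t"
proof -
  have "L t - M t \<in> {0}"
    by (rule gtensor_map_into[OF lvp.linear_compose_sub[OF L M] _ _ t, of "{0}"]) (simp_all add: gen)
  then show ?thesis by simp
qed

lemma ltensor_in_gtotal:
  assumes V: "V \<in> gspaces G" and W: "W \<in> gspaces G" and v: "v \<in> gtotal V" and w: "w \<in> gtotal W"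
    and G: "monoid G"
  shows "v \<otimes>\<^sub>l w \<in> gtotal (gtensor G V W)"
proof -
  let ?T = "gtotal (gtensor G V W)"
  have hom: "v \<otimes>\<^sub>l w \<in> ?T" if vx: "v \<in> V x" and wy: "w \<in> W y" for v w x y
  proof (cases "x \<in> carrier G \<and> y \<in> carrier G")
    case True
    then show ?thesis
      by (intro in_gtotal[of _ _ "x \<otimes>\<^bsub>G\<^esub> y"] gtensor_mem[of x G y _ v V w W] vx wy) simp_all
  next
    case False
    then have "v = 0 \<or> w = 0"
      using vx wy gspaces_outside[OF V, of x] gspaces_outside[OF W, of y] by (cases "x \<in> carrier G") auto
    then show ?thesis using lv.subspace_0[OF gtotal_subspace] by (elim disjE) simp_all
  qed
  have "gtotal W \<subseteq> {w. v \<otimes>\<^sub>l w \<in> ?T}" if v: "v \<in> V x" for v x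
    by (intro gtotal_minimal lvp.linear_subspace_linear_preimage[OF llinear_ltensor_right] gtotal_subspace
        subsetI CollectI) (rule hom[OF v])
  then have "V x \<subseteq> {v. v \<otimes>\<^sub>l w \<in> ?T}" for x using w by blast
  then have "gtotal V \<subseteq> {v. v \<otimes>\<^sub>l w \<in> ?T}"
    by (intro gtotal_minimal lvp.linear_subspace_linear_preimage[OF llinear_ltensor_left] gtotal_subspace)
  then show ?thesis using v by blast
qed

locale finite_grading = comm_group G for G :: "('g, 'b) monoid_scheme" (structure) +
  assumes finite_carrier: "finite (carrier G)"
begin

text \<open>The source of all scalars in associators and braidings. With projections \<open>p\<close> and \<open>q\<close> for the two
  gradings the map is \<open>\<Sum>x y. r x y (p x \<otimes> q y)\<close>.\<close>

lemma homogeneous_weights: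
  assumes V: "V \<in> gspaces G" and W: "W \<in> gspaces G"
  shows "\<exists>H. llinear H \<and> (\<forall>x\<in>carrier G. \<forall>y\<in>carrier G. \<forall>v\<in>V x. \<forall>w\<in>W y.
    H (v \<otimes>\<^sub>l w) = (r x y :: 'k::field) *\<^sub>l (v \<otimes>\<^sub>l w))"
proof -
  obtain p where p: "\<And>x. x \<in> carrier G \<Longrightarrow> llinear (p x)"
      "\<And>x y v. x \<in> carrier G \<Longrightarrow> y \<in> carrier G \<Longrightarrow> v \<in> V y \<Longrightarrow> p x v = (if x = y then v else 0)"
    using gspaces_projections[OF V finite_carrier] by metis
  obtain q where q: "\<And>x. x \<in> carrier G \<Longrightarrow> llinear (q x)"
      "\<And>x y v. x \<in> carrier G \<Longrightarrow> y \<in> carrier G \<Longrightarrow> v \<in> W y \<Longrightarrow> q x v = (if x = y then v else 0)"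
    using gspaces_projections[OF W finite_carrier] by metis
  define P where "P x y = (SOME H. llinear H \<and> (\<forall>v w. H (v \<otimes>\<^sub>l w) = p x v \<otimes>\<^sub>l q y w))" for x y
  have P: "llinear (P x y) \<and> (\<forall>v w. P x y (v \<otimes>\<^sub>l w) = p x v \<otimes>\<^sub>l q y w)"
    if "x \<in> carrier G" "y \<in> carrier G" for x y
    unfolding P_def
    by (rule someI_ex[OF llinear_tensor_map[OF p(1)[OF that(1)] q(1)[OF that(2)]]])
  define H where "H t = (\<Sum>x\<in>carrier G. \<Sum>y\<in>carrier G. r x y *\<^sub>l P x y t)" for t
  have "llinear H"
    unfolding H_def using P by (intro llinear_sum llinear_scale) simp
  moreover have "H (v \<otimes>\<^sub>l w) = r x y *\<^sub>l (v \<otimes>\<^sub>l w)"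
    if x: "x \<in> carrier G" and y: "y \<in> carrier G" and v: "v \<in> V x" and w: "w \<in> W y" for x y v w
  proof -
    have "H (v \<otimes>\<^sub>l w) = (\<Sum>x'\<in>carrier G. \<Sum>y'\<in>carrier G.
        if x' = x then (if y' = y then r x y *\<^sub>l (v \<otimes>\<^sub>l w) else 0) else 0)"
      unfolding H_def
      by (intro sum.cong refl) (simp add: P p(2)[OF _ x v] q(2)[OF _ y w])
    also have "\<dots> = (\<Sum>x'\<in>carrier G. if x' = x then r x y *\<^sub>l (v \<otimes>\<^sub>l w) else 0)"
      using y finite_carrier by (intro sum.cong refl) simp
    also have "\<dots> = r x y *\<^sub>l (v \<otimes>\<^sub>l w)"
      using x finite_carrier by simp
    finally show ?thesis .
  qed
  ultimately show ?thesis by (intro exI[of _ H]) simp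
qed

text \<open>The weights that are \<open>1\<close> in total degree \<open>z\<close> and \<open>0\<close> elsewhere give the projection onto degree \<open>z\<close>.\<close>

lemma gtensor_gspaces:
  assumes V: "V \<in> gspaces G" and W: "(W :: ('g, 'a, 'k::field) gspace) \<in> gspaces G"
  shows "gtensor G V W \<in> gspaces G"
proof -
  define P where "P z = (SOME H. llinear H \<and> (\<forall>x\<in>carrier G. \<forall>y\<in>carrier G. \<forall>v\<in>V x. \<forall>w\<in>W y.
    H (v \<otimes>\<^sub>l w) = (if x \<otimes> y = z then 1 else 0) *\<^sub>l (v \<otimes>\<^sub>l w)))" for z
  have P: "llinear (P z) \<and> (\<forall>x\<in>carrier G. \<forall>y\<in>carrier G. \<forall>v\<in>V x. \<forall>w\<in>W y.
    P z (v \<otimes>\<^sub>l w) = (if x \<otimes> y = z then 1 else 0) *\<^sub>l (v \<otimes>\<^sub>l w))" for z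
    unfolding P_def
    by (rule someI_ex[OF homogeneous_weights[OF V W, of "\<lambda>x y. if x \<otimes> y = z then 1 else 0"]])
  then have PL: "llinear (P z)" for z by simp
  show ?thesis
  proof (rule gspacesI[OF gtensor_subspace _ finite_carrier, where p = P])
    show "gtensor G V W z = {0}" if "z \<notin> carrier G" for z
    proof -
      have "{v \<otimes>\<^sub>l w |v w x y. x \<in> carrier G \<and> y \<in> carrier G \<and> x \<otimes> y = z \<and> v \<in> V x \<and> w \<in> W y} = {}"
        using that by auto
      then show ?thesis unfolding gtensor_def by (simp only: lv.span_empty)
    qed
    show "llinear (P z)" for z by (rule PL)
    show "P z t = (if z = z' then t else 0)"
      if "z \<in> carrier G" "z' \<in> carrier G" "t \<in> gtensor G V W z'" for z z' t
    proof (cases "z = z'")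
      case True
      have "P z t = (\<lambda>t. t) t"
        by (rule gtensor_map_eq[OF PL llinear_id _ that(3)]) (simp add: P True)
      then show ?thesis using True by simp
    next
      case False
      have "P z t = (\<lambda>t. 0) t"
        by (rule gtensor_map_eq[OF PL llinear_zero _ that(3)]) (use P False in simp)
      then show ?thesis using False by simp
    qed
  qed
qed

lemma gunit_gspaces: "(gunit G :: ('g, 'a, 'k::field) gspace) \<in> gspaces G"
proof (rule gspacesI[OF _ _ finite_carrier, of _ "\<lambda>x v. if x = \<one> then v else 0"])
  show "llinear (\<lambda>v. if x = \<one> then v else 0)" for x
    by (cases "x = \<one>") (simp_all add: llinear_id llinear_zero)
qed (auto simp: gunit_def)

lemma group_alg_gspaces: "(group_alg G :: ('g, 'g, 'k::field) gspace) \<in> gspaces G"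
proof (rule gspacesI[OF _ _ finite_carrier, of _ "\<lambda>x v. v (Base x) *\<^sub>l lbasis (Base x)"])
  show "llinear (\<lambda>v. v (Base x) *\<^sub>l lbasis (Base x))" for x
    by (rule llinear_coordinate[of "Base x" "lbasis (Base x)"])
  show "v (Base x) *\<^sub>l lbasis (Base x) = (if x = y then v else 0)"
    if "x \<in> carrier G" "y \<in> carrier G" "v \<in> group_alg G y" for x y and v :: "('g, 'k) lvec"
  proof -
    have "\<exists>c. v = c *\<^sub>l lbasis (Base y)"
      using that by (auto simp: group_alg_def lv.span_singleton)
    then obtain c where "v = c *\<^sub>l lbasis (Base y)" by (elim exE)
    then show ?thesis by (auto simp: lbasis_def lscale_def zero_fun_def)
  qed
qed (auto simp: group_alg_def)

end

section \<open>The twisted tensor of homogeneous elements\<close>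

text \<open>Normalization of \<open>F\<close> is the condition \<open>\<phi>(x, 1, z) = 1\<close> for the associator together with the scaling
  \<open>F(1, 1) = 1\<close>; it makes the trivial unit constraints coherent.\<close>

locale twisted_grading = finite_grading G for G :: "('g, 'b) monoid_scheme" (structure) +
  fixes F :: "'g \<Rightarrow> 'g \<Rightarrow> 'k::field"
  assumes F_nonzero: "x \<in> carrier G \<Longrightarrow> y \<in> carrier G \<Longrightarrow> F x y \<noteq> 0"
    and F_one_left [simp]: "x \<in> carrier G \<Longrightarrow> F \<one> x = 1"
    and F_one_right [simp]: "x \<in> carrier G \<Longrightarrow> F x \<one> = 1"
begin

text \<open>The tensor of homogeneous elements of degrees \<open>x\<close> and \<open>y\<close>, scaled such that no structure morphism
  of the twisted category produces a scalar. The degrees are arguments because \<open>0\<close> has every degree.\<close>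

definition twtensor :: "'g \<Rightarrow> 'g \<Rightarrow> ('a, 'k) lvec \<Rightarrow> ('a, 'k) lvec \<Rightarrow> ('a, 'k) lvec" where
  "twtensor x y v w = inverse (F x y) *\<^sub>l (v \<otimes>\<^sub>l w)"

lemma ltensor_twtensor: "x \<in> carrier G \<Longrightarrow> y \<in> carrier G \<Longrightarrow> v \<otimes>\<^sub>l w = F x y *\<^sub>l twtensor x y v w"
  by (simp add: twtensor_def F_nonzero)

lemma llinear_tt_left: "llinear (\<lambda>v. twtensor x y v w)"
  and llinear_tt_right: "llinear (\<lambda>w. twtensor x y v w)"
  unfolding twtensor_def by (intro llinear_scale llinear_ltensor_left llinear_ltensor_right)+

lemmas twtensor_scale_left = lvp.linear_scale[OF llinear_tt_left]
  and twtensor_scale_right = lvp.linear_scale[OF llinear_tt_right]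
  and twtensor_sum_left = lvp.linear_sum[OF llinear_tt_left]
  and twtensor_sum_right = lvp.linear_sum[OF llinear_tt_right]
  and twtensor_zero_left = lvp.linear_0[OF llinear_tt_left]
  and twtensor_zero_right = lvp.linear_0[OF llinear_tt_right]

lemma twtensor_mem:
  "x \<in> carrier G \<Longrightarrow> y \<in> carrier G \<Longrightarrow> v \<in> V x \<Longrightarrow> w \<in> W y \<Longrightarrow> x \<otimes> y = z \<Longrightarrow>
    twtensor x y v w \<in> gtensor G V W z"
  unfolding twtensor_def by (intro lv.subspace_scale[OF gtensor_subspace] gtensor_mem[of x G y z v V w W])

lemma twtensor_gtotal:
  "V \<in> gspaces G \<Longrightarrow> W \<in> gspaces G \<Longrightarrow> v \<in> gtotal V \<Longrightarrow> w \<in> gtotal W \<Longrightarrow>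
    twtensor x y v w \<in> gtotal (gtensor G V W)"
  unfolding twtensor_def by (intro lv.subspace_scale[OF gtotal_subspace] ltensor_in_gtotal is_monoid)

lemma gtensor_map_eq_twtensor:
  assumes L: "llinear L" and M: "llinear M"
    and gen: "\<And>x y v w. x \<in> carrier G \<Longrightarrow> y \<in> carrier G \<Longrightarrow> x \<otimes> y = z \<Longrightarrow>
      v \<in> V x \<Longrightarrow> w \<in> W y \<Longrightarrow> L (twtensor x y v w) = M (twtensor x y v w)"
    and t: "t \<in> gtensor G V W z"
  shows "L t = M t"
proof (rule gtensor_map_eq[OF L M _ t])
  fix x y v w assume xy: "x \<in> carrier G" "y \<in> carrier G" "x \<otimes> y = z" "v \<in> V x" "w \<in> W y"
  show "L (v \<otimes>\<^sub>l w) = M (v \<otimes>\<^sub>l w)"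
    by (simp only: ltensor_twtensor[OF xy(1,2)] lvp.linear_scale[OF L] lvp.linear_scale[OF M] gen[OF xy])
qed

text \<open>A morphism knows its domain and codomain. Rewrite rules whose conditions are expressed through \<open>gdom\<close>
  and \<open>gcod\<close> leave no object to be guessed.\<close>

definition arr :: "('g, 'a, 'k) garrow \<Rightarrow> bool" where
  "arr f \<longleftrightarrow> f \<in> ghom G (gdom f) (gcod f) \<and> gdom f \<in> gspaces G \<and> gcod f \<in> gspaces G"

lemma arrI: "f \<in> ghom G V W \<Longrightarrow> V \<in> gspaces G \<Longrightarrow> W \<in> gspaces G \<Longrightarrow> arr f"
  by (simp add: arr_def ghom_gdom ghom_gcod)

lemma arr_ghom: "arr f \<Longrightarrow> gdom f = V \<Longrightarrow> gcod f = W \<Longrightarrow> f \<in> ghom G V W"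
  by (auto simp: arr_def)

lemma arr_deg: "arr f \<Longrightarrow> gcod f = W \<Longrightarrow> x \<in> carrier G \<Longrightarrow> v \<in> gdom f x \<Longrightarrow> gmap f v \<in> W x"
  by (auto simp: arr_def intro: ghom_degree)

lemma arr_gtotal: "arr f \<Longrightarrow> gcod f = W \<Longrightarrow> v \<in> gtotal (gdom f) \<Longrightarrow> gmap f v \<in> gtotal W"
  using ghom_gtotal by (auto simp: arr_def)

lemma gmap_scale: "arr f \<Longrightarrow> v \<in> gtotal (gdom f) \<Longrightarrow> gmap f (c *\<^sub>l v) = c *\<^sub>l gmap f v"
  by (auto simp: arr_def intro: ghom_scale)

lemma gmap_zero: "arr f \<Longrightarrow> gmap f 0 = 0"
  using gmap_scale[of f 0 0] lv.subspace_0[OF gtotal_subspace[of "gdom f"]] by simp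

lemma gmap_sum:
  "arr f \<Longrightarrow> (\<And>i. i \<in> I \<Longrightarrow> v i \<in> gtotal (gdom f)) \<Longrightarrow> gmap f (\<Sum>i\<in>I. v i) = (\<Sum>i\<in>I. gmap f (v i))"
  unfolding arr_def by (elim conjE) (rule ghom_sum)

lemma arr_llinear:
  assumes "arr f" "arr g" "gdom f = V" "gdom g = V"
  shows "\<exists>L M. llinear L \<and> llinear M \<and> (\<forall>v\<in>gtotal V. gmap f v = L v) \<and> (\<forall>v\<in>gtotal V. gmap g v = M v)"
proof -
  have f: "f \<in> ghom G V (gcod f)" and g: "g \<in> ghom G V (gcod g)"
    using assms by (simp_all add: arr_ghom)
  obtain L where "llinear L" "\<And>v. v \<in> gtotal V \<Longrightarrow> gmap f v = L v"
    using ghom_llinear[OF f] by metis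
  moreover obtain M where "llinear M" "\<And>v. v \<in> gtotal V \<Longrightarrow> gmap g v = M v"
    using ghom_llinear[OF g] by metis
  ultimately show ?thesis by (intro exI[of _ L] exI[of _ M]) simp
qed

lemma arr_eqI:
  assumes "arr f" "arr g" "gdom f = V" "gdom g = V" "gcod f = gcod g"
    and "\<And>x v. x \<in> carrier G \<Longrightarrow> v \<in> V x \<Longrightarrow> gmap f v = gmap g v"
  shows "f = g"
proof (rule ghom_eqI)
  show "V \<in> gspaces G" using assms(1,3) by (auto simp: arr_def)
  show "f \<in> ghom G V (gcod f)" "g \<in> ghom G V (gcod f)"
    using assms by (simp_all add: arr_ghom)
qed (rule assms(6))

text \<open>The following extensionality rules reduce equations between morphisms on iterated tensor products to
  computations with twisted tensors of homogeneous elements.\<close>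

lemma arr_eqI2:
  assumes fg: "arr f" "arr g" "gdom f = gtensor G U V" "gdom g = gtensor G U V" "gcod f = gcod g"
    and UV: "U \<in> gspaces G" "V \<in> gspaces G"
    and eq: "\<And>x y u v. x \<in> carrier G \<Longrightarrow> y \<in> carrier G \<Longrightarrow> u \<in> U x \<Longrightarrow> v \<in> V y \<Longrightarrow>
      gmap f (twtensor x y u v) = gmap g (twtensor x y u v)"
  shows "f = g"
proof (rule arr_eqI[OF fg])
  obtain L M where L: "llinear L" and M: "llinear M"
    and LM: "\<forall>v\<in>gtotal (gtensor G U V). gmap f v = L v" "\<forall>v\<in>gtotal (gtensor G U V). gmap g v = M v"
    using arr_llinear[OF fg(1-4)] by (elim exE conjE)
  fix z t assume "z \<in> carrier G" and t: "t \<in> gtensor G U V z"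
  have "L t = M t"
  proof (rule gtensor_map_eq_twtensor[OF L M _ t])
    fix x y u v assume *: "x \<in> carrier G" "y \<in> carrier G" "u \<in> U x" "v \<in> V y"
    have "twtensor x y u v \<in> gtotal (gtensor G U V)"
      by (rule twtensor_gtotal[OF UV in_gtotal[of u U x] in_gtotal[of v V y]]) (use * in simp_all)
    then show "L (twtensor x y u v) = M (twtensor x y u v)" using eq[OF *] LM by simp
  qed
  then show "gmap f t = gmap g t" using LM in_gtotal[of t "gtensor G U V" z, OF t] by simp
qed

lemma arr_eqI3_left:
  assumes fg: "arr f" "arr g" "gdom f = gtensor G (gtensor G U V) W" "gdom g = gtensor G (gtensor G U V) W"
      "gcod f = gcod g"
    and UVW: "U \<in> gspaces G" "V \<in> gspaces G" "W \<in> gspaces G"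
    and eq: "\<And>x y z u v w. x \<in> carrier G \<Longrightarrow> y \<in> carrier G \<Longrightarrow> z \<in> carrier G \<Longrightarrow>
      u \<in> U x \<Longrightarrow> v \<in> V y \<Longrightarrow> w \<in> W z \<Longrightarrow>
      gmap f (twtensor (x \<otimes> y) z (twtensor x y u v) w) = gmap g (twtensor (x \<otimes> y) z (twtensor x y u v) w)"
  shows "f = g"
proof (rule arr_eqI2[OF fg gtensor_gspaces[OF UVW(1,2)] UVW(3)])
  let ?T = "gtotal (gtensor G (gtensor G U V) W)"
  obtain L M where L: "llinear L" and M: "llinear M"
    and LM: "\<forall>v\<in>?T. gmap f v = L v" "\<forall>v\<in>?T. gmap g v = M v"
    using arr_llinear[OF fg(1-4)] by (elim exE conjE)
  fix s z t w assume s: "s \<in> carrier G" and z: "z \<in> carrier G"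
    and t: "t \<in> gtensor G U V s" and w: "w \<in> W z"
  have "(\<lambda>t. L (twtensor s z t w)) t = (\<lambda>t. M (twtensor s z t w)) t"
  proof (rule gtensor_map_eq_twtensor[OF _ _ _ t])
    show "llinear (\<lambda>t. L (twtensor s z t w))" "llinear (\<lambda>t. M (twtensor s z t w))"
      by (rule llinear_compose[OF llinear_tt_left L] llinear_compose[OF llinear_tt_left M])+
    fix x y u v assume *: "x \<in> carrier G" "y \<in> carrier G" "x \<otimes> y = s" "u \<in> U x" "v \<in> V y"
    have "twtensor s z (twtensor x y u v) w \<in> ?T"
      by (intro twtensor_gtotal gtensor_gspaces UVW in_gtotal[of u U x] in_gtotal[of v V y] in_gtotal[of w W z] * w)
    then show "L (twtensor s z (twtensor x y u v) w) = M (twtensor s z (twtensor x y u v) w)"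
      using eq[OF *(1,2) z *(4,5) w] LM *(3) by simp
  qed
  moreover have "twtensor s z t w \<in> ?T"
    by (intro twtensor_gtotal gtensor_gspaces UVW in_gtotal[of t _ s] in_gtotal[of w W z] t w)
  ultimately show "gmap f (twtensor s z t w) = gmap g (twtensor s z t w)" using LM by simp
qed

lemma arr_eqI3_right:
  assumes fg: "arr f" "arr g" "gdom f = gtensor G U (gtensor G V W)" "gdom g = gtensor G U (gtensor G V W)"
      "gcod f = gcod g"
    and UVW: "U \<in> gspaces G" "V \<in> gspaces G" "W \<in> gspaces G"
    and eq: "\<And>x y z u v w. x \<in> carrier G \<Longrightarrow> y \<in> carrier G \<Longrightarrow> z \<in> carrier G \<Longrightarrow>
      u \<in> U x \<Longrightarrow> v \<in> V y \<Longrightarrow> w \<in> W z \<Longrightarrow>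
      gmap f (twtensor x (y \<otimes> z) u (twtensor y z v w)) = gmap g (twtensor x (y \<otimes> z) u (twtensor y z v w))"
  shows "f = g"
proof (rule arr_eqI2[OF fg UVW(1) gtensor_gspaces[OF UVW(2,3)]])
  let ?T = "gtotal (gtensor G U (gtensor G V W))"
  obtain L M where L: "llinear L" and M: "llinear M"
    and LM: "\<forall>v\<in>?T. gmap f v = L v" "\<forall>v\<in>?T. gmap g v = M v"
    using arr_llinear[OF fg(1-4)] by (elim exE conjE)
  fix x s u t assume x: "x \<in> carrier G" and s: "s \<in> carrier G"
    and u: "u \<in> U x" and t: "t \<in> gtensor G V W s"
  have "(\<lambda>t. L (twtensor x s u t)) t = (\<lambda>t. M (twtensor x s u t)) t"
  proof (rule gtensor_map_eq_twtensor[OF _ _ _ t])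
    show "llinear (\<lambda>t. L (twtensor x s u t))" "llinear (\<lambda>t. M (twtensor x s u t))"
      by (rule llinear_compose[OF llinear_tt_right L] llinear_compose[OF llinear_tt_right M])+
    fix y z v w assume *: "y \<in> carrier G" "z \<in> carrier G" "y \<otimes> z = s" "v \<in> V y" "w \<in> W z"
    have "twtensor x s u (twtensor y z v w) \<in> ?T"
      by (intro twtensor_gtotal gtensor_gspaces UVW in_gtotal[of u U x] in_gtotal[of v V y] in_gtotal[of w W z] * u)
    then show "L (twtensor x s u (twtensor y z v w)) = M (twtensor x s u (twtensor y z v w))"
      using eq[OF x *(1,2) u *(4,5)] LM *(3) by simp
  qed
  moreover have "twtensor x s u t \<in> ?T"
    by (intro twtensor_gtotal gtensor_gspaces UVW in_gtotal[of t _ s] in_gtotal[of u U x] t u)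
  ultimately show "gmap f (twtensor x s u t) = gmap g (twtensor x s u t)" using LM by simp
qed

lemma arr_eqI4_left:
  assumes fg: "arr f" "arr g" "gdom f = gtensor G (gtensor G (gtensor G U V) W) X"
      "gdom g = gtensor G (gtensor G (gtensor G U V) W) X" "gcod f = gcod g"
    and UVW: "U \<in> gspaces G" "V \<in> gspaces G" "W \<in> gspaces G" "X \<in> gspaces G"
    and eq: "\<And>x y z r u v w p. x \<in> carrier G \<Longrightarrow> y \<in> carrier G \<Longrightarrow> z \<in> carrier G \<Longrightarrow> r \<in> carrier G \<Longrightarrow>
      u \<in> U x \<Longrightarrow> v \<in> V y \<Longrightarrow> w \<in> W z \<Longrightarrow> p \<in> X r \<Longrightarrow>
      gmap f (twtensor (x \<otimes> y \<otimes> z) r (twtensor (x \<otimes> y) z (twtensor x y u v) w) p) =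
      gmap g (twtensor (x \<otimes> y \<otimes> z) r (twtensor (x \<otimes> y) z (twtensor x y u v) w) p)"
  shows "f = g"
proof (rule arr_eqI3_left[OF fg gtensor_gspaces[OF UVW(1,2)] UVW(3,4)])
  let ?T = "gtotal (gtensor G (gtensor G (gtensor G U V) W) X)"
  obtain L M where L: "llinear L" and M: "llinear M"
    and LM: "\<forall>v\<in>?T. gmap f v = L v" "\<forall>v\<in>?T. gmap g v = M v"
    using arr_llinear[OF fg(1-4)] by (elim exE conjE)
  fix s z r t w p assume s: "s \<in> carrier G" and z: "z \<in> carrier G" and r: "r \<in> carrier G"
    and t: "t \<in> gtensor G U V s" and w: "w \<in> W z" and p: "p \<in> X r"
  let ?h = "\<lambda>t. twtensor (s \<otimes> z) r (twtensor s z t w) p"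
  have "(\<lambda>t. L (?h t)) t = (\<lambda>t. M (?h t)) t"
  proof (rule gtensor_map_eq_twtensor[OF _ _ _ t])
    note h = llinear_compose[OF llinear_tt_left llinear_tt_left]
    show "llinear (\<lambda>t. L (?h t))" "llinear (\<lambda>t. M (?h t))"
      by (rule llinear_compose[OF h L] llinear_compose[OF h M])+
    fix x y u v assume *: "x \<in> carrier G" "y \<in> carrier G" "x \<otimes> y = s" "u \<in> U x" "v \<in> V y"
    have "?h (twtensor x y u v) \<in> ?T"
      by (intro twtensor_gtotal gtensor_gspaces UVW in_gtotal[of u U x] in_gtotal[of v V y]
          in_gtotal[of w W z] in_gtotal[of p X r] * w p)
    then show "L (?h (twtensor x y u v)) = M (?h (twtensor x y u v))"
      using eq[OF *(1,2) z r *(4,5) w p] LM *(3) by simp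
  qed
  moreover have "?h t \<in> ?T"
    by (intro twtensor_gtotal gtensor_gspaces UVW in_gtotal[of t _ s] in_gtotal[of w W z] in_gtotal[of p X r] t w p)
  ultimately show "gmap f (?h t) = gmap g (?h t)" using LM by simp
qed

end

section \<open>The structure morphisms on twisted tensors\<close>

lemma gtensor_map_into_left:
  assumes L: "llinear L" and S: "lv.subspace S"
    and gen: "\<And>x y z u v w. x \<in> carrier G \<Longrightarrow> y \<in> carrier G \<Longrightarrow> z \<in> carrier G \<Longrightarrow>
      (x \<otimes>\<^bsub>G\<^esub> y) \<otimes>\<^bsub>G\<^esub> z = s \<Longrightarrow> u \<in> U x \<Longrightarrow> v \<in> V y \<Longrightarrow> w \<in> W z \<Longrightarrow> L ((u \<otimes>\<^sub>l v) \<otimes>\<^sub>l w) \<in> S"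
    and t: "t \<in> gtensor G (gtensor G U V) W s"
  shows "L t \<in> S"
proof (rule gtensor_map_into[OF L S _ t])
  fix r z t w assume *: "r \<in> carrier G" "z \<in> carrier G" "r \<otimes>\<^bsub>G\<^esub> z = s" "w \<in> W z"
    and t: "t \<in> gtensor G U V r"
  show "L (t \<otimes>\<^sub>l w) \<in> S"
    by (rule gtensor_map_into[OF llinear_compose[OF llinear_ltensor_left L] S _ t]) (use gen * in blast)
qed

lemma gtensor_map_into_right:
  assumes L: "llinear L" and S: "lv.subspace S"
    and gen: "\<And>x y z u v w. x \<in> carrier G \<Longrightarrow> y \<in> carrier G \<Longrightarrow> z \<in> carrier G \<Longrightarrow>
      x \<otimes>\<^bsub>G\<^esub> (y \<otimes>\<^bsub>G\<^esub> z) = s \<Longrightarrow> u \<in> U x \<Longrightarrow> v \<in> V y \<Longrightarrow> w \<in> W z \<Longrightarrow> L (u \<otimes>\<^sub>l (v \<otimes>\<^sub>l w)) \<in> S"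
    and t: "t \<in> gtensor G U (gtensor G V W) s"
  shows "L t \<in> S"
proof (rule gtensor_map_into[OF L S _ t])
  fix x r u t assume *: "x \<in> carrier G" "r \<in> carrier G" "x \<otimes>\<^bsub>G\<^esub> r = s" "u \<in> U x"
    and t: "t \<in> gtensor G V W r"
  show "L (u \<otimes>\<^sub>l t) \<in> S"
    by (rule gtensor_map_into[OF llinear_compose[OF llinear_ltensor_right L] S _ t]) (use gen * in blast)
qed

lemma gunit_cases:
  assumes "u \<in> gunit G x"
  obtains (scalar) c where "x = \<one>\<^bsub>G\<^esub>" and "u = c *\<^sub>l lbasis Triv" | (zero) "u = 0"
  using assms by (auto simp: gunit_def lv.span_singleton split: if_splits)

context twisted_grading
begin

text \<open>The tensor product of two morphisms exists because both extend to linear maps of the whole function space;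
  it is unique because homogeneous pure tensors span the components.\<close>

lemma gtensor_arr_spec:
  assumes f: "arr f" and g: "arr g"
  shows "gtensor_arr G f g \<in> ghom G (gtensor G (gdom f) (gdom g)) (gtensor G (gcod f) (gcod g)) \<and>
    (\<forall>v\<in>gtotal (gdom f). \<forall>w\<in>gtotal (gdom g). gmap (gtensor_arr G f g) (v \<otimes>\<^sub>l w) = gmap f v \<otimes>\<^sub>l gmap g w)"
    (is "?P (gtensor_arr G f g)")
proof -
  have obj: "gdom f \<in> gspaces G" "gdom g \<in> gspaces G" "gcod f \<in> gspaces G" "gcod g \<in> gspaces G"
    using f g by (simp_all add: arr_def)
  have "\<exists>!h. ?P h"
  proof (rule ex_ex1I)
    obtain L where L: "llinear L" "\<And>v. v \<in> gtotal (gdom f) \<Longrightarrow> gmap f v = L v"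
      using ghom_llinear[OF arr_ghom[OF f refl refl]] by metis
    obtain M where M: "llinear M" "\<And>v. v \<in> gtotal (gdom g) \<Longrightarrow> gmap g v = M v"
      using ghom_llinear[OF arr_ghom[OF g refl refl]] by metis
    obtain H where H: "llinear H" "\<And>v w. H (v \<otimes>\<^sub>l w) = L v \<otimes>\<^sub>l M w"
      using llinear_tensor_map[OF L(1) M(1)] by metis
    let ?h = "garr (gtensor G (gdom f) (gdom g)) (gtensor G (gcod f) (gcod g)) H"
    have "?h \<in> ghom G (gtensor G (gdom f) (gdom g)) (gtensor G (gcod f) (gcod g))"
    proof (rule garr_in_ghom[OF H(1)])
      fix z t assume t: "t \<in> gtensor G (gdom f) (gdom g) z"
      show "H t \<in> gtensor G (gcod f) (gcod g) z"
      proof (rule gtensor_map_into[OF H(1) gtensor_subspace _ t])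
        fix x y v w assume *: "x \<in> carrier G" "y \<in> carrier G" "x \<otimes> y = z" "v \<in> gdom f x" "w \<in> gdom g y"
        have "L v \<in> gcod f x" "M w \<in> gcod g y"
          using arr_deg[OF f refl *(1,4)] arr_deg[OF g refl *(2,5)]
            L(2)[OF in_gtotal[of v "gdom f", OF *(4)]] M(2)[OF in_gtotal[of w "gdom g", OF *(5)]]
          by simp_all
        then show "H (v \<otimes>\<^sub>l w) \<in> gtensor G (gcod f) (gcod g) z"
          unfolding H(2) by (intro gtensor_mem[OF *(1-3)])
      qed
    qed
    moreover have "gmap ?h (v \<otimes>\<^sub>l w) = gmap f v \<otimes>\<^sub>l gmap g w"
      if "v \<in> gtotal (gdom f)" "w \<in> gtotal (gdom g)" for v w
      by (simp add: gmap_garr[OF ltensor_in_gtotal[OF obj(1,2) that is_monoid]] H(2) L(2) M(2) that)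
    ultimately show "\<exists>h. ?P h" by (intro exI[of _ ?h]) simp
  next
    fix h h' assume h: "?P h" and h': "?P h'"
    have dom: "gdom h = gtensor G (gdom f) (gdom g)" "gdom h' = gtensor G (gdom f) (gdom g)"
      "gcod h = gtensor G (gcod f) (gcod g)" "gcod h' = gtensor G (gcod f) (gcod g)"
      using h h' by (auto simp: ghom_gdom ghom_gcod)
    have arr: "arr h" "arr h'"
      using h h' obj by (auto intro: arrI gtensor_gspaces)
    show "h = h'"
    proof (rule arr_eqI2[OF arr dom(1,2) _ obj(1,2)])
      show "gcod h = gcod h'" using dom by simp
      fix x y v w assume *: "v \<in> gdom f x" "w \<in> gdom g y"
      have m: "v \<in> gtotal (gdom f)" "w \<in> gtotal (gdom g)"
        using in_gtotal[of v "gdom f", OF *(1)] in_gtotal[of w "gdom g", OF *(2)] by simp_all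
      have "v \<otimes>\<^sub>l w \<in> gtotal (gdom h)" "v \<otimes>\<^sub>l w \<in> gtotal (gdom h')"
        using ltensor_in_gtotal[OF obj(1,2) m is_monoid] dom by simp_all
      then show "gmap h (twtensor x y v w) = gmap h' (twtensor x y v w)"
        using h h' m by (simp add: twtensor_def gmap_scale[OF arr(1)] gmap_scale[OF arr(2)])
    qed
  qed
  then show ?thesis
    unfolding gtensor_arr_def by (rule theI')
qed

lemma gbraid_spec:
  fixes r :: "'g \<Rightarrow> 'g \<Rightarrow> 'k"
  assumes V: "V \<in> gspaces G" and W: "W \<in> gspaces G"
  shows "gbraid G r V W \<in> ghom G (gtensor G V W) (gtensor G W V) \<and>
    (\<forall>x\<in>carrier G. \<forall>y\<in>carrier G. \<forall>v\<in>V x. \<forall>w\<in>W y. gmap (gbraid G r V W) (v \<otimes>\<^sub>l w) = r x y *\<^sub>l (w \<otimes>\<^sub>l v))"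
    (is "?P (gbraid G r V W)")
proof -
  note obj = gtensor_gspaces[OF V W] gtensor_gspaces[OF W V]
  have tot: "v \<otimes>\<^sub>l w \<in> gtotal (gtensor G V W)" if "v \<in> V x" "w \<in> W y" for x y v w
    by (rule ltensor_in_gtotal[OF V W in_gtotal[of v V, OF that(1)] in_gtotal[of w W, OF that(2)] is_monoid])
  have "\<exists>!h. ?P h"
  proof (rule ex_ex1I)
    obtain D where D: "llinear D" "\<forall>x\<in>carrier G. \<forall>y\<in>carrier G. \<forall>v\<in>V x. \<forall>w\<in>W y.
        D (v \<otimes>\<^sub>l w) = r x y *\<^sub>l (v \<otimes>\<^sub>l w)"
      using homogeneous_weights[OF V W, of r] by (elim exE conjE)
    obtain T :: "('a, 'k) lvec \<Rightarrow> ('a, 'k) lvec"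
      where T: "llinear T" "\<forall>v w. T (v \<otimes>\<^sub>l w) = w \<otimes>\<^sub>l v"
      using llinear_swap by (elim exE conjE)
    let ?H = "\<lambda>t. T (D t)"
    let ?h = "garr (gtensor G V W) (gtensor G W V) ?H"
    have H: "llinear ?H" by (rule llinear_compose[OF D(1) T(1)])
    have eq: "?H (v \<otimes>\<^sub>l w) = r x y *\<^sub>l (w \<otimes>\<^sub>l v)"
      if "x \<in> carrier G" "y \<in> carrier G" "v \<in> V x" "w \<in> W y" for x y v w
      using that by (simp add: D(2) T(2) lvp.linear_scale[OF T(1)])
    have "?h \<in> ghom G (gtensor G V W) (gtensor G W V)"
    proof (rule garr_in_ghom[OF H])
      fix z t assume t: "t \<in> gtensor G V W z"
      show "?H t \<in> gtensor G W V z"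
      proof (rule gtensor_map_into[OF H gtensor_subspace _ t])
        fix x y v w assume *: "x \<in> carrier G" "y \<in> carrier G" "x \<otimes> y = z" "v \<in> V x" "w \<in> W y"
        show "?H (v \<otimes>\<^sub>l w) \<in> gtensor G W V z"
          unfolding eq[OF *(1,2,4,5)] using * m_comm[OF *(1,2)]
          by (intro lv.subspace_scale[OF gtensor_subspace] gtensor_mem[of y G x]) simp_all
      qed
    qed
    moreover have "gmap ?h (v \<otimes>\<^sub>l w) = r x y *\<^sub>l (w \<otimes>\<^sub>l v)"
      if "x \<in> carrier G" "y \<in> carrier G" "v \<in> V x" "w \<in> W y" for x y v w
      unfolding gmap_garr[OF tot[OF that(3,4)]] by (rule eq[OF that])
    ultimately show "\<exists>h. ?P h" by (intro exI[of _ ?h]) simp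
  next
    fix h h' assume h: "?P h" and h': "?P h'"
    have dom: "gdom h = gtensor G V W" "gdom h' = gtensor G V W" "gcod h = gtensor G W V" "gcod h' = gtensor G W V"
      using h h' by (auto simp: ghom_gdom ghom_gcod)
    have arr: "arr h" "arr h'"
      using h h' obj by (auto intro: arrI)
    show "h = h'"
    proof (rule arr_eqI2[OF arr dom(1,2) _ V W])
      show "gcod h = gcod h'" using dom by simp
      fix x y v w assume *: "x \<in> carrier G" "y \<in> carrier G" "v \<in> V x" "w \<in> W y"
      then show "gmap h (twtensor x y v w) = gmap h' (twtensor x y v w)"
        using h h' tot[OF *(3,4)]
        by (simp add: twtensor_def gmap_scale[OF arr(1)] gmap_scale[OF arr(2)] dom)
    qed
  qed
  then show ?thesis
    unfolding gbraid_def by (rule theI')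
qed

text \<open>Since \<open>\<phi>\<close> is a coboundary, the map with weights \<open>\<phi>\<close> factors into two maps with weights \<open>F\<close>, the
  plain reassociation, and two maps with weights \<open>F\<^sup>-\<^sup>1\<close>; each of them involves only two tensor
  factors, so \<open>homogeneous_weights\<close> applies.\<close>

lemma gassoc_spec:
  assumes U: "U \<in> gspaces G" and V: "V \<in> gspaces G" and W: "W \<in> gspaces G"
  shows "gassoc G (twist_assoc G F) U V W \<in>
      ghom G (gtensor G (gtensor G U V) W) (gtensor G U (gtensor G V W)) \<and>
    (\<forall>x\<in>carrier G. \<forall>y\<in>carrier G. \<forall>z\<in>carrier G. \<forall>u\<in>U x. \<forall>v\<in>V y. \<forall>w\<in>W z.
      gmap (gassoc G (twist_assoc G F) U V W) ((u \<otimes>\<^sub>l v) \<otimes>\<^sub>l w) = twist_assoc G F x y z *\<^sub>l (u \<otimes>\<^sub>l (v \<otimes>\<^sub>l w)))"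
    (is "?P (gassoc G (twist_assoc G F) U V W)")
proof -
  let ?UV = "gtensor G U V" and ?VW = "gtensor G V W"
  note UV = gtensor_gspaces[OF U V] and VW = gtensor_gspaces[OF V W]
  note obj = gtensor_gspaces[OF UV W] gtensor_gspaces[OF U VW]
  have tot: "(u \<otimes>\<^sub>l v) \<otimes>\<^sub>l w \<in> gtotal (gtensor G ?UV W)" if "u \<in> U x" "v \<in> V y" "w \<in> W z" for x y z u v w
    using that by (intro ltensor_in_gtotal U V W UV is_monoid) (auto intro: in_gtotal)
  have "\<exists>!h. ?P h"
  proof (rule ex_ex1I)
    obtain D1 where D1: "llinear D1" "\<forall>s\<in>carrier G. \<forall>z\<in>carrier G. \<forall>t\<in>?UV s. \<forall>w\<in>W z.
        D1 (t \<otimes>\<^sub>l w) = F s z *\<^sub>l (t \<otimes>\<^sub>l w)"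
      using homogeneous_weights[OF UV W, of F] by (elim exE conjE)
    obtain D2 where D2: "llinear D2" "\<forall>x\<in>carrier G. \<forall>y\<in>carrier G. \<forall>u\<in>U x. \<forall>v\<in>V y.
        D2 (u \<otimes>\<^sub>l v) = F x y *\<^sub>l (u \<otimes>\<^sub>l v)"
      using homogeneous_weights[OF U V, of F] by (elim exE conjE)
    obtain D3 where D3: "llinear D3" "\<forall>y\<in>carrier G. \<forall>z\<in>carrier G. \<forall>v\<in>V y. \<forall>w\<in>W z.
        D3 (v \<otimes>\<^sub>l w) = inverse (F y z) *\<^sub>l (v \<otimes>\<^sub>l w)"
      using homogeneous_weights[OF V W, of "\<lambda>y z. inverse (F y z)"] by (elim exE conjE)
    obtain D4 where D4: "llinear D4" "\<forall>x\<in>carrier G. \<forall>s\<in>carrier G. \<forall>u\<in>U x. \<forall>t\<in>?VW s.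
        D4 (u \<otimes>\<^sub>l t) = inverse (F x s) *\<^sub>l (u \<otimes>\<^sub>l t)"
      using homogeneous_weights[OF U VW, of "\<lambda>x s. inverse (F x s)"] by (elim exE conjE)
    obtain E2 where E2: "llinear E2" "\<forall>v w. E2 (v \<otimes>\<^sub>l w) = D2 v \<otimes>\<^sub>l w"
      using llinear_tensor_map[OF D2(1) llinear_id] by (elim exE conjE)
    obtain E3 where E3: "llinear E3" "\<forall>v w. E3 (v \<otimes>\<^sub>l w) = v \<otimes>\<^sub>l D3 w"
      using llinear_tensor_map[OF llinear_id D3(1)] by (elim exE conjE)
    obtain A :: "('a, 'k) lvec \<Rightarrow> ('a, 'k) lvec"
      where A: "llinear A" "\<forall>u v w. A ((u \<otimes>\<^sub>l v) \<otimes>\<^sub>l w) = u \<otimes>\<^sub>l (v \<otimes>\<^sub>l w)"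
      using llinear_assoc by (elim exE conjE)
    let ?H = "\<lambda>t. D4 (E3 (A (E2 (D1 t))))"
    let ?h = "garr (gtensor G ?UV W) (gtensor G U ?VW) ?H"
    note scale = lvp.linear_scale[OF D1(1)] lvp.linear_scale[OF E2(1)] lvp.linear_scale[OF E3(1)]
      lvp.linear_scale[OF D4(1)] lvp.linear_scale[OF A(1)]
    have H: "llinear ?H"
      by (rule llinear_compose[OF D1(1) llinear_compose[OF E2(1) llinear_compose[OF A(1) llinear_compose[OF E3(1) D4(1)]]]])
    have eq: "?H ((u \<otimes>\<^sub>l v) \<otimes>\<^sub>l w) = twist_assoc G F x y z *\<^sub>l (u \<otimes>\<^sub>l (v \<otimes>\<^sub>l w))"
      if *: "x \<in> carrier G" "y \<in> carrier G" "z \<in> carrier G" "u \<in> U x" "v \<in> V y" "w \<in> W z" for x y z u v w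
    proof -
      have m: "u \<otimes>\<^sub>l v \<in> ?UV (x \<otimes> y)" "v \<otimes>\<^sub>l w \<in> ?VW (y \<otimes> z)"
        using * by (simp_all add: gtensor_mem[of x G y _ u U v V] gtensor_mem[of y G z _ v V w W])
      have "?H ((u \<otimes>\<^sub>l v) \<otimes>\<^sub>l w) = (F (x \<otimes> y) z * (F x y * (inverse (F y z) * inverse (F x (y \<otimes> z))))) *\<^sub>l (u \<otimes>\<^sub>l (v \<otimes>\<^sub>l w))"
        by (simp add: E2(2) A(2) E3(2) scale ltensor_scale_left ltensor_scale_right
            D1(2)[rule_format, OF m_closed[OF *(1,2)] *(3) m(1) *(6)] D2(2)[rule_format, OF *(1,2,4,5)]
            D3(2)[rule_format, OF *(2,3,5,6)] D4(2)[rule_format, OF *(1) m_closed[OF *(2,3)] *(4) m(2)])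
      then show ?thesis by (simp add: twist_assoc_def mult_ac)
    qed
    have "?h \<in> ghom G (gtensor G ?UV W) (gtensor G U ?VW)"
    proof (rule garr_in_ghom[OF H])
      fix s t assume t: "t \<in> gtensor G ?UV W s"
      show "?H t \<in> gtensor G U ?VW s"
      proof (rule gtensor_map_into_left[OF H gtensor_subspace _ t])
        fix x y z u v w assume *: "x \<in> carrier G" "y \<in> carrier G" "z \<in> carrier G" "x \<otimes> y \<otimes> z = s"
          "u \<in> U x" "v \<in> V y" "w \<in> W z"
        show "?H ((u \<otimes>\<^sub>l v) \<otimes>\<^sub>l w) \<in> gtensor G U ?VW s"
          unfolding eq[OF *(1-3,5-7)] using * m_assoc[OF *(1-3)]
          by (intro lv.subspace_scale[OF gtensor_subspace] gtensor_mem[of x G "y \<otimes> z"]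
              gtensor_mem[of y G z _ v V w W]) simp_all
      qed
    qed
    moreover have "gmap ?h ((u \<otimes>\<^sub>l v) \<otimes>\<^sub>l w) = twist_assoc G F x y z *\<^sub>l (u \<otimes>\<^sub>l (v \<otimes>\<^sub>l w))"
      if "x \<in> carrier G" "y \<in> carrier G" "z \<in> carrier G" "u \<in> U x" "v \<in> V y" "w \<in> W z" for x y z u v w
      unfolding gmap_garr[OF tot[OF that(4-6)]] by (rule eq[OF that])
    ultimately show "\<exists>h. ?P h" by (intro exI[of _ ?h]) simp
  next
    fix h h' assume h: "?P h" and h': "?P h'"
    have dom: "gdom h = gtensor G ?UV W" "gdom h' = gtensor G ?UV W"
      "gcod h = gtensor G U ?VW" "gcod h' = gtensor G U ?VW"
      using h h' by (auto simp: ghom_gdom ghom_gcod)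
    have arr: "arr h" "arr h'"
      using h h' obj by (auto intro: arrI)
    show "h = h'"
    proof (rule arr_eqI3_left[OF arr dom(1,2) _ U V W])
      show "gcod h = gcod h'" using dom by simp
      fix x y z u v w
      assume *: "x \<in> carrier G" "y \<in> carrier G" "z \<in> carrier G" "u \<in> U x" "v \<in> V y" "w \<in> W z"
      then show "gmap h (twtensor (x \<otimes> y) z (twtensor x y u v) w) = gmap h' (twtensor (x \<otimes> y) z (twtensor x y u v) w)"
        using h h' tot[OF *(4-6)]
        by (simp add: twtensor_def gmap_scale[OF arr(1)] gmap_scale[OF arr(2)] dom ltensor_scale_left)
    qed
  qed
  then show ?thesis
    unfolding gassoc_def by (rule theI')
qed

text \<open>The same factorization, read from right to left.\<close>

lemma gassoc_inv_spec:
  assumes U: "U \<in> gspaces G" and V: "V \<in> gspaces G" and W: "W \<in> gspaces G"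
  shows "gassoc_inv G (twist_assoc G F) U V W \<in>
      ghom G (gtensor G U (gtensor G V W)) (gtensor G (gtensor G U V) W) \<and>
    (\<forall>x\<in>carrier G. \<forall>y\<in>carrier G. \<forall>z\<in>carrier G. \<forall>u\<in>U x. \<forall>v\<in>V y. \<forall>w\<in>W z.
      gmap (gassoc_inv G (twist_assoc G F) U V W) (u \<otimes>\<^sub>l (v \<otimes>\<^sub>l w)) =
        inverse (twist_assoc G F x y z) *\<^sub>l ((u \<otimes>\<^sub>l v) \<otimes>\<^sub>l w))"
    (is "?P (gassoc_inv G (twist_assoc G F) U V W)")
proof -
  let ?UV = "gtensor G U V" and ?VW = "gtensor G V W"
  note UV = gtensor_gspaces[OF U V] and VW = gtensor_gspaces[OF V W]
  note obj = gtensor_gspaces[OF UV W] gtensor_gspaces[OF U VW]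
  have tot: "u \<otimes>\<^sub>l (v \<otimes>\<^sub>l w) \<in> gtotal (gtensor G U ?VW)" if "u \<in> U x" "v \<in> V y" "w \<in> W z" for x y z u v w
    using that by (intro ltensor_in_gtotal U V W VW is_monoid) (auto intro: in_gtotal)
  have "\<exists>!h. ?P h"
  proof (rule ex_ex1I)
    obtain D1 where D1: "llinear D1" "\<forall>x\<in>carrier G. \<forall>s\<in>carrier G. \<forall>u\<in>U x. \<forall>t\<in>?VW s.
        D1 (u \<otimes>\<^sub>l t) = F x s *\<^sub>l (u \<otimes>\<^sub>l t)"
      using homogeneous_weights[OF U VW, of F] by (elim exE conjE)
    obtain D2 where D2: "llinear D2" "\<forall>y\<in>carrier G. \<forall>z\<in>carrier G. \<forall>v\<in>V y. \<forall>w\<in>W z.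
        D2 (v \<otimes>\<^sub>l w) = F y z *\<^sub>l (v \<otimes>\<^sub>l w)"
      using homogeneous_weights[OF V W, of F] by (elim exE conjE)
    obtain D3 where D3: "llinear D3" "\<forall>x\<in>carrier G. \<forall>y\<in>carrier G. \<forall>u\<in>U x. \<forall>v\<in>V y.
        D3 (u \<otimes>\<^sub>l v) = inverse (F x y) *\<^sub>l (u \<otimes>\<^sub>l v)"
      using homogeneous_weights[OF U V, of "\<lambda>y z. inverse (F y z)"] by (elim exE conjE)
    obtain D4 where D4: "llinear D4" "\<forall>s\<in>carrier G. \<forall>z\<in>carrier G. \<forall>t\<in>?UV s. \<forall>w\<in>W z.
        D4 (t \<otimes>\<^sub>l w) = inverse (F s z) *\<^sub>l (t \<otimes>\<^sub>l w)"
      using homogeneous_weights[OF UV W, of "\<lambda>x s. inverse (F x s)"] by (elim exE conjE)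
    obtain E2 where E2: "llinear E2" "\<forall>v w. E2 (v \<otimes>\<^sub>l w) = v \<otimes>\<^sub>l D2 w"
      using llinear_tensor_map[OF llinear_id D2(1)] by (elim exE conjE)
    obtain E3 where E3: "llinear E3" "\<forall>v w. E3 (v \<otimes>\<^sub>l w) = D3 v \<otimes>\<^sub>l w"
      using llinear_tensor_map[OF D3(1) llinear_id] by (elim exE conjE)
    obtain A :: "('a, 'k) lvec \<Rightarrow> ('a, 'k) lvec"
      where A: "llinear A" "\<forall>u v w. A (u \<otimes>\<^sub>l (v \<otimes>\<^sub>l w)) = (u \<otimes>\<^sub>l v) \<otimes>\<^sub>l w"
      using llinear_assoc_inv by (elim exE conjE)
    let ?H = "\<lambda>t. D4 (E3 (A (E2 (D1 t))))"
    let ?h = "garr (gtensor G U ?VW) (gtensor G ?UV W) ?H"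
    note scale = lvp.linear_scale[OF D1(1)] lvp.linear_scale[OF E2(1)] lvp.linear_scale[OF E3(1)]
      lvp.linear_scale[OF D4(1)] lvp.linear_scale[OF A(1)]
    have H: "llinear ?H"
      by (rule llinear_compose[OF D1(1) llinear_compose[OF E2(1) llinear_compose[OF A(1) llinear_compose[OF E3(1) D4(1)]]]])
    have eq: "?H (u \<otimes>\<^sub>l (v \<otimes>\<^sub>l w)) = inverse (twist_assoc G F x y z) *\<^sub>l ((u \<otimes>\<^sub>l v) \<otimes>\<^sub>l w)"
      if *: "x \<in> carrier G" "y \<in> carrier G" "z \<in> carrier G" "u \<in> U x" "v \<in> V y" "w \<in> W z" for x y z u v w
    proof -
      have m: "u \<otimes>\<^sub>l v \<in> ?UV (x \<otimes> y)" "v \<otimes>\<^sub>l w \<in> ?VW (y \<otimes> z)"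
        using * by (simp_all add: gtensor_mem[of x G y _ u U v V] gtensor_mem[of y G z _ v V w W])
      have "?H (u \<otimes>\<^sub>l (v \<otimes>\<^sub>l w)) = (F x (y \<otimes> z) * (F y z * (inverse (F x y) * inverse (F (x \<otimes> y) z)))) *\<^sub>l ((u \<otimes>\<^sub>l v) \<otimes>\<^sub>l w)"
        by (simp add: E2(2) A(2) E3(2) scale ltensor_scale_left ltensor_scale_right
            D1(2)[rule_format, OF *(1) m_closed[OF *(2,3)] *(4) m(2)] D2(2)[rule_format, OF *(2,3,5,6)]
            D3(2)[rule_format, OF *(1,2,4,5)] D4(2)[rule_format, OF m_closed[OF *(1,2)] *(3) m(1) *(6)])
      then show ?thesis by (simp add: twist_assoc_def mult_ac)
    qed
    have "?h \<in> ghom G (gtensor G U ?VW) (gtensor G ?UV W)"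
    proof (rule garr_in_ghom[OF H])
      fix s t assume t: "t \<in> gtensor G U ?VW s"
      show "?H t \<in> gtensor G ?UV W s"
      proof (rule gtensor_map_into_right[OF H gtensor_subspace _ t])
        fix x y z u v w assume *: "x \<in> carrier G" "y \<in> carrier G" "z \<in> carrier G" "x \<otimes> (y \<otimes> z) = s"
          "u \<in> U x" "v \<in> V y" "w \<in> W z"
        show "?H (u \<otimes>\<^sub>l (v \<otimes>\<^sub>l w)) \<in> gtensor G ?UV W s"
          unfolding eq[OF *(1-3,5-7)] using * m_assoc[OF *(1-3)]
          by (intro lv.subspace_scale[OF gtensor_subspace] gtensor_mem[of "x \<otimes> y" G z]
              gtensor_mem[of x G y _ u U v V]) simp_all
      qed
    qed
    moreover have "gmap ?h (u \<otimes>\<^sub>l (v \<otimes>\<^sub>l w)) = inverse (twist_assoc G F x y z) *\<^sub>l ((u \<otimes>\<^sub>l v) \<otimes>\<^sub>l w)"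
      if "x \<in> carrier G" "y \<in> carrier G" "z \<in> carrier G" "u \<in> U x" "v \<in> V y" "w \<in> W z" for x y z u v w
      unfolding gmap_garr[OF tot[OF that(4-6)]] by (rule eq[OF that])
    ultimately show "\<exists>h. ?P h" by (intro exI[of _ ?h]) simp
  next
    fix h h' assume h: "?P h" and h': "?P h'"
    have dom: "gdom h = gtensor G U ?VW" "gdom h' = gtensor G U ?VW"
      "gcod h = gtensor G ?UV W" "gcod h' = gtensor G ?UV W"
      using h h' by (auto simp: ghom_gdom ghom_gcod)
    have arr: "arr h" "arr h'"
      using h h' obj by (auto intro: arrI)
    show "h = h'"
    proof (rule arr_eqI3_right[OF arr dom(1,2) _ U V W])
      show "gcod h = gcod h'" using dom by simp
      fix x y z u v w
      assume *: "x \<in> carrier G" "y \<in> carrier G" "z \<in> carrier G" "u \<in> U x" "v \<in> V y" "w \<in> W z"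
      then show "gmap h (twtensor x (y \<otimes> z) u (twtensor y z v w)) = gmap h' (twtensor x (y \<otimes> z) u (twtensor y z v w))"
        using h h' tot[OF *(4-6)]
        by (simp add: twtensor_def gmap_scale[OF arr(1)] gmap_scale[OF arr(2)] dom ltensor_scale_right)
    qed
  qed
  then show ?thesis
    unfolding gassoc_inv_def by (rule theI')
qed

lemma triv_mem: "lbasis Triv \<in> gunit G \<one>"
  by (simp add: gunit_def lv.span_base)

text \<open>The unit object is spanned by one vector of degree \<open>1\<close>, so this vector alone has to be tested.\<close>

lemma arr_eqI_left_unit:
  fixes V :: "('g, 'a, 'k) gspace"
  assumes fg: "arr f" "arr g" "gdom f = gtensor G (gunit G) V" "gdom g = gtensor G (gunit G) V" "gcod f = gcod g"
    and V: "V \<in> gspaces G"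
    and eq: "\<And>x v. x \<in> carrier G \<Longrightarrow> v \<in> V x \<Longrightarrow>
      gmap f (twtensor \<one> x (lbasis Triv) v) = gmap g (twtensor \<one> x (lbasis Triv) v)"
  shows "f = g"
proof (rule arr_eqI2[OF fg gunit_gspaces V])
  fix x y u v assume *: "x \<in> carrier G" "y \<in> carrier G" "u \<in> (gunit G :: ('g, 'a, 'k) gspace) x" "v \<in> V y"
  have "twtensor \<one> y (lbasis Triv) v \<in> gtotal (gtensor G (gunit G) V)"
    using *(4) triv_mem by (intro twtensor_gtotal gunit_gspaces V) (auto intro: in_gtotal)
  then have t: "twtensor \<one> y (lbasis Triv) v \<in> gtotal (gdom f)" "twtensor \<one> y (lbasis Triv) v \<in> gtotal (gdom g)"
    using fg by simp_all
  show "gmap f (twtensor x y u v) = gmap g (twtensor x y u v)"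
    using *(3)
  proof (cases rule: gunit_cases)
    case (scalar c)
    then show ?thesis
      by (simp add: twtensor_scale_left gmap_scale[OF fg(1) t(1)] gmap_scale[OF fg(2) t(2)] eq *)
  next
    case zero
    then show ?thesis by (simp add: twtensor_zero_left gmap_zero fg)
  qed
qed

lemma arr_eqI_right_unit:
  fixes V :: "('g, 'a, 'k) gspace"
  assumes fg: "arr f" "arr g" "gdom f = gtensor G V (gunit G)" "gdom g = gtensor G V (gunit G)" "gcod f = gcod g"
    and V: "V \<in> gspaces G"
    and eq: "\<And>x v. x \<in> carrier G \<Longrightarrow> v \<in> V x \<Longrightarrow>
      gmap f (twtensor x \<one> v (lbasis Triv)) = gmap g (twtensor x \<one> v (lbasis Triv))"
  shows "f = g"
proof (rule arr_eqI2[OF fg V gunit_gspaces])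
  fix x y u v assume *: "x \<in> carrier G" "y \<in> carrier G" "v \<in> V x" "u \<in> (gunit G :: ('g, 'a, 'k) gspace) y"
  have "twtensor x \<one> v (lbasis Triv) \<in> gtotal (gtensor G V (gunit G))"
    using *(3) triv_mem by (intro twtensor_gtotal gunit_gspaces V) (auto intro: in_gtotal)
  then have t: "twtensor x \<one> v (lbasis Triv) \<in> gtotal (gdom f)" "twtensor x \<one> v (lbasis Triv) \<in> gtotal (gdom g)"
    using fg by simp_all
  show "gmap f (twtensor x y v u) = gmap g (twtensor x y v u)"
    using *(4)
  proof (cases rule: gunit_cases)
    case (scalar c)
    then show ?thesis
      by (simp add: twtensor_scale_right gmap_scale[OF fg(1) t(1)] gmap_scale[OF fg(2) t(2)] eq *)
  next
    case zero
    then show ?thesis by (simp add: twtensor_zero_right gmap_zero fg)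
  qed
qed

lemma twtensor_one_left: "x \<in> carrier G \<Longrightarrow> twtensor \<one> x v w = v \<otimes>\<^sub>l w"
  and twtensor_one_right: "x \<in> carrier G \<Longrightarrow> twtensor x \<one> v w = v \<otimes>\<^sub>l w"
  by (simp_all add: twtensor_def)

lemma glunit_spec:
  fixes V :: "('g, 'a, 'k) gspace"
  assumes V: "V \<in> gspaces G"
  shows "glunit G V \<in> ghom G (gtensor G (gunit G) V) V \<and>
    (\<forall>v\<in>gtotal V. gmap (glunit G V) (lbasis Triv \<otimes>\<^sub>l v) = v)" (is "?P (glunit G V)")
proof -
  let ?I = "gunit G :: ('g, 'a, 'k) gspace"
  have "\<exists>!h. ?P h"
  proof (rule ex_ex1I)
    obtain H :: "('a, 'k) lvec \<Rightarrow> ('a, 'k) lvec"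
      where H: "llinear H" "\<forall>v. H (lbasis Triv \<otimes>\<^sub>l v) = v"
      using llinear_cancel_left_unit by (elim exE conjE)
    let ?h = "garr (gtensor G ?I V) V H"
    have "?h \<in> ghom G (gtensor G ?I V) V"
    proof (rule garr_in_ghom[OF H(1)])
      fix z t assume t: "t \<in> gtensor G ?I V z"
      show "H t \<in> V z"
      proof (rule gtensor_map_into[OF H(1) gspaces_subspace[OF V] _ t])
        fix x y u v assume *: "x \<in> carrier G" "y \<in> carrier G" "x \<otimes> y = z" "u \<in> ?I x" "v \<in> V y"
        show "H (u \<otimes>\<^sub>l v) \<in> V z"
          using *(4)
        proof (cases rule: gunit_cases)
          case (scalar c)
          then show ?thesis
            using * by (simp add: ltensor_scale_left lvp.linear_scale[OF H(1)] H(2)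
                lv.subspace_scale[OF gspaces_subspace[OF V]])
        next
          case zero
          then show ?thesis by (simp add: lvp.linear_0[OF H(1)] lv.subspace_0[OF gspaces_subspace[OF V]])
        qed
      qed
    qed
    moreover have "gmap ?h (lbasis Triv \<otimes>\<^sub>l v) = v" if "v \<in> gtotal V" for v
      using H(2) gmap_garr[OF ltensor_in_gtotal[OF gunit_gspaces V in_gtotal[of _ ?I, OF triv_mem] that is_monoid]]
      by simp
    ultimately show "\<exists>h. ?P h" by (intro exI[of _ ?h]) simp
  next
    fix h h' assume h: "?P h" and h': "?P h'"
    have dom: "gdom h = gtensor G ?I V" "gdom h' = gtensor G ?I V" "gcod h = V" "gcod h' = V"
      using h h' by (auto simp: ghom_gdom ghom_gcod)
    have arr: "arr h" "arr h'"
      using h h' by (auto intro: arrI gtensor_gspaces gunit_gspaces V)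
    show "h = h'"
      by (rule arr_eqI_left_unit[OF arr dom(1,2) _ V])
        (use h h' in \<open>simp_all add: dom twtensor_one_left in_gtotal[of _ V]\<close>)
  qed
  then show ?thesis
    unfolding glunit_def by (rule theI')
qed

lemma grunit_spec:
  fixes V :: "('g, 'a, 'k) gspace"
  assumes V: "V \<in> gspaces G"
  shows "grunit G V \<in> ghom G (gtensor G V (gunit G)) V \<and>
    (\<forall>v\<in>gtotal V. gmap (grunit G V) (v \<otimes>\<^sub>l lbasis Triv) = v)" (is "?P (grunit G V)")
proof -
  let ?I = "gunit G :: ('g, 'a, 'k) gspace"
  have "\<exists>!h. ?P h"
  proof (rule ex_ex1I)
    obtain H :: "('a, 'k) lvec \<Rightarrow> ('a, 'k) lvec"
      where H: "llinear H" "\<forall>v. H (v \<otimes>\<^sub>l lbasis Triv) = v"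
      using llinear_cancel_right_unit by (elim exE conjE)
    let ?h = "garr (gtensor G V ?I) V H"
    have "?h \<in> ghom G (gtensor G V ?I) V"
    proof (rule garr_in_ghom[OF H(1)])
      fix z t assume t: "t \<in> gtensor G V ?I z"
      show "H t \<in> V z"
      proof (rule gtensor_map_into[OF H(1) gspaces_subspace[OF V] _ t])
        fix x y u v assume *: "x \<in> carrier G" "y \<in> carrier G" "x \<otimes> y = z" "v \<in> V x" "u \<in> ?I y"
        show "H (v \<otimes>\<^sub>l u) \<in> V z"
          using *(5)
        proof (cases rule: gunit_cases)
          case (scalar c)
          then show ?thesis
            using * by (simp add: ltensor_scale_right lvp.linear_scale[OF H(1)] H(2)
                lv.subspace_scale[OF gspaces_subspace[OF V]])
        next
          case zero
          then show ?thesis by (simp add: lvp.linear_0[OF H(1)] lv.subspace_0[OF gspaces_subspace[OF V]])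
        qed
      qed
    qed
    moreover have "gmap ?h (v \<otimes>\<^sub>l lbasis Triv) = v" if "v \<in> gtotal V" for v
      using H(2) gmap_garr[OF ltensor_in_gtotal[OF V gunit_gspaces that in_gtotal[of _ ?I, OF triv_mem] is_monoid]]
      by simp
    ultimately show "\<exists>h. ?P h" by (intro exI[of _ ?h]) simp
  next
    fix h h' assume h: "?P h" and h': "?P h'"
    have dom: "gdom h = gtensor G V ?I" "gdom h' = gtensor G V ?I" "gcod h = V" "gcod h' = V"
      using h h' by (auto simp: ghom_gdom ghom_gcod)
    have arr: "arr h" "arr h'"
      using h h' by (auto intro: arrI gtensor_gspaces gunit_gspaces V)
    show "h = h'"
      by (rule arr_eqI_right_unit[OF arr dom(1,2) _ V])
        (use h h' in \<open>simp_all add: dom twtensor_one_right in_gtotal[of _ V]\<close>)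
  qed
  then show ?thesis
    unfolding grunit_def by (rule theI')
qed

end

section \<open>The twisted category is symmetric monoidal\<close>

context twisted_grading
begin

abbreviation twassoc where "twassoc \<equiv> gassoc G (twist_assoc G F)"
abbreviation twassoc' where "twassoc' \<equiv> gassoc_inv G (twist_assoc G F)"
abbreviation twbraid where "twbraid \<equiv> gbraid G (\<lambda>x y. F x y * inverse (F y x))"

lemma gcomp_arr:
  "gdom (gcomp g f) = gdom f" "gcod (gcomp g f) = gcod g"
  "arr f \<Longrightarrow> arr g \<Longrightarrow> gdom g = gcod f \<Longrightarrow> arr (gcomp g f)"
  "v \<in> gtotal (gdom f) \<Longrightarrow> gmap (gcomp g f) v = gmap g (gmap f v)"
proof -
  show "gdom (gcomp g f) = gdom f" "gcod (gcomp g f) = gcod g"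
    by (simp_all add: gcomp_def)
  show "arr f \<Longrightarrow> arr g \<Longrightarrow> gdom g = gcod f \<Longrightarrow> arr (gcomp g f)"
    by (rule arrI[OF gcomp_in_ghom[of f G "gdom f" "gcod f" g "gcod g"]]) (auto simp: arr_def)
  show "v \<in> gtotal (gdom f) \<Longrightarrow> gmap (gcomp g f) v = gmap g (gmap f v)"
    by (simp add: gcomp_def compose_def)
qed

lemma gident_arr:
  "gdom (gident V) = V" "gcod (gident V) = V" "V \<in> gspaces G \<Longrightarrow> arr (gident V)"
  "v \<in> gtotal V \<Longrightarrow> gmap (gident V) v = v"
  by (simp_all add: gident_def arrI[OF gident_in_ghom[unfolded gident_def]])

text \<open>Here and in the lemmas below, the last claim says that the morphism acts on twisted tensors as its
  untwisted counterpart acts on ordinary ones.\<close>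

lemma gtensor_arr_arr:
  assumes f: "arr f" and g: "arr g"
  shows "gdom (gtensor_arr G f g) = gtensor G (gdom f) (gdom g)"
    and "gcod (gtensor_arr G f g) = gtensor G (gcod f) (gcod g)"
    and "arr (gtensor_arr G f g)"
    and "v \<in> gtotal (gdom f) \<Longrightarrow> w \<in> gtotal (gdom g) \<Longrightarrow>
      gmap (gtensor_arr G f g) (twtensor x y v w) = twtensor x y (gmap f v) (gmap g w)"
proof -
  note s = gtensor_arr_spec[OF f g, THEN conjunct1] gtensor_arr_spec[OF f g, THEN conjunct2, rule_format]
  show d: "gdom (gtensor_arr G f g) = gtensor G (gdom f) (gdom g)"
    and "gcod (gtensor_arr G f g) = gtensor G (gcod f) (gcod g)"
    using s(1) by (simp_all add: ghom_gdom ghom_gcod)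
  show a: "arr (gtensor_arr G f g)"
    using f g by (intro arrI[OF s(1)] gtensor_gspaces) (simp_all add: arr_def)
  assume vw: "v \<in> gtotal (gdom f)" "w \<in> gtotal (gdom g)"
  have "v \<otimes>\<^sub>l w \<in> gtotal (gdom (gtensor_arr G f g))"
    unfolding d using f g by (intro ltensor_in_gtotal vw is_monoid) (simp_all add: arr_def)
  then show "gmap (gtensor_arr G f g) (twtensor x y v w) = twtensor x y (gmap f v) (gmap g w)"
    by (simp add: twtensor_def gmap_scale[OF a] s(2)[OF vw])
qed

text \<open>The scalar \<open>F(x, y)\<^sup>-\<^sup>1 F(xy, z)\<^sup>-\<^sup>1\<close> of the left bracketing cancels two of the factors of \<open>\<phi>\<close>, and the
  other two are the scalar of the right bracketing. The degree \<open>s\<close> is a separate variable so that the rule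
  applies to whatever expression denotes \<open>x \<otimes> y\<close>.\<close>

lemma twassoc_arr:
  assumes U: "U \<in> gspaces G" and V: "V \<in> gspaces G" and W: "W \<in> gspaces G"
  shows "gdom (twassoc U V W) = gtensor G (gtensor G U V) W"
    and "gcod (twassoc U V W) = gtensor G U (gtensor G V W)"
    and "arr (twassoc U V W)"
    and "x \<in> carrier G \<Longrightarrow> y \<in> carrier G \<Longrightarrow> z \<in> carrier G \<Longrightarrow> s = x \<otimes> y \<Longrightarrow> u \<in> U x \<Longrightarrow> v \<in> V y \<Longrightarrow> w \<in> W z \<Longrightarrow>
      gmap (twassoc U V W) (twtensor s z (twtensor x y u v) w) = twtensor x (y \<otimes> z) u (twtensor y z v w)"
proof -
  note s = gassoc_spec[OF U V W, THEN conjunct1] gassoc_spec[OF U V W, THEN conjunct2, rule_format]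
  show d: "gdom (twassoc U V W) = gtensor G (gtensor G U V) W"
    and "gcod (twassoc U V W) = gtensor G U (gtensor G V W)"
    using s(1) by (simp_all add: ghom_gdom ghom_gcod)
  show a: "arr (twassoc U V W)"
    by (intro arrI[OF s(1)] gtensor_gspaces U V W)
  assume *: "x \<in> carrier G" "y \<in> carrier G" "z \<in> carrier G" "s = x \<otimes> y" "u \<in> U x" "v \<in> V y" "w \<in> W z"
  have t: "(u \<otimes>\<^sub>l v) \<otimes>\<^sub>l w \<in> gtotal (gdom (twassoc U V W))"
    unfolding d using *(5-7) in_gtotal[of u U] in_gtotal[of v V] in_gtotal[of w W]
    by (intro ltensor_in_gtotal gtensor_gspaces U V W is_monoid)
  have "gmap (twassoc U V W) (twtensor s z (twtensor x y u v) w) =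
      (inverse (F s z) * inverse (F x y) * twist_assoc G F x y z) *\<^sub>l (u \<otimes>\<^sub>l (v \<otimes>\<^sub>l w))"
    by (simp add: twtensor_def ltensor_scale_left gmap_scale[OF a t] s(2)[OF *(1-3,5-7)])
  also have "\<dots> = twtensor x (y \<otimes> z) u (twtensor y z v w)"
    using * F_nonzero[of x y] F_nonzero[of "x \<otimes> y" z]
    by (simp add: twtensor_def ltensor_scale_right twist_assoc_def field_simps)
  finally show "gmap (twassoc U V W) (twtensor s z (twtensor x y u v) w) = twtensor x (y \<otimes> z) u (twtensor y z v w)" .
qed

lemma twassoc'_arr:
  assumes U: "U \<in> gspaces G" and V: "V \<in> gspaces G" and W: "W \<in> gspaces G"
  shows "gdom (twassoc' U V W) = gtensor G U (gtensor G V W)"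
    and "gcod (twassoc' U V W) = gtensor G (gtensor G U V) W"
    and "arr (twassoc' U V W)"
    and "x \<in> carrier G \<Longrightarrow> y \<in> carrier G \<Longrightarrow> z \<in> carrier G \<Longrightarrow> s = y \<otimes> z \<Longrightarrow> u \<in> U x \<Longrightarrow> v \<in> V y \<Longrightarrow> w \<in> W z \<Longrightarrow>
      gmap (twassoc' U V W) (twtensor x s u (twtensor y z v w)) = twtensor (x \<otimes> y) z (twtensor x y u v) w"
proof -
  note s = gassoc_inv_spec[OF U V W, THEN conjunct1] gassoc_inv_spec[OF U V W, THEN conjunct2, rule_format]
  show d: "gdom (twassoc' U V W) = gtensor G U (gtensor G V W)"
    and "gcod (twassoc' U V W) = gtensor G (gtensor G U V) W"
    using s(1) by (simp_all add: ghom_gdom ghom_gcod)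
  show a: "arr (twassoc' U V W)"
    by (intro arrI[OF s(1)] gtensor_gspaces U V W)
  assume *: "x \<in> carrier G" "y \<in> carrier G" "z \<in> carrier G" "s = y \<otimes> z" "u \<in> U x" "v \<in> V y" "w \<in> W z"
  have t: "u \<otimes>\<^sub>l (v \<otimes>\<^sub>l w) \<in> gtotal (gdom (twassoc' U V W))"
    unfolding d using *(5-7) in_gtotal[of u U] in_gtotal[of v V] in_gtotal[of w W]
    by (intro ltensor_in_gtotal gtensor_gspaces U V W is_monoid)
  have "gmap (twassoc' U V W) (twtensor x s u (twtensor y z v w)) =
      (inverse (F x s) * inverse (F y z) * inverse (twist_assoc G F x y z)) *\<^sub>l ((u \<otimes>\<^sub>l v) \<otimes>\<^sub>l w)"
    by (simp add: twtensor_def ltensor_scale_right gmap_scale[OF a t] s(2)[OF *(1-3,5-7)])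
  also have "\<dots> = twtensor (x \<otimes> y) z (twtensor x y u v) w"
    using * F_nonzero[of y z] F_nonzero[of x "y \<otimes> z"]
    by (simp add: twtensor_def ltensor_scale_left twist_assoc_def field_simps)
  finally show "gmap (twassoc' U V W) (twtensor x s u (twtensor y z v w)) = twtensor (x \<otimes> y) z (twtensor x y u v) w" .
qed

lemma twbraid_arr:
  assumes V: "V \<in> gspaces G" and W: "W \<in> gspaces G"
  shows "gdom (twbraid V W) = gtensor G V W"
    and "gcod (twbraid V W) = gtensor G W V"
    and "arr (twbraid V W)"
    and "x \<in> carrier G \<Longrightarrow> y \<in> carrier G \<Longrightarrow> v \<in> V x \<Longrightarrow> w \<in> W y \<Longrightarrow>
      gmap (twbraid V W) (twtensor x y v w) = twtensor y x w v"
proof -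
  note spec = gbraid_spec[OF V W, of "\<lambda>x y. F x y * inverse (F y x)"]
  note s = spec[THEN conjunct1] spec[THEN conjunct2, rule_format]
  show d: "gdom (twbraid V W) = gtensor G V W" and "gcod (twbraid V W) = gtensor G W V"
    using s(1) by (simp_all add: ghom_gdom ghom_gcod)
  show a: "arr (twbraid V W)"
    by (intro arrI[OF s(1)] gtensor_gspaces V W)
  assume *: "x \<in> carrier G" "y \<in> carrier G" "v \<in> V x" "w \<in> W y"
  have t: "v \<otimes>\<^sub>l w \<in> gtotal (gdom (twbraid V W))"
    unfolding d using *(3,4) in_gtotal[of v V] in_gtotal[of w W]
    by (intro ltensor_in_gtotal V W is_monoid)
  show "gmap (twbraid V W) (twtensor x y v w) = twtensor y x w v"
    using * by (simp add: twtensor_def gmap_scale[OF a t] s(2)[OF *] F_nonzero)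
qed

lemma glunit_arr:
  assumes V: "V \<in> gspaces G"
  shows "gdom (glunit G V) = gtensor G (gunit G) V" and "gcod (glunit G V) = V" and "arr (glunit G V)"
    and "x \<in> carrier G \<Longrightarrow> v \<in> gtotal V \<Longrightarrow> gmap (glunit G V) (twtensor \<one> x (lbasis Triv) v) = v"
  using glunit_spec[OF V]
  by (auto simp: ghom_gdom ghom_gcod twtensor_one_left intro: arrI gtensor_gspaces gunit_gspaces V)

lemma grunit_arr:
  assumes V: "V \<in> gspaces G"
  shows "gdom (grunit G V) = gtensor G V (gunit G)" and "gcod (grunit G V) = V" and "arr (grunit G V)"
    and "x \<in> carrier G \<Longrightarrow> v \<in> gtotal V \<Longrightarrow> gmap (grunit G V) (twtensor x \<one> v (lbasis Triv)) = v"
  using grunit_spec[OF V]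
  by (auto simp: ghom_gdom ghom_gcod twtensor_one_right intro: arrI gtensor_gspaces gunit_gspaces V)

text \<open>The degree \<open>x\<close> in the last claim is arbitrary, as \<open>F \<one> x = 1\<close>. It is chosen to be the degree of \<open>v\<close>
  when the claim is used.\<close>

lemma glunit_inv_arr:
  assumes V: "V \<in> gspaces G"
  shows "gdom (glunit_inv G V) = V" and "gcod (glunit_inv G V) = gtensor G (gunit G) V" and "arr (glunit_inv G V)"
    and "x \<in> carrier G \<Longrightarrow> v \<in> gtotal V \<Longrightarrow> gmap (glunit_inv G V) v = twtensor \<one> x (lbasis Triv) v"
proof -
  have g: "glunit_inv G V = garr V (gtensor G (gunit G) V) (\<lambda>v. lbasis Triv \<otimes>\<^sub>l v)"
    by (simp add: glunit_inv_def garr_def)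
  have h: "glunit_inv G V \<in> ghom G V (gtensor G (gunit G) V)"
    unfolding g by (rule garr_in_ghom[OF llinear_ltensor_right])
      (simp add: gtensor_mem[of \<one> G _ _ "lbasis Triv" "gunit G" _ V] triv_mem)
  then show "gdom (glunit_inv G V) = V" "gcod (glunit_inv G V) = gtensor G (gunit G) V" "arr (glunit_inv G V)"
    by (auto simp: ghom_gdom ghom_gcod intro: arrI gtensor_gspaces gunit_gspaces V)
  show "x \<in> carrier G \<Longrightarrow> v \<in> gtotal V \<Longrightarrow> gmap (glunit_inv G V) v = twtensor \<one> x (lbasis Triv) v"
    by (simp add: g gmap_garr twtensor_one_left)
qed

lemma grunit_inv_arr:
  assumes V: "V \<in> gspaces G"
  shows "gdom (grunit_inv G V) = V" and "gcod (grunit_inv G V) = gtensor G V (gunit G)" and "arr (grunit_inv G V)"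
    and "x \<in> carrier G \<Longrightarrow> v \<in> gtotal V \<Longrightarrow> gmap (grunit_inv G V) v = twtensor x \<one> v (lbasis Triv)"
proof -
  have g: "grunit_inv G V = garr V (gtensor G V (gunit G)) (\<lambda>v. v \<otimes>\<^sub>l lbasis Triv)"
    by (simp add: grunit_inv_def garr_def)
  have h: "grunit_inv G V \<in> ghom G V (gtensor G V (gunit G))"
    unfolding g by (rule garr_in_ghom[OF llinear_ltensor_left])
      (simp add: gtensor_mem[of _ G \<one> _ _ V "lbasis Triv" "gunit G"] triv_mem)
  then show "gdom (grunit_inv G V) = V" "gcod (grunit_inv G V) = gtensor G V (gunit G)" "arr (grunit_inv G V)"
    by (auto simp: ghom_gdom ghom_gcod intro: arrI gtensor_gspaces gunit_gspaces V)
  show "x \<in> carrier G \<Longrightarrow> v \<in> gtotal V \<Longrightarrow> gmap (grunit_inv G V) v = twtensor x \<one> v (lbasis Triv)"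
    by (simp add: g gmap_garr twtensor_one_right)
qed

lemma triv_gtotal: "lbasis Triv \<in> gtotal (gunit G)"
  by (rule in_gtotal[of _ "gunit G", OF triv_mem])

lemmas arrow_simps = triv_gtotal gcomp_arr gident_arr gtensor_arr_arr twassoc_arr twassoc'_arr twbraid_arr
  glunit_arr grunit_arr glunit_inv_arr(1-3) grunit_inv_arr(1-3)
  gtensor_gspaces gunit_gspaces arr_deg arr_gtotal twtensor_mem twtensor_gtotal triv_mem m_assoc

lemma ghom_iff:
  "V \<in> gspaces G \<Longrightarrow> W \<in> gspaces G \<Longrightarrow> f \<in> ghom G V W \<longleftrightarrow> arr f \<and> gdom f = V \<and> gcod f = W"
  by (auto simp: arr_def ghom_gdom ghom_gcod)

text \<open>On twisted tensors all structure morphisms are strict, hence both sides of each axiom send a twisted tensor of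
  homogeneous elements to the same rebracketing or permutation of it.\<close>

lemma Vect_twist_symmetric_monoidal:
  "symmetric_monoidal_category (Vect_twist G F :: (('g, 'a, 'k) gspace, ('g, 'a, 'k) garrow) smc)"
proof (unfold_locales, unfold Vect_twist_def smc.simps)
  fix A B D E A' B' D' :: "('g, 'a, 'k) gspace" and f g h f' g' :: "('g, 'a, 'k) garrow"
  note simps = arrow_simps ghom_iff in_gtotal
  let ?I = "gunit G :: ('g, 'a, 'k) gspace"
  show "?I \<in> gspaces G" by (rule gunit_gspaces)
  assume A: "A \<in> gspaces G"
  show "gident A \<in> ghom G A A" using A by (simp add: simps)
  show "glunit G A \<in> ghom G (gtensor G ?I A) A \<and> glunit_inv G A \<in> ghom G A (gtensor G ?I A)"
    "grunit G A \<in> ghom G (gtensor G A ?I) A \<and> grunit_inv G A \<in> ghom G A (gtensor G A ?I)"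
    using A by (simp_all add: simps)
  show "gcomp (glunit G A) (glunit_inv G A) = gident A \<and> gcomp (glunit_inv G A) (glunit G A) = gident (gtensor G ?I A)"
  proof
    show "gcomp (glunit G A) (glunit_inv G A) = gident A"
      by (rule arr_eqI[of _ _ A]) (simp_all add: A simps glunit_inv_arr(4))
    show "gcomp (glunit_inv G A) (glunit G A) = gident (gtensor G ?I A)"
      by (rule arr_eqI_left_unit[of _ _ A]) (simp_all add: A simps glunit_inv_arr(4))
  qed
  show "gcomp (grunit G A) (grunit_inv G A) = gident A \<and> gcomp (grunit_inv G A) (grunit G A) = gident (gtensor G A ?I)"
  proof
    show "gcomp (grunit G A) (grunit_inv G A) = gident A"
      by (rule arr_eqI[of _ _ A]) (simp_all add: A simps grunit_inv_arr(4))
    show "gcomp (grunit_inv G A) (grunit G A) = gident (gtensor G A ?I)"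
      by (rule arr_eqI_right_unit[of _ _ A]) (simp_all add: A simps grunit_inv_arr(4))
  qed
  assume B: "B \<in> gspaces G"
  show "gtensor G A B \<in> gspaces G" using A B by (rule gtensor_gspaces)
  show "gtensor_arr G (gident A) (gident B) = gident (gtensor G A B)"
    by (rule arr_eqI2[of _ _ A B]) (simp_all add: A B simps)
  show "twbraid A B \<in> ghom G (gtensor G A B) (gtensor G B A)" using A B by (simp add: simps)
  show "gcomp (twbraid B A) (twbraid A B) = gident (gtensor G A B)"
    by (rule arr_eqI2[of _ _ A B]) (simp_all add: A B simps)
  show "gcomp (gtensor_arr G (gident A) (glunit G B)) (twassoc A ?I B) = gtensor_arr G (grunit G A) (gident B)"
  proof (rule arr_eqI3_left[of _ _ A ?I B])
    (* The rules for the unit constraints only see the basis vector of the unit object. *)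
    fix x y z a u b
    assume *: "x \<in> carrier G" "y \<in> carrier G" "z \<in> carrier G" "a \<in> A x" "u \<in> ?I y" "b \<in> B z"
    show "gmap (gcomp (gtensor_arr G (gident A) (glunit G B)) (twassoc A ?I B)) (twtensor (x \<otimes> y) z (twtensor x y a u) b) =
        gmap (gtensor_arr G (grunit G A) (gident B)) (twtensor (x \<otimes> y) z (twtensor x y a u) b)"
      using *(5)
    proof (cases rule: gunit_cases)
      case (scalar c)
      have "twtensor \<one> z (lbasis Triv) b \<in> gtotal (gtensor G ?I B)" "twtensor x \<one> a (lbasis Triv) \<in> gtotal (gtensor G A ?I)"
        using * by (simp_all add: A B simps)
      then show ?thesis
        using * scalar by (simp add: A B simps twtensor_scale_left twtensor_scale_right gmap_scale)
    next
      case zero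
      then show ?thesis
        using * by (simp add: A B simps twtensor_zero_left twtensor_zero_right gmap_zero)
    qed
  qed (simp_all add: A B simps)
  { assume f: "f \<in> ghom G A B"
    show "gcomp (gident B) f = f"
      using f by (intro arr_eqI[of "gcomp (gident B) f" f A]) (simp_all add: A B simps)
    show "gcomp f (gident A) = f"
      using f by (intro arr_eqI[of "gcomp f (gident A)" f A]) (simp_all add: A B simps)
    show "gcomp (glunit G B) (gtensor_arr G (gident ?I) f) = gcomp f (glunit G A)"
      using f by (intro arr_eqI_left_unit[of _ _ A]) (simp_all add: A B simps)
    show "gcomp (grunit G B) (gtensor_arr G f (gident ?I)) = gcomp f (grunit G A)"
      using f by (intro arr_eqI_right_unit[of _ _ A]) (simp_all add: A B simps) }
  assume D: "D \<in> gspaces G"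
  show "f \<in> ghom G A B \<Longrightarrow> g \<in> ghom G B D \<Longrightarrow> gcomp g f \<in> ghom G A D"
    using A B D by (simp add: simps)
  show "twassoc A B D \<in> ghom G (gtensor G (gtensor G A B) D) (gtensor G A (gtensor G B D))"
    "twassoc' A B D \<in> ghom G (gtensor G A (gtensor G B D)) (gtensor G (gtensor G A B) D)"
    using A B D by (simp_all add: simps)
  show "gcomp (twassoc A B D) (twassoc' A B D) = gident (gtensor G A (gtensor G B D)) \<and>
     gcomp (twassoc' A B D) (twassoc A B D) = gident (gtensor G (gtensor G A B) D)"
  proof
    show "gcomp (twassoc A B D) (twassoc' A B D) = gident (gtensor G A (gtensor G B D))"
      by (rule arr_eqI3_right[of _ _ A B D]) (simp_all add: A B D simps)
    show "gcomp (twassoc' A B D) (twassoc A B D) = gident (gtensor G (gtensor G A B) D)"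
      by (rule arr_eqI3_left[of _ _ A B D]) (simp_all add: A B D simps)
  qed
  show "gcomp (twassoc B D A) (gcomp (twbraid A (gtensor G B D)) (twassoc A B D)) =
     gcomp (gtensor_arr G (gident B) (twbraid A D)) (gcomp (twassoc B A D) (gtensor_arr G (twbraid A B) (gident D)))"
    by (rule arr_eqI3_left[of _ _ A B D]) (simp_all add: A B D simps m_comm)
  assume E: "E \<in> gspaces G"
  show "f \<in> ghom G A B \<Longrightarrow> g \<in> ghom G B D \<Longrightarrow> h \<in> ghom G D E \<Longrightarrow>
     gcomp (gcomp h g) f = gcomp h (gcomp g f)"
    by (rule arr_eqI[of _ _ A]) (simp_all add: A B D E simps)
  show "gcomp (gtensor_arr G (gident A) (twassoc B D E)) (gcomp (twassoc A (gtensor G B D) E) (gtensor_arr G (twassoc A B D) (gident E))) =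
    gcomp (twassoc A B (gtensor G D E)) (twassoc (gtensor G A B) D E)"
    by (rule arr_eqI4_left[of _ _ A B D E]) (simp_all add: A B D E simps)
  assume A': "A' \<in> gspaces G" and B': "B' \<in> gspaces G"
  show "f \<in> ghom G A B \<Longrightarrow> f' \<in> ghom G A' B' \<Longrightarrow>
      gtensor_arr G f f' \<in> ghom G (gtensor G A A') (gtensor G B B')"
    using A B A' B' by (simp add: simps)
  show "f \<in> ghom G A A' \<Longrightarrow> g \<in> ghom G B B' \<Longrightarrow>
      gcomp (twbraid A' B') (gtensor_arr G f g) = gcomp (gtensor_arr G g f) (twbraid A B)"
    by (rule arr_eqI2[of _ _ A B]) (simp_all add: A B A' B' simps)
  assume D': "D' \<in> gspaces G"
  show "f \<in> ghom G A B \<Longrightarrow> g \<in> ghom G B D \<Longrightarrow> f' \<in> ghom G A' B' \<Longrightarrow> g' \<in> ghom G B' D' \<Longrightarrow>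
      gtensor_arr G (gcomp g f) (gcomp g' f') = gcomp (gtensor_arr G g g') (gtensor_arr G f f')"
    by (rule arr_eqI2[of _ _ A A']) (simp_all add: A B D A' B' D' simps)
  show "f \<in> ghom G A A' \<Longrightarrow> g \<in> ghom G B B' \<Longrightarrow> h \<in> ghom G D D' \<Longrightarrow>
      gcomp (twassoc A' B' D') (gtensor_arr G (gtensor_arr G f g) h) =
      gcomp (gtensor_arr G f (gtensor_arr G g h)) (twassoc A B D)"
    by (rule arr_eqI3_left[of _ _ A B D]) (simp_all add: A B D A' B' D' simps)
qed

end

section \<open>The weak Hopf algebra structure on the group algebra\<close>

locale twisted_group_algebra = twisted_grading G F
  for G :: "('g, 'b) monoid_scheme" (structure) and F :: "'g \<Rightarrow> 'g \<Rightarrow> 'k::field" +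
  assumes order_nonzero: "of_nat (order G) \<noteq> (0 :: 'k)"
begin

abbreviation comp_arrow  (infixr "\<bullet>" 65) where "g \<bullet> f \<equiv> gcomp g f"
abbreviation tens_arrow  (infixr "\<boxtimes>" 70) where "f \<boxtimes> g \<equiv> gtensor_arr G f g"

abbreviation kG :: "('g, 'g, 'k) gspace" where "kG \<equiv> group_alg G"
abbreviation bas :: "'g \<Rightarrow> ('g, 'k) lvec" where "bas x \<equiv> lbasis (Base x)"
abbreviation bas2 :: "'g \<Rightarrow> 'g \<Rightarrow> ('g, 'k) lvec" where "bas2 x y \<equiv> twtensor x y (bas x) (bas y)"
abbreviation N :: 'k where "N \<equiv> of_nat (order G)"
abbreviation kI :: "('g, 'g, 'k) gspace" where "kI \<equiv> gunit G"
abbreviation id_kG :: "('g, 'g, 'k) garrow" where "id_kG \<equiv> gident kG"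

lemma bas_mem: "x \<in> carrier G \<Longrightarrow> bas x \<in> kG x"
  by (simp add: group_alg_def lv.span_base)

lemma bas_gtotal: "x \<in> carrier G \<Longrightarrow> bas x \<in> gtotal kG"
  by (rule in_gtotal[of _ kG, OF bas_mem])

lemma kG_gspaces: "kG \<in> gspaces G"
  by (rule group_alg_gspaces)

lemma kG_scalar:
  assumes "x \<in> carrier G" and "v \<in> kG x"
  shows "\<exists>c. v = c *\<^sub>l bas x"
proof -
  have "v \<in> range (\<lambda>c. c *\<^sub>l bas x)"
    using assms by (simp only: group_alg_def if_True lv.span_singleton)
  then show ?thesis by (rule rangeE) (rule exI)
qed

lemma arr_eqI_kG:
  assumes fg: "arr f" "arr g" "gdom f = kG" "gdom g = kG" "gcod f = gcod g"
    and eq: "\<And>x. x \<in> carrier G \<Longrightarrow> gmap f (bas x) = gmap g (bas x)"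
  shows "f = g"
proof (rule arr_eqI[OF fg])
  fix x v assume x: "x \<in> carrier G" and v: "v \<in> kG x"
  obtain c where v: "v = c *\<^sub>l bas x" using kG_scalar[OF x v] by (elim exE)
  show "gmap f v = gmap g v"
    by (simp add: v gmap_scale fg bas_gtotal eq x)
qed

lemma arr_eqI2_kG:
  assumes fg: "arr f" "arr g" "gdom f = gtensor G kG kG" "gdom g = gtensor G kG kG" "gcod f = gcod g"
    and eq: "\<And>x y. x \<in> carrier G \<Longrightarrow> y \<in> carrier G \<Longrightarrow> gmap f (bas2 x y) = gmap g (bas2 x y)"
  shows "f = g"
proof (rule arr_eqI2[OF fg kG_gspaces kG_gspaces])
  fix x y u v assume x: "x \<in> carrier G" and y: "y \<in> carrier G" and u: "u \<in> kG x" and v: "v \<in> kG y"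
  obtain c d where uv: "u = c *\<^sub>l bas x" "v = d *\<^sub>l bas y"
    using kG_scalar[OF x u] kG_scalar[OF y v] by (elim exE)
  have "bas2 x y \<in> gtotal (gtensor G kG kG)"
    by (intro twtensor_gtotal kG_gspaces bas_gtotal x y)
  then show "gmap f (twtensor x y u v) = gmap g (twtensor x y u v)"
    by (simp add: uv twtensor_scale_left twtensor_scale_right gmap_scale fg eq x y)
qed

lemma arr_eqI3_kG:
  assumes fg: "arr f" "arr g" "gdom f = gtensor G (gtensor G kG kG) kG" "gdom g = gtensor G (gtensor G kG kG) kG"
      "gcod f = gcod g"
    and eq: "\<And>x y z. x \<in> carrier G \<Longrightarrow> y \<in> carrier G \<Longrightarrow> z \<in> carrier G \<Longrightarrow>
      gmap f (twtensor (x \<otimes> y) z (bas2 x y) (bas z)) = gmap g (twtensor (x \<otimes> y) z (bas2 x y) (bas z))"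
  shows "f = g"
proof (rule arr_eqI3_left[OF fg kG_gspaces kG_gspaces kG_gspaces])
  fix x y z u v w assume x: "x \<in> carrier G" and y: "y \<in> carrier G" and z: "z \<in> carrier G"
    and u: "u \<in> kG x" and v: "v \<in> kG y" and w: "w \<in> kG z"
  obtain c d b where uv: "u = c *\<^sub>l bas x" "v = d *\<^sub>l bas y" "w = b *\<^sub>l bas z"
    using kG_scalar[OF x u] kG_scalar[OF y v] kG_scalar[OF z w] by (elim exE)
  have "twtensor (x \<otimes> y) z (bas2 x y) (bas z) \<in> gtotal (gtensor G (gtensor G kG kG) kG)"
    by (intro twtensor_gtotal gtensor_gspaces kG_gspaces bas_gtotal x y z)
  then show "gmap f (twtensor (x \<otimes> y) z (twtensor x y u v) w) = gmap g (twtensor (x \<otimes> y) z (twtensor x y u v) w)"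
    by (simp add: uv twtensor_scale_left twtensor_scale_right gmap_scale fg eq x y z)
qed

lemma arr_eqI_kI:
  assumes fg: "arr f" "arr g" "gdom f = kI" "gdom g = kI" "gcod f = gcod g"
    and eq: "gmap f (lbasis Triv) = gmap g (lbasis Triv)"
  shows "f = g"
proof (rule arr_eqI[OF fg])
  fix x u assume "u \<in> kI x"
  then show "gmap f u = gmap g u"
    by (cases rule: gunit_cases) (simp_all add: gmap_scale gmap_zero fg triv_gtotal eq)
qed

definition mul :: "('g, 'g, 'k) garrow" where
  "mul = garr (gtensor G kG kG) kG
    (\<lambda>v. \<Sum>x\<in>carrier G. \<Sum>y\<in>carrier G. v (Join (Base x) (Base y)) *\<^sub>l (F x y *\<^sub>l bas (x \<otimes> y)))"

definition unit_map :: "('g, 'g, 'k) garrow" where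
  "unit_map = garr kI kG (\<lambda>v. v Triv *\<^sub>l bas \<one>)"

text \<open>This is \<open>x \<mapsto> N\<^sup>-\<^sup>1 (\<Sum>uv=x. u \<odot> v)\<close>, the sum being parametrized by \<open>u\<close>.\<close>

definition comul :: "('g, 'g, 'k) garrow" where
  "comul = garr kG (gtensor G kG kG)
    (\<lambda>v. \<Sum>x\<in>carrier G. v (Base x) *\<^sub>l ((1 / N) *\<^sub>l (\<Sum>u\<in>carrier G. bas2 u (inv u \<otimes> x))))"

definition counit :: "('g, 'g, 'k) garrow" where
  "counit = garr kG kI (\<lambda>v. v (Base \<one>) *\<^sub>l (N *\<^sub>l lbasis Triv))"

lemma cancel_left: "x \<in> carrier G \<Longrightarrow> y \<in> carrier G \<Longrightarrow> x \<otimes> (inv x \<otimes> y) = y"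
  and cancel_left': "x \<in> carrier G \<Longrightarrow> y \<in> carrier G \<Longrightarrow> inv x \<otimes> (x \<otimes> y) = y"
  by (simp_all add: m_assoc[symmetric])

lemma sum_delta_lvec:
  assumes "x \<in> carrier G"
  shows "(\<Sum>y\<in>carrier G. bas x (Base y) *\<^sub>l f y) = f x"
proof -
  have "bas x (Base y) *\<^sub>l f y = (if y = x then f x else 0)" for y
    by (simp add: lbasis_def)
  then show ?thesis using assms finite_carrier by simp
qed

lemma mul_on_bas:
  assumes x: "x \<in> carrier G" and y: "y \<in> carrier G"
  shows "(\<Sum>x'\<in>carrier G. \<Sum>y'\<in>carrier G. (bas x \<otimes>\<^sub>l bas y) (Join (Base x') (Base y')) *\<^sub>l
    (F x' y' *\<^sub>l bas (x' \<otimes> y'))) = F x y *\<^sub>l bas (x \<otimes> y)"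
proof -
  have "(\<Sum>x'\<in>carrier G. \<Sum>y'\<in>carrier G. (bas x \<otimes>\<^sub>l bas y) (Join (Base x') (Base y')) *\<^sub>l
      (F x' y' *\<^sub>l bas (x' \<otimes> y'))) =
    (\<Sum>x'\<in>carrier G. bas x (Base x') *\<^sub>l (\<Sum>y'\<in>carrier G. bas y (Base y') *\<^sub>l (F x' y' *\<^sub>l bas (x' \<otimes> y'))))"
    by (simp add: ltensor_def lv.scale_sum_right mult.assoc)
  then show ?thesis using x y by (simp only: sum_delta_lvec)
qed

lemma mul_arr:
  shows "gdom mul = gtensor G kG kG" and "gcod mul = kG" and "arr mul"
    and "x \<in> carrier G \<Longrightarrow> y \<in> carrier G \<Longrightarrow> gmap mul (bas2 x y) = bas (x \<otimes> y)"
    and "x \<in> carrier G \<Longrightarrow> y \<in> carrier G \<Longrightarrow> gmap mul (bas x \<otimes>\<^sub>l bas y) = F x y *\<^sub>l bas (x \<otimes> y)"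
proof -
  let ?M = "\<lambda>v. \<Sum>x\<in>carrier G. \<Sum>y\<in>carrier G. v (Join (Base x) (Base y)) *\<^sub>l (F x y *\<^sub>l bas (x \<otimes> y))"
  have L: "llinear ?M"
    by (intro llinear_sum llinear_coordinate)
  have "mul \<in> ghom G (gtensor G kG kG) kG"
    unfolding mul_def
  proof (rule garr_in_ghom[OF L])
    fix z t assume t: "t \<in> gtensor G kG kG z"
    show "?M t \<in> kG z"
    proof (rule gtensor_map_into[OF L gspaces_subspace[OF kG_gspaces] _ t])
      fix x y v w assume *: "x \<in> carrier G" "y \<in> carrier G" "x \<otimes> y = z" "v \<in> kG x" "w \<in> kG y"
      obtain c d where v: "v = c *\<^sub>l bas x" "w = d *\<^sub>l bas y"
        using kG_scalar[OF *(1,4)] kG_scalar[OF *(2,5)] by (elim exE)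
      have "?M (v \<otimes>\<^sub>l w) = d *\<^sub>l (c *\<^sub>l ?M (bas x \<otimes>\<^sub>l bas y))"
        unfolding v ltensor_scale_left ltensor_scale_right by (simp only: lvp.linear_scale[OF L])
      also have "\<dots> \<in> kG z"
        unfolding mul_on_bas[OF *(1,2)] *(3)[symmetric] using *(1,2)
        by (intro lv.subspace_scale[OF gspaces_subspace[OF kG_gspaces]] bas_mem) simp
      finally show "?M (v \<otimes>\<^sub>l w) \<in> kG z" .
    qed
  qed
  then show g: "gdom mul = gtensor G kG kG" "gcod mul = kG" and a: "arr mul"
    by (auto simp: ghom_gdom ghom_gcod intro: arrI gtensor_gspaces kG_gspaces)
  assume xy: "x \<in> carrier G" "y \<in> carrier G"
  have t: "bas x \<otimes>\<^sub>l bas y \<in> gtotal (gtensor G kG kG)"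
    by (intro ltensor_in_gtotal kG_gspaces bas_gtotal xy is_monoid)
  show "gmap mul (bas x \<otimes>\<^sub>l bas y) = F x y *\<^sub>l bas (x \<otimes> y)"
    unfolding mul_def gmap_garr[OF t] by (rule mul_on_bas[OF xy])
  then show "gmap mul (bas2 x y) = bas (x \<otimes> y)"
    using t by (simp add: twtensor_def gmap_scale[OF a] g F_nonzero xy)
qed

lemma unit_map_arr:
  shows "gdom unit_map = kI" and "gcod unit_map = kG" and "arr unit_map" and "gmap unit_map (lbasis Triv) = bas \<one>"
proof -
  have "unit_map \<in> ghom G kI kG"
    unfolding unit_map_def
  proof (rule garr_in_ghom[OF llinear_coordinate])
    fix x v assume "v \<in> kI x"
    then show "v Triv *\<^sub>l bas \<one> \<in> kG x"
      by (cases rule: gunit_cases)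
        (simp_all add: bas_mem zero_fun_apply lv.subspace_scale[OF gspaces_subspace[OF kG_gspaces]]
          lv.subspace_0[OF gspaces_subspace[OF kG_gspaces]])
  qed
  then show "gdom unit_map = kI" "gcod unit_map = kG" "arr unit_map"
    by (auto simp: ghom_gdom ghom_gcod intro: arrI gunit_gspaces kG_gspaces)
  show "gmap unit_map (lbasis Triv) = bas \<one>"
    unfolding unit_map_def gmap_garr[OF triv_gtotal] by (simp add: lbasis_def[of Triv])
qed

lemma comul_arr:
  shows "gdom comul = kG" and "gcod comul = gtensor G kG kG" and "arr comul"
    and "x \<in> carrier G \<Longrightarrow> gmap comul (bas x) = (1 / N) *\<^sub>l (\<Sum>u\<in>carrier G. bas2 u (inv u \<otimes> x))"
proof -
  let ?M = "\<lambda>v. \<Sum>x\<in>carrier G. v (Base x) *\<^sub>l ((1 / N) *\<^sub>l (\<Sum>u\<in>carrier G. bas2 u (inv u \<otimes> x)))"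
  have L: "llinear ?M"
    by (intro llinear_sum llinear_coordinate)
  have val: "?M (bas x) = (1 / N) *\<^sub>l (\<Sum>u\<in>carrier G. bas2 u (inv u \<otimes> x))" if "x \<in> carrier G" for x
    using that by (rule sum_delta_lvec)
  have "comul \<in> ghom G kG (gtensor G kG kG)"
    unfolding comul_def
  proof (rule garr_in_ghom[OF L])
    fix x v assume x: "x \<in> carrier G" and v: "v \<in> kG x"
    obtain c where v: "v = c *\<^sub>l bas x" using kG_scalar[OF x v] by (elim exE)
    have "?M v = c *\<^sub>l ?M (bas x)"
      unfolding v by (rule lvp.linear_scale[OF L])
    also have "\<dots> \<in> gtensor G kG kG x"
      unfolding val[OF x]
      by (intro lv.subspace_scale[OF gtensor_subspace] lv.subspace_sum[OF gtensor_subspace] twtensor_mem bas_mem)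
        (simp_all add: x cancel_left)
    finally show "?M v \<in> gtensor G kG kG x" .
  qed
  then show "gdom comul = kG" "gcod comul = gtensor G kG kG" "arr comul"
    by (auto simp: ghom_gdom ghom_gcod intro: arrI gtensor_gspaces kG_gspaces)
  assume x: "x \<in> carrier G"
  show "gmap comul (bas x) = (1 / N) *\<^sub>l (\<Sum>u\<in>carrier G. bas2 u (inv u \<otimes> x))"
    unfolding comul_def gmap_garr[OF bas_gtotal[OF x]] by (rule val[OF x])
qed

lemma counit_arr:
  shows "gdom counit = kG" and "gcod counit = kI" and "arr counit"
    and "x \<in> carrier G \<Longrightarrow> gmap counit (bas x) = (if x = \<one> then N else 0) *\<^sub>l lbasis Triv"
proof -
  have val: "bas x (Base \<one>) *\<^sub>l (N *\<^sub>l lbasis Triv) = (if x = \<one> then N else 0) *\<^sub>l lbasis Triv" for x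
    by (simp add: lbasis_def[of "Base _"])
  have "counit \<in> ghom G kG kI"
    unfolding counit_def
  proof (rule garr_in_ghom[OF llinear_coordinate])
    fix x v assume x: "x \<in> carrier G" and v: "v \<in> kG x"
    obtain c where v: "v = c *\<^sub>l bas x" using kG_scalar[OF x v] by (elim exE)
    have "v (Base \<one>) *\<^sub>l (N *\<^sub>l lbasis Triv) = c *\<^sub>l (bas x (Base \<one>) *\<^sub>l (N *\<^sub>l lbasis Triv))"
      by (simp add: v lscale_def mult_ac)
    also have "\<dots> = c *\<^sub>l ((if x = \<one> then N else 0) *\<^sub>l lbasis Triv)"
      by (simp only: val)
    also have "\<dots> \<in> kI x"
      by (cases "x = \<one>") (simp_all add: triv_mem lv.subspace_scale[OF gspaces_subspace[OF gunit_gspaces]]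
          lv.subspace_0[OF gspaces_subspace[OF gunit_gspaces]])
    finally show "v (Base \<one>) *\<^sub>l (N *\<^sub>l lbasis Triv) \<in> kI x" .
  qed
  then show "gdom counit = kG" "gcod counit = kI" "arr counit"
    by (auto simp: ghom_gdom ghom_gcod intro: arrI gunit_gspaces kG_gspaces)
  assume x: "x \<in> carrier G"
  show "gmap counit (bas x) = (if x = \<one> then N else 0) *\<^sub>l lbasis Triv"
    unfolding counit_def gmap_garr[OF bas_gtotal[OF x]] by (rule val)
qed

end

section \<open>The axioms of a weak braided Hopf algebra\<close>

context twisted_group_algebra
begin

lemma gcomp_assoc:
  assumes "arr f" "arr g" "arr h" "gdom g = gcod f" "gdom h = gcod g"
  shows "gcomp (gcomp h g) f = gcomp h (gcomp g f)"
  by (rule arr_eqI[of _ _ "gdom f"]) (use assms in_gtotal[of _ "gdom f"] in \<open>simp_all add: arrow_simps\<close>)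

lemma sum_const_lvec: "(\<Sum>u\<in>carrier G. v) = N *\<^sub>l (v :: ('g, 'k) lvec)"
  using lv.scale_sum_left[of "\<lambda>_. 1" "carrier G" v] by (simp add: order_def)

lemma sum_translate:
  assumes a: "a \<in> carrier G"
  shows "(\<Sum>u\<in>carrier G. h (a \<otimes> u)) = (\<Sum>u\<in>carrier G. (h u :: ('g, 'k) lvec))"
  by (rule sum.reindex_bij_witness[of _ "\<lambda>u. inv a \<otimes> u" "\<lambda>u. a \<otimes> u"])
    (simp_all add: a cancel_left cancel_left')

lemma cancel_conj: "x \<in> carrier G \<Longrightarrow> y \<in> carrier G \<Longrightarrow> inv x \<otimes> (y \<otimes> x) = y"
  by (simp add: m_comm[of y x] cancel_left')

lemma sum_single:
  assumes "a \<in> carrier G" and "\<And>u. u \<in> carrier G \<Longrightarrow> u \<noteq> a \<Longrightarrow> h u = 0"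
  shows "(\<Sum>u\<in>carrier G. h u) = (h a :: ('g, 'k) lvec)"
proof -
  have "(\<Sum>u\<in>carrier G. h u) = (\<Sum>u\<in>carrier G. if u = a then h u else 0)"
    by (intro sum.cong refl) (use assms(2) in simp)
  then show ?thesis using assms(1) finite_carrier by simp
qed

lemma gtotal_scale: "v \<in> gtotal V \<Longrightarrow> c *\<^sub>l v \<in> gtotal V"
  by (rule lv.subspace_scale[OF gtotal_subspace])

lemma gtotal_sum: "(\<And>i. i \<in> I \<Longrightarrow> v i \<in> gtotal V) \<Longrightarrow> (\<Sum>i\<in>I. v i) \<in> gtotal V"
  by (rule lv.subspace_sum[OF gtotal_subspace])

lemmas alg_simps = arrow_simps mul_arr(1-4) unit_map_arr comul_arr counit_arr
  bas_mem bas_gtotal kG_gspaces twtensor_scale_left twtensor_scale_right twtensor_sum_left twtensor_sum_right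
  twtensor_zero_left twtensor_zero_right gmap_scale gmap_sum gmap_zero gtotal_scale gtotal_sum cancel_left cancel_left'

abbreviation kG2 :: "('g, 'g, 'k) gspace" where "kG2 \<equiv> gtensor G kG kG"
abbreviation asc :: "('g, 'g, 'k) garrow" where "asc \<equiv> twassoc kG kG kG"
abbreviation asc' :: "('g, 'g, 'k) garrow" where "asc' \<equiv> twassoc' kG kG kG"
abbreviation brd :: "('g, 'g, 'k) garrow" where "brd \<equiv> twbraid kG kG"
abbreviation mid_in :: "('g, 'g, 'k) garrow" where "mid_in \<equiv> (asc \<boxtimes> id_kG) \<bullet> twassoc' kG2 kG kG"
abbreviation mid_out :: "('g, 'g, 'k) garrow" where "mid_out \<equiv> twassoc kG2 kG kG \<bullet> (asc' \<boxtimes> id_kG)"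

lemma mul_assoc: "mul \<bullet> (mul \<boxtimes> id_kG) = mul \<bullet> (id_kG \<boxtimes> mul) \<bullet> asc"
  by (rule arr_eqI3_kG) (simp_all add: alg_simps)

lemma mul_unit_left: "mul \<bullet> (unit_map \<boxtimes> id_kG) = glunit G kG"
proof (rule arr_eqI_left_unit[of _ _ kG])
  fix x v assume x: "x \<in> carrier G" and v: "v \<in> kG x"
  obtain c where v: "v = c *\<^sub>l bas x" using kG_scalar[OF x v] by (elim exE)
  show "gmap (mul \<bullet> (unit_map \<boxtimes> id_kG)) (twtensor \<one> x (lbasis Triv) v) = gmap (glunit G kG) (twtensor \<one> x (lbasis Triv) v)"
    using x by (simp add: v alg_simps)
qed (simp_all add: alg_simps)

lemma mul_unit_right: "mul \<bullet> (id_kG \<boxtimes> unit_map) = grunit G kG"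
proof (rule arr_eqI_right_unit[of _ _ kG])
  fix x v assume x: "x \<in> carrier G" and v: "v \<in> kG x"
  obtain c where v: "v = c *\<^sub>l bas x" using kG_scalar[OF x v] by (elim exE)
  show "gmap (mul \<bullet> (id_kG \<boxtimes> unit_map)) (twtensor x \<one> v (lbasis Triv)) = gmap (grunit G kG) (twtensor x \<one> v (lbasis Triv))"
    using x by (simp add: v alg_simps)
qed (simp_all add: alg_simps)

lemma mul_commutative: "mul \<bullet> brd = mul"
  by (rule arr_eqI2_kG) (simp_all add: alg_simps m_comm)

lemma comul_cocommutative: "brd \<bullet> comul = comul"
proof (rule arr_eqI_kG)
  fix x assume x: "x \<in> carrier G"
  have "gmap (brd \<bullet> comul) (bas x) = (1 / N) *\<^sub>l (\<Sum>u\<in>carrier G. bas2 (inv u \<otimes> x) u)"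
    using x by (simp add: alg_simps)
  also have "(\<Sum>u\<in>carrier G. bas2 (inv u \<otimes> x) u) = (\<Sum>u\<in>carrier G. bas2 u (inv u \<otimes> x))"
    by (rule sum.reindex_bij_witness[of _ "\<lambda>u. inv u \<otimes> x" "\<lambda>u. inv u \<otimes> x"])
      (use x in \<open>simp_all add: inv_mult_group m_assoc cancel_conj\<close>)
  finally show "gmap (brd \<bullet> comul) (bas x) = gmap comul (bas x)"
    using x by (simp add: alg_simps)
qed (simp_all add: alg_simps)

text \<open>Both sides are sums over all factorizations of \<open>x\<close> into three factors. The left side has the factors
  \<open>w\<close>, \<open>w\<^sup>-\<^sup>1u\<close>, \<open>u\<^sup>-\<^sup>1x\<close>, and for fixed \<open>w\<close> the substitution \<open>s = w\<^sup>-\<^sup>1u\<close> gives the right side.\<close>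

lemma comul_coassoc: "asc \<bullet> (comul \<boxtimes> id_kG) \<bullet> comul = (id_kG \<boxtimes> comul) \<bullet> comul"
proof (rule arr_eqI_kG)
  fix x assume x: "x \<in> carrier G"
  let ?h = "\<lambda>w s. twtensor w (inv w \<otimes> x) (bas w) (bas2 s (inv s \<otimes> (inv w \<otimes> x)))"
  have "gmap (asc \<bullet> (comul \<boxtimes> id_kG) \<bullet> comul) (bas x) = (1 / N) *\<^sub>l (\<Sum>u\<in>carrier G. (1 / N) *\<^sub>l (\<Sum>w\<in>carrier G.
      twtensor w (inv w \<otimes> x) (bas w) (bas2 (inv w \<otimes> u) (inv u \<otimes> x))))"
    using x by (simp add: alg_simps)
  also have "\<dots> = (1 / N) *\<^sub>l (\<Sum>u\<in>carrier G. (1 / N) *\<^sub>l (\<Sum>w\<in>carrier G. ?h w (inv w \<otimes> u)))"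
    using x by (intro arg_cong2[of _ _ _ _ lscale] refl sum.cong) (simp add: inv_mult_group m_assoc cancel_left)
  also have "\<dots> = (1 / N) *\<^sub>l ((1 / N) *\<^sub>l (\<Sum>w\<in>carrier G. \<Sum>u\<in>carrier G. ?h w (inv w \<otimes> u)))"
    by (subst sum.swap) (simp only: lv.scale_sum_right)
  also have "\<dots> = (1 / N) *\<^sub>l ((1 / N) *\<^sub>l (\<Sum>w\<in>carrier G. \<Sum>u\<in>carrier G. ?h w u))"
    by (intro arg_cong2[of _ _ _ _ lscale] refl sum.cong sum_translate) simp
  also have "\<dots> = gmap ((id_kG \<boxtimes> comul) \<bullet> comul) (bas x)"
    using x by (simp add: alg_simps lv.scale_sum_right)
  finally show "gmap (asc \<bullet> (comul \<boxtimes> id_kG) \<bullet> comul) (bas x) = gmap ((id_kG \<boxtimes> comul) \<bullet> comul) (bas x)" .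
qed (simp_all add: alg_simps)

lemma counit_left: "glunit G kG \<bullet> (counit \<boxtimes> id_kG) \<bullet> comul = id_kG"
proof (rule arr_eqI_kG)
  fix x assume x: "x \<in> carrier G"
  let ?t = "\<lambda>u. gmap (glunit G kG) (twtensor u (inv u \<otimes> x) ((if u = \<one> then N else 0) *\<^sub>l lbasis Triv) (bas (inv u \<otimes> x)))"
  have "gmap (glunit G kG \<bullet> (counit \<boxtimes> id_kG) \<bullet> comul) (bas x) = (1 / N) *\<^sub>l (\<Sum>u\<in>carrier G. ?t u)"
    using x by (simp add: alg_simps del: lv.scale_eq_0_iff twtensor_scale_left)
  also have "(\<Sum>u\<in>carrier G. ?t u) = ?t \<one>"
    by (rule sum_single) (use x in \<open>simp_all add: alg_simps\<close>)
  also have "(1 / N) *\<^sub>l ?t \<one> = bas x"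
    using x by (simp add: alg_simps order_nonzero)
  finally show "gmap (glunit G kG \<bullet> (counit \<boxtimes> id_kG) \<bullet> comul) (bas x) = gmap id_kG (bas x)"
    using x by (simp add: alg_simps)
qed (simp_all add: alg_simps)

lemma counit_right: "grunit G kG \<bullet> (id_kG \<boxtimes> counit) \<bullet> comul = id_kG"
proof (rule arr_eqI_kG)
  fix x assume x: "x \<in> carrier G"
  let ?t = "\<lambda>u. gmap (grunit G kG) (twtensor u (inv u \<otimes> x) (bas u) ((if inv u \<otimes> x = \<one> then N else 0) *\<^sub>l lbasis Triv))"
  have "gmap (grunit G kG \<bullet> (id_kG \<boxtimes> counit) \<bullet> comul) (bas x) = (1 / N) *\<^sub>l (\<Sum>u\<in>carrier G. ?t u)"
    using x by (simp add: alg_simps del: lv.scale_eq_0_iff twtensor_scale_right)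
  also have "(\<Sum>u\<in>carrier G. ?t u) = ?t x"
  proof (rule sum_single[OF x])
    fix u assume u: "u \<in> carrier G" "u \<noteq> x"
    then have "inv u \<otimes> x \<noteq> \<one>"
      using x cancel_left[of u x] by auto
    then show "?t u = 0" by (simp add: alg_simps)
  qed
  also have "(1 / N) *\<^sub>l ?t x = bas x"
    using x by (simp add: alg_simps order_nonzero)
  finally show "gmap (grunit G kG \<bullet> (id_kG \<boxtimes> counit) \<bullet> comul) (bas x) = gmap id_kG (bas x)"
    using x by (simp add: alg_simps)
qed (simp_all add: alg_simps)

text \<open>Multiplying \<open>u \<odot> s\<close> and \<open>v \<odot> t\<close> with \<open>us = x\<close>, \<open>vt = y\<close> gives \<open>uv \<odot> st\<close>, so every factorization of \<open>xy\<close>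
  arises \<open>N\<close> times, and this compensates one of the two factors \<open>N\<^sup>-\<^sup>1\<close> of \<open>\<Delta> \<otimes> \<Delta>\<close>.\<close>

lemma comul_mul:
  "comul \<bullet> mul = (mul \<boxtimes> mul) \<bullet> mid_out \<bullet> ((id_kG \<boxtimes> brd) \<boxtimes> id_kG) \<bullet> mid_in \<bullet> (comul \<boxtimes> comul)"
proof -
  define R where "R = (mul \<boxtimes> mul) \<bullet> mid_out \<bullet> ((id_kG \<boxtimes> brd) \<boxtimes> id_kG) \<bullet> mid_in"
  have R: "arr R" "gdom R = gtensor G kG2 kG2" "gcod R = kG2"
    by (simp_all add: R_def alg_simps)
  (* For independent factors u, s, v, t no inverses occur in the degrees, so that the laws of a
     commutative monoid suffice to compare them. The inverses are substituted afterwards. *)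
  have R_val: "gmap R (twtensor (u \<otimes> s) (v \<otimes> t) (bas2 u s) (bas2 v t)) = bas2 (u \<otimes> v) (s \<otimes> t)"
    if "u \<in> carrier G" "s \<in> carrier G" "v \<in> carrier G" "t \<in> carrier G" for u s v t
    using that by (simp add: R_def alg_simps m_ac)
  have "comul \<bullet> mul = R \<bullet> (comul \<boxtimes> comul)"
  proof (rule arr_eqI2_kG)
    fix x y assume x: "x \<in> carrier G" and y: "y \<in> carrier G"
    let ?h = "\<lambda>w. bas2 w (inv w \<otimes> (x \<otimes> y))"
    have val: "gmap R (twtensor x y (bas2 u (inv u \<otimes> x)) (bas2 v (inv v \<otimes> y))) = ?h (u \<otimes> v)"
      if "u \<in> carrier G" "v \<in> carrier G" for u v
    proof -
      have "inv u \<otimes> x \<otimes> (inv v \<otimes> y) = inv (u \<otimes> v) \<otimes> (x \<otimes> y)"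
        using that x y by (simp add: inv_mult m_ac)
      then show ?thesis
        using R_val[of u "inv u \<otimes> x" v "inv v \<otimes> y"] that x y
        by (simp only: cancel_left inv_closed m_closed)
    qed
    have "gmap (R \<bullet> (comul \<boxtimes> comul)) (bas2 x y) =
        (1 / N) *\<^sub>l ((1 / N) *\<^sub>l (\<Sum>v\<in>carrier G. \<Sum>u\<in>carrier G. ?h (u \<otimes> v)))"
      using x y R by (simp add: alg_simps val lv.scale_sum_right)
    also have "(\<Sum>v\<in>carrier G. \<Sum>u\<in>carrier G. ?h (u \<otimes> v)) = (\<Sum>u\<in>carrier G. \<Sum>v\<in>carrier G. ?h (u \<otimes> v))"
      by (rule sum.swap)
    also have "(1 / N) *\<^sub>l ((1 / N) *\<^sub>l (\<Sum>u\<in>carrier G. \<Sum>v\<in>carrier G. ?h (u \<otimes> v))) =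
        (1 / N) *\<^sub>l ((1 / N) *\<^sub>l (\<Sum>u\<in>carrier G. \<Sum>v\<in>carrier G. ?h v))"
      by (intro arg_cong2[of _ _ _ _ lscale] refl sum.cong sum_translate)
    also have "\<dots> = gmap (comul \<bullet> mul) (bas2 x y)"
      using x y by (simp add: alg_simps sum_const_lvec order_nonzero del: sum_constant)
    finally show "gmap (comul \<bullet> mul) (bas2 x y) = gmap (R \<bullet> (comul \<boxtimes> comul)) (bas2 x y)" by simp
  qed (simp_all add: alg_simps R)
  also have "\<dots> = (mul \<boxtimes> mul) \<bullet> mid_out \<bullet> ((id_kG \<boxtimes> brd) \<boxtimes> id_kG) \<bullet> mid_in \<bullet> (comul \<boxtimes> comul)"
    by (simp add: R_def gcomp_assoc alg_simps)
  finally show ?thesis .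
qed

text \<open>In the comultiplication of the middle factor \<open>y\<close> only the term \<open>y = u s\<close> with \<open>u = x\<^sup>-\<^sup>1\<close> survives the
  first counit, and the second one then tests \<open>xyz = 1\<close>. The scalar is \<open>N\<^sup>-\<^sup>1 N N = N\<close>.\<close>

lemma counit_mul:
  "counit \<bullet> mul \<bullet> (mul \<boxtimes> id_kG) =
    glunit G kI \<bullet> ((counit \<bullet> mul) \<boxtimes> (counit \<bullet> mul)) \<bullet> mid_out \<bullet> ((id_kG \<boxtimes> comul) \<boxtimes> id_kG)"
proof -
  define R where "R = glunit G kI \<bullet> ((counit \<bullet> mul) \<boxtimes> (counit \<bullet> mul)) \<bullet> mid_out"
  have R: "arr R" "gdom R = gtensor G (gtensor G kG kG2) kG" "gcod R = kI"
    by (simp_all add: R_def alg_simps)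
  have R_val: "gmap R (twtensor (x \<otimes> (u \<otimes> s)) z (twtensor x (u \<otimes> s) (bas x) (bas2 u s)) (bas z)) =
      (if x \<otimes> u = \<one> \<and> s \<otimes> z = \<one> then N * N else 0) *\<^sub>l lbasis Triv"
    if "x \<in> carrier G" "u \<in> carrier G" "s \<in> carrier G" "z \<in> carrier G" for x u s z
    using that by (simp add: R_def alg_simps)
  have "counit \<bullet> mul \<bullet> (mul \<boxtimes> id_kG) = R \<bullet> ((id_kG \<boxtimes> comul) \<boxtimes> id_kG)"
  proof (rule arr_eqI3_kG)
    fix x y z assume x: "x \<in> carrier G" and y: "y \<in> carrier G" and z: "z \<in> carrier G"
    let ?t = "\<lambda>u. (if x \<otimes> u = \<one> \<and> inv u \<otimes> y \<otimes> z = \<one> then N * N else 0) *\<^sub>l lbasis Triv :: ('g, 'k) lvec"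
    have val: "gmap R (twtensor (x \<otimes> y) z (twtensor x y (bas x) (bas2 u (inv u \<otimes> y))) (bas z)) = ?t u"
      if "u \<in> carrier G" for u
      using R_val[of x u "inv u \<otimes> y" z] that x y z by (simp add: cancel_left)
    have "gmap (R \<bullet> ((id_kG \<boxtimes> comul) \<boxtimes> id_kG)) (twtensor (x \<otimes> y) z (bas2 x y) (bas z)) =
        (1 / N) *\<^sub>l (\<Sum>u\<in>carrier G. gmap R (twtensor (x \<otimes> y) z (twtensor x y (bas x) (bas2 u (inv u \<otimes> y))) (bas z)))"
      using x y z R by (simp add: alg_simps)
    also have "\<dots> = (1 / N) *\<^sub>l (\<Sum>u\<in>carrier G. ?t u)"
      by (simp only: val cong: sum.cong)
    also have "(\<Sum>u\<in>carrier G. ?t u) = ?t (inv x)"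
    proof (rule sum_single)
      fix u assume u: "u \<in> carrier G" "u \<noteq> inv x"
      then have "x \<otimes> u \<noteq> \<one>"
        using x inv_equality[of u x] m_comm[of u x] by auto
      then show "?t u = 0" by simp
    qed (use x in simp)
    also have "(1 / N) *\<^sub>l ?t (inv x) = gmap (counit \<bullet> mul \<bullet> (mul \<boxtimes> id_kG)) (twtensor (x \<otimes> y) z (bas2 x y) (bas z))"
      using x y z by (simp add: alg_simps order_nonzero)
    finally show "gmap (counit \<bullet> mul \<bullet> (mul \<boxtimes> id_kG)) (twtensor (x \<otimes> y) z (bas2 x y) (bas z)) =
        gmap (R \<bullet> ((id_kG \<boxtimes> comul) \<boxtimes> id_kG)) (twtensor (x \<otimes> y) z (bas2 x y) (bas z))" by simp
  qed (simp_all add: alg_simps R)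
  also have "\<dots> = glunit G kI \<bullet> ((counit \<bullet> mul) \<boxtimes> (counit \<bullet> mul)) \<bullet> mid_out \<bullet> ((id_kG \<boxtimes> comul) \<boxtimes> id_kG)"
    by (simp add: R_def gcomp_assoc alg_simps)
  finally show ?thesis .
qed

text \<open>Both sides are the sum of \<open>(u \<odot> s) \<odot> t\<close> over all factorizations \<open>ust = 1\<close>, divided by the square of \<open>N\<close>.\<close>

lemma comul_unit:
  "(comul \<boxtimes> id_kG) \<bullet> comul \<bullet> unit_map =
    ((id_kG \<boxtimes> mul) \<boxtimes> id_kG) \<bullet> mid_in \<bullet> ((comul \<bullet> unit_map) \<boxtimes> (comul \<bullet> unit_map)) \<bullet> glunit_inv G kI"
proof -
  define R where "R = ((id_kG \<boxtimes> mul) \<boxtimes> id_kG) \<bullet> mid_in"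
  have R: "arr R" "gdom R = gtensor G kG2 kG2" "gcod R = gtensor G kG2 kG"
    by (simp_all add: R_def alg_simps)
  have R_val: "gmap R (twtensor (u \<otimes> s) (v \<otimes> t) (bas2 u s) (bas2 v t)) =
      twtensor (u \<otimes> (s \<otimes> v)) t (bas2 u (s \<otimes> v)) (bas t)"
    if "u \<in> carrier G" "s \<in> carrier G" "v \<in> carrier G" "t \<in> carrier G" for u s v t
    using that by (simp add: R_def alg_simps)
  have "R \<bullet> ((comul \<bullet> unit_map) \<boxtimes> (comul \<bullet> unit_map)) \<bullet> glunit_inv G kI = (comul \<boxtimes> id_kG) \<bullet> comul \<bullet> unit_map"
  proof (rule arr_eqI_kI)
    have val: "gmap R (twtensor \<one> \<one> (bas2 u (inv u)) (bas2 v (inv v))) = twtensor v (inv v) (bas2 u (inv u \<otimes> v)) (bas (inv v))"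
      if "u \<in> carrier G" "v \<in> carrier G" for u v
      using R_val[of u "inv u" v "inv v"] that by (simp add: cancel_left)
    have "gmap (R \<bullet> ((comul \<bullet> unit_map) \<boxtimes> (comul \<bullet> unit_map)) \<bullet> glunit_inv G kI) (lbasis Triv) =
        (1 / N) *\<^sub>l ((1 / N) *\<^sub>l (\<Sum>v\<in>carrier G. \<Sum>u\<in>carrier G. twtensor v (inv v) (bas2 u (inv u \<otimes> v)) (bas (inv v))))"
      using R by (simp add: alg_simps glunit_inv_arr(4)[of _ \<one>] val lv.scale_sum_right)
    also have "\<dots> = gmap ((comul \<boxtimes> id_kG) \<bullet> comul \<bullet> unit_map) (lbasis Triv)"
      by (simp add: alg_simps lv.scale_sum_right)
    finally show "gmap (R \<bullet> ((comul \<bullet> unit_map) \<boxtimes> (comul \<bullet> unit_map)) \<bullet> glunit_inv G kI) (lbasis Triv) =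
        gmap ((comul \<boxtimes> id_kG) \<bullet> comul \<bullet> unit_map) (lbasis Triv)" .
  qed (simp_all add: alg_simps R)
  then show ?thesis
    by (simp add: R_def gcomp_assoc alg_simps)
qed

text \<open>On the left all \<open>N\<close> terms of the coproduct multiply to \<open>x\<close>. On the right, in \<open>\<Delta>(1)\<close>, the sum of the
  \<open>u \<odot> u\<^sup>-\<^sup>1\<close>, the counit of \<open>ux\<close> selects \<open>u = x\<^sup>-\<^sup>1\<close>. So both sides are the identity.\<close>

lemma antipode_left:
  "mul \<bullet> (id_kG \<boxtimes> id_kG) \<bullet> comul =
    glunit G kG \<bullet> ((counit \<bullet> mul) \<boxtimes> id_kG) \<bullet> asc' \<bullet> (id_kG \<boxtimes> brd) \<bullet> asc \<bullet> ((comul \<bullet> unit_map) \<boxtimes> id_kG) \<bullet> glunit_inv G kG"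
proof -
  define R where "R = glunit G kG \<bullet> ((counit \<bullet> mul) \<boxtimes> id_kG) \<bullet> asc' \<bullet> (id_kG \<boxtimes> brd) \<bullet> asc"
  have R: "arr R" "gdom R = gtensor G kG2 kG" "gcod R = kG"
    by (simp_all add: R_def alg_simps)
  have R_val: "gmap R (twtensor (u \<otimes> s) x (bas2 u s) (bas x)) = (if u \<otimes> x = \<one> then N else 0) *\<^sub>l bas s"
    if "u \<in> carrier G" "s \<in> carrier G" "x \<in> carrier G" for u s x
    using that by (simp add: R_def alg_simps m_comm[of s x])
  have "mul \<bullet> (id_kG \<boxtimes> id_kG) \<bullet> comul = R \<bullet> ((comul \<bullet> unit_map) \<boxtimes> id_kG) \<bullet> glunit_inv G kG"
  proof (rule arr_eqI_kG)
    fix x assume x: "x \<in> carrier G"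
    let ?t = "\<lambda>u. (if u \<otimes> x = \<one> then N else 0) *\<^sub>l bas (inv u)"
    have val: "gmap R (twtensor \<one> x (bas2 u (inv u)) (bas x)) = ?t u" if "u \<in> carrier G" for u
      using R_val[of u "inv u" x] that x by simp
    have "gmap (R \<bullet> ((comul \<bullet> unit_map) \<boxtimes> id_kG) \<bullet> glunit_inv G kG) (bas x) =
        (1 / N) *\<^sub>l (\<Sum>u\<in>carrier G. gmap R (twtensor \<one> x (bas2 u (inv u)) (bas x)))"
      using x R by (simp add: alg_simps glunit_inv_arr(4)[of _ x])
    also have "\<dots> = (1 / N) *\<^sub>l (\<Sum>u\<in>carrier G. ?t u)"
      by (simp only: val cong: sum.cong)
    also have "(\<Sum>u\<in>carrier G. ?t u) = ?t (inv x)"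
    proof (rule sum_single)
      fix u assume u: "u \<in> carrier G" "u \<noteq> inv x"
      then have "u \<otimes> x \<noteq> \<one>"
        using x inv_equality[of u x] by auto
      then show "?t u = 0" by simp
    qed (use x in simp)
    also have "(1 / N) *\<^sub>l ?t (inv x) = gmap (mul \<bullet> (id_kG \<boxtimes> id_kG) \<bullet> comul) (bas x)"
      using x by (simp add: alg_simps sum_const_lvec order_nonzero del: sum_constant)
    finally show "gmap (mul \<bullet> (id_kG \<boxtimes> id_kG) \<bullet> comul) (bas x) =
        gmap (R \<bullet> ((comul \<bullet> unit_map) \<boxtimes> id_kG) \<bullet> glunit_inv G kG) (bas x)" by simp
  qed (simp_all add: alg_simps R)
  then show ?thesis
    by (simp add: R_def gcomp_assoc alg_simps)
qed

text \<open>The mirror image: the counit of \<open>x u\<^sup>-\<^sup>1\<close> selects \<open>u = x\<close>.\<close>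

lemma antipode_right:
  "mul \<bullet> (id_kG \<boxtimes> id_kG) \<bullet> comul =
    grunit G kG \<bullet> (id_kG \<boxtimes> (counit \<bullet> mul)) \<bullet> asc \<bullet> (brd \<boxtimes> id_kG) \<bullet> asc' \<bullet> (id_kG \<boxtimes> (comul \<bullet> unit_map)) \<bullet> grunit_inv G kG"
proof -
  define R where "R = grunit G kG \<bullet> (id_kG \<boxtimes> (counit \<bullet> mul)) \<bullet> asc \<bullet> (brd \<boxtimes> id_kG) \<bullet> asc'"
  have R: "arr R" "gdom R = gtensor G kG kG2" "gcod R = kG"
    by (simp_all add: R_def alg_simps)
  have R_val: "gmap R (twtensor x (u \<otimes> s) (bas x) (bas2 u s)) = (if x \<otimes> s = \<one> then N else 0) *\<^sub>l bas u"
    if "u \<in> carrier G" "s \<in> carrier G" "x \<in> carrier G" for u s x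
    using that by (simp add: R_def alg_simps m_comm[of x u])
  have "mul \<bullet> (id_kG \<boxtimes> id_kG) \<bullet> comul = R \<bullet> (id_kG \<boxtimes> (comul \<bullet> unit_map)) \<bullet> grunit_inv G kG"
  proof (rule arr_eqI_kG)
    fix x assume x: "x \<in> carrier G"
    let ?t = "\<lambda>u. (if x \<otimes> inv u = \<one> then N else 0) *\<^sub>l bas u"
    have val: "gmap R (twtensor x \<one> (bas x) (bas2 u (inv u))) = ?t u" if "u \<in> carrier G" for u
      using R_val[of u "inv u" x] that x by simp
    have "gmap (R \<bullet> (id_kG \<boxtimes> (comul \<bullet> unit_map)) \<bullet> grunit_inv G kG) (bas x) =
        (1 / N) *\<^sub>l (\<Sum>u\<in>carrier G. gmap R (twtensor x \<one> (bas x) (bas2 u (inv u))))"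
      using x R by (simp add: alg_simps grunit_inv_arr(4)[of _ x])
    also have "\<dots> = (1 / N) *\<^sub>l (\<Sum>u\<in>carrier G. ?t u)"
      by (simp only: val cong: sum.cong)
    also have "(\<Sum>u\<in>carrier G. ?t u) = ?t x"
    proof (rule sum_single)
      fix u assume u: "u \<in> carrier G" "u \<noteq> x"
      then have "x \<otimes> inv u \<noteq> \<one>"
        using x inv_equality[of x "inv u"] by auto
      then show "?t u = 0" by simp
    qed (use x in simp)
    also have "(1 / N) *\<^sub>l ?t x = gmap (mul \<bullet> (id_kG \<boxtimes> id_kG) \<bullet> comul) (bas x)"
      using x by (simp add: alg_simps sum_const_lvec order_nonzero del: sum_constant)
    finally show "gmap (mul \<bullet> (id_kG \<boxtimes> id_kG) \<bullet> comul) (bas x) =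
        gmap (R \<bullet> (id_kG \<boxtimes> (comul \<bullet> unit_map)) \<bullet> grunit_inv G kG) (bas x)" by simp
  qed (simp_all add: alg_simps R)
  then show ?thesis
    by (simp add: R_def gcomp_assoc alg_simps)
qed

lemma antipode_convolution:
  "mul \<bullet> (mul \<boxtimes> id_kG) \<bullet> ((id_kG \<boxtimes> id_kG) \<boxtimes> id_kG) \<bullet> (comul \<boxtimes> id_kG) \<bullet> comul = id_kG"
proof (rule arr_eqI_kG)
  fix x assume x: "x \<in> carrier G"
  then show "gmap (mul \<bullet> (mul \<boxtimes> id_kG) \<bullet> ((id_kG \<boxtimes> id_kG) \<boxtimes> id_kG) \<bullet> (comul \<boxtimes> id_kG) \<bullet> comul) (bas x) = gmap id_kG (bas x)"
    by (simp add: alg_simps sum_const_lvec order_nonzero del: sum_constant)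
qed (simp_all add: alg_simps)

text \<open>The two axioms that involve the braiding besides their plain forms reduce to these forms by commutativity and
  cocommutativity.\<close>

theorem group_algebra_weak_braided_Hopf:
  "weak_braided_Hopf_algebra (Vect_twist G F) kG mul unit_map comul counit (Ident (Vect_twist G F) kG)"
proof (intro weak_braided_Hopf_algebra.intro[OF Vect_twist_symmetric_monoidal] weak_braided_Hopf_algebra_axioms.intro,
    unfold smc_data.mid_in_def smc_data.mid_out_def Vect_twist_def smc.simps)
  show "kG \<in> gspaces G" by (rule kG_gspaces)
  show "mul \<in> ghom G kG2 kG" "unit_map \<in> ghom G kI kG" "comul \<in> ghom G kG kG2" "counit \<in> ghom G kG kI"
    "id_kG \<in> ghom G kG kG"
    by (simp_all add: ghom_iff alg_simps)
  show "mul \<bullet> (mul \<boxtimes> id_kG) = mul \<bullet> (id_kG \<boxtimes> mul) \<bullet> asc" by (rule mul_assoc)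
  show "mul \<bullet> (unit_map \<boxtimes> id_kG) = glunit G kG" by (rule mul_unit_left)
  show "mul \<bullet> (id_kG \<boxtimes> unit_map) = grunit G kG" by (rule mul_unit_right)
  show "asc \<bullet> (comul \<boxtimes> id_kG) \<bullet> comul = (id_kG \<boxtimes> comul) \<bullet> comul" by (rule comul_coassoc)
  show "glunit G kG \<bullet> (counit \<boxtimes> id_kG) \<bullet> comul = id_kG" by (rule counit_left)
  show "grunit G kG \<bullet> (id_kG \<boxtimes> counit) \<bullet> comul = id_kG" by (rule counit_right)
  show "comul \<bullet> mul = (mul \<boxtimes> mul) \<bullet> mid_out \<bullet> ((id_kG \<boxtimes> brd) \<boxtimes> id_kG) \<bullet> mid_in \<bullet> (comul \<boxtimes> comul)"
    by (rule comul_mul)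
  show "counit \<bullet> mul \<bullet> (mul \<boxtimes> id_kG) =
      glunit G kI \<bullet> ((counit \<bullet> mul) \<boxtimes> (counit \<bullet> mul)) \<bullet> mid_out \<bullet> ((id_kG \<boxtimes> comul) \<boxtimes> id_kG)"
    by (rule counit_mul)
  show "counit \<bullet> mul \<bullet> (mul \<boxtimes> id_kG) =
      glunit G kI \<bullet> ((counit \<bullet> mul) \<boxtimes> (counit \<bullet> mul)) \<bullet> mid_out \<bullet> ((id_kG \<boxtimes> (brd \<bullet> comul)) \<boxtimes> id_kG)"
    unfolding comul_cocommutative by (rule counit_mul)
  show "(comul \<boxtimes> id_kG) \<bullet> comul \<bullet> unit_map =
      ((id_kG \<boxtimes> mul) \<boxtimes> id_kG) \<bullet> mid_in \<bullet> ((comul \<bullet> unit_map) \<boxtimes> (comul \<bullet> unit_map)) \<bullet> glunit_inv G kI"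
    by (rule comul_unit)
  show "(comul \<boxtimes> id_kG) \<bullet> comul \<bullet> unit_map =
      ((id_kG \<boxtimes> (mul \<bullet> brd)) \<boxtimes> id_kG) \<bullet> mid_in \<bullet> ((comul \<bullet> unit_map) \<boxtimes> (comul \<bullet> unit_map)) \<bullet> glunit_inv G kI"
    unfolding mul_commutative by (rule comul_unit)
  show "mul \<bullet> (id_kG \<boxtimes> id_kG) \<bullet> comul =
      glunit G kG \<bullet> ((counit \<bullet> mul) \<boxtimes> id_kG) \<bullet> asc' \<bullet> (id_kG \<boxtimes> brd) \<bullet> asc \<bullet> ((comul \<bullet> unit_map) \<boxtimes> id_kG) \<bullet> glunit_inv G kG"
    by (rule antipode_left)
  show "mul \<bullet> (id_kG \<boxtimes> id_kG) \<bullet> comul =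
      grunit G kG \<bullet> (id_kG \<boxtimes> (counit \<bullet> mul)) \<bullet> asc \<bullet> (brd \<boxtimes> id_kG) \<bullet> asc' \<bullet> (id_kG \<boxtimes> (comul \<bullet> unit_map)) \<bullet> grunit_inv G kG"
    by (rule antipode_right)
  show "mul \<bullet> (mul \<boxtimes> id_kG) \<bullet> ((id_kG \<boxtimes> id_kG) \<boxtimes> id_kG) \<bullet> (comul \<boxtimes> id_kG) \<bullet> comul = id_kG"
    by (rule antipode_convolution)
qed

end

section \<open>Cyclic groups and roots of unity\<close>

text \<open>The powers of \<open>q\<close> other than \<open>1\<close> are roots of \<open>1 + X + \<dots> + X\<^sup>n\<^sup>-\<^sup>1\<close>. If \<open>n\<close> were \<open>0\<close> in the field, then
  \<open>1\<close> would be a root as well, and a polynomial of degree at most \<open>n - 1\<close> would have \<open>n\<close> roots.\<close>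

lemma primitive_root_order_nonzero:
  fixes q :: "'k::field"
  assumes n: "n \<ge> 1" and qn: "q ^ n = 1" and prim: "\<forall>j. 0 < j \<and> j < n \<longrightarrow> q ^ j \<noteq> 1"
  shows "of_nat n \<noteq> (0 :: 'k)"
proof
  assume zero: "of_nat n = (0 :: 'k)"
  have q0: "q \<noteq> 0" using n qn by (auto simp: power_0_left)
  define p where "p = (\<Sum>i<n. Polynomial.monom (1::'k) i)"
  have p_val: "poly p x = (\<Sum>i<n. x ^ i)" for x
    by (simp add: p_def poly_sum poly_monom)
  have "Polynomial.coeff p 0 = 1"
    using n by (simp add: p_def coeff_sum lessThan_Suc_atMost[symmetric] if_distrib sum.delta cong: if_cong)
  then have p0: "p \<noteq> 0" by auto
  have deg: "degree p \<le> n - 1"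
    unfolding p_def by (intro degree_sum_le) (auto intro: order.trans[OF degree_monom_le])
  have "(\<lambda>j. q ^ j) ` {..<n} \<subseteq> {x. poly p x = 0}"
  proof (rule image_subsetI)
    fix j assume "j \<in> {..<n}"
    show "q ^ j \<in> {x. poly p x = 0}"
    proof (cases "j = 0")
      case True
      then show ?thesis using zero by (simp add: p_val)
    next
      case False
      then have "q ^ j \<noteq> 1" using prim \<open>j \<in> {..<n}\<close> by simp
      moreover have "(q ^ j) ^ n = 1"
        using qn by (simp only: power_mult[symmetric] mult.commute[of j]) (simp add: power_mult)
      ultimately show ?thesis by (simp add: p_val geometric_sum)
    qed
  qed
  then have "card ((\<lambda>j. q ^ j) ` {..<n}) \<le> card {x. poly p x = 0}"
    by (intro card_mono poly_roots_finite p0)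
  moreover have "inj_on (\<lambda>j. q ^ j) {..<n}"
  proof (rule linorder_inj_onI)
    fix i j assume ij: "i < j" "i \<in> {..<n}" "j \<in> {..<n}"
    have "q ^ j = q ^ i * q ^ (j - i)"
      using ij by (simp add: power_add[symmetric])
    moreover have "q ^ (j - i) \<noteq> 1" using prim ij by simp
    ultimately show "q ^ i \<noteq> q ^ j" using q0 by simp
  qed auto
  ultimately have "n \<le> card {x. poly p x = 0}" by (simp add: card_image)
  also have "\<dots> \<le> degree p" by (rule card_poly_roots_bound[OF p0])
  finally show False using deg n by simp
qed

text \<open>The exponent is linear in \<open>b\<close>, hence \<open>F(\<sigma>\<^sup>a, \<sigma>\<^sup>b)\<close> as a function of \<open>b\<close> has period \<open>n\<close>.\<close>

lemma triangular_exponent: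
  "((int a - 1) * int a * b) div 2 = ((int a - 1) * int a) div 2 * b"
proof -
  have "2 dvd (int a - 1) * int a" by simp
  then show ?thesis by (simp add: dvd_div_mult)
qed

lemma powi_cong:
  fixes q :: "'k::field"
  assumes n: "n \<ge> 1" and qn: "q ^ n = 1" and ij: "i mod int n = j mod int n"
  shows "q powi i = q powi j"
proof -
  have q0: "q \<noteq> 0" using n qn by (auto simp: power_0_left)
  obtain k where k: "i - j = int n * k"
    using ij by (metis mod_eq_dvd_iff dvdE)
  then have "q powi i = q powi (j + int n * k)" by (simp add: algebra_simps)
  also have "\<dots> = q powi j" using q0 qn by (simp add: power_int_add power_int_mult)
  finally show ?thesis .
qed

theorem proposition5p3:
  fixes n :: nat and q :: "'k::field"
    and G :: "('g, 'b) monoid_scheme" and \<sigma> :: 'g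
    and F :: "'g \<Rightarrow> 'g \<Rightarrow> 'k"
  assumes "n \<ge> 1"
    and "q ^ n = 1" and "\<forall>j. 0 < j \<and> j < n \<longrightarrow> q ^ j \<noteq> 1"
    and "q ^ (n * (n - 1) div 2) = 1"
    and "group G" and "\<sigma> \<in> carrier G" and "generate G {\<sigma>} = carrier G" and "order G = n"
    and "\<forall>a<n. \<forall>b<n. F (\<sigma> [^]\<^bsub>G\<^esub> a) (\<sigma> [^]\<^bsub>G\<^esub> b) = q powi (- (((int a - 1) * int a * int b) div 2))"
  shows "\<exists>m \<eta> \<Delta> \<epsilon>.
     (\<forall>a<n. \<forall>b<n. gmap m (lbasis (Base (\<sigma> [^]\<^bsub>G\<^esub> a)) \<otimes>\<^sub>l lbasis (Base (\<sigma> [^]\<^bsub>G\<^esub> b)))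
        = q powi (- (((int a - 1) * int a * int b) div 2)) *\<^sub>l lbasis (Base (\<sigma> [^]\<^bsub>G\<^esub> (a + b)))) \<and>
     gmap \<eta> (lbasis Triv) = lbasis (Base \<one>\<^bsub>G\<^esub>) \<and>
     (\<forall>a<n. gmap \<Delta> (lbasis (Base (\<sigma> [^]\<^bsub>G\<^esub> a)))
        = (1 / of_nat n) *\<^sub>l (\<Sum>l=0..n-1. q powi (((int l - 1) * int l * (int a - int l)) div 2) *\<^sub>l
            (lbasis (Base (\<sigma> [^]\<^bsub>G\<^esub> l)) \<otimes>\<^sub>l lbasis (Base (\<sigma> [^]\<^bsub>G\<^esub> (int a - int l)))))) \<and>
     (\<forall>a<n. gmap \<epsilon> (lbasis (Base (\<sigma> [^]\<^bsub>G\<^esub> a))) = (if a = 0 then of_nat n else 0) *\<^sub>l lbasis Triv) \<and>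
     weak_braided_Hopf_algebra (Vect_twist G F) (group_alg G) m \<eta> \<Delta> \<epsilon> (Ident (Vect_twist G F) (group_alg G)) \<and>
     smc_data.commutative_mult (Vect_twist G F) (group_alg G) m \<and>
     smc_data.cocommutative_comult (Vect_twist G F) (group_alg G) \<Delta>"
proof -
  interpret group G by fact
  note n = assms(1) and qn = assms(2) and \<sigma> = assms(6) and F = assms(9)
  have q0: "q \<noteq> 0" using n qn by (auto simp: power_0_left)
  have fin: "finite (carrier G)"
    using n assms(8) by (intro card_ge_0_finite) (simp add: order_def)
  have ord: "ord \<sigma> = n"
    using generate_pow_card[OF \<sigma>] assms(7,8) by (simp add: order_def)
  have inj: "inj_on (\<lambda>i. \<sigma> [^]\<^bsub>G\<^esub> (i::nat)) {0..n-1}"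
    using ord_inj[OF \<sigma>] ord by simp
  have carrier: "carrier G = (\<lambda>i. \<sigma> [^]\<^bsub>G\<^esub> (i::nat)) ` {0..n-1}"
    using generate_pow_on_finite_carrier[OF fin \<sigma>] ord_elems[OF fin \<sigma>] ord assms(7) by auto
  have carrierE: "\<exists>i<n. x = \<sigma> [^]\<^bsub>G\<^esub> i" if x: "x \<in> carrier G" for x
  proof -
    obtain i where "i \<in> {0..n-1}" "x = \<sigma> [^]\<^bsub>G\<^esub> i"
      using x unfolding carrier by (elim imageE)
    then show ?thesis using n by (intro exI[of _ i]) simp
  qed
  have comm: "comm_group G"
  proof (rule group_comm_groupI)
    fix x y assume "x \<in> carrier G" "y \<in> carrier G"
    then obtain i j where "x = \<sigma> [^]\<^bsub>G\<^esub> (i::nat)" "y = \<sigma> [^]\<^bsub>G\<^esub> (j::nat)"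
      using carrierE by blast
    then show "x \<otimes>\<^bsub>G\<^esub> y = y \<otimes>\<^bsub>G\<^esub> x"
      using \<sigma> by (simp add: nat_pow_mult add.commute)
  qed
  (* The coproduct involves negative powers of the generator in the second argument of F. *)
  have F_int: "F (\<sigma> [^]\<^bsub>G\<^esub> a) (\<sigma> [^]\<^bsub>G\<^esub> b) = q powi (- (((int a - 1) * int a * b) div 2))"
    if a: "a < n" for a :: nat and b :: int
  proof -
    define c where "c = nat (b mod int n)"
    have c: "c < n" "int c = b mod int n"
      using n by (simp_all add: c_def nat_less_iff)
    have "\<sigma> [^]\<^bsub>G\<^esub> b = \<sigma> [^]\<^bsub>G\<^esub> c"
    proof -
      have "\<sigma> [^]\<^bsub>G\<^esub> b = \<sigma> [^]\<^bsub>G\<^esub> int c"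
        using \<sigma> ord by (simp add: int_pow_eq c(2) mod_eq_dvd_iff[symmetric])
      then show ?thesis by (simp add: int_pow_int)
    qed
    then have "F (\<sigma> [^]\<^bsub>G\<^esub> a) (\<sigma> [^]\<^bsub>G\<^esub> b) = q powi (- (((int a - 1) * int a) div 2 * int c))"
      using F a c(1) by (simp add: triangular_exponent)
    also have "\<dots> = q powi (- (((int a - 1) * int a) div 2 * b))"
      by (rule powi_cong[OF n qn]) (metis c(2) mod_minus_cong mod_mult_right_eq)
    finally show ?thesis by (simp add: triangular_exponent)
  qed
  interpret A: twisted_group_algebra G F
  proof (intro twisted_group_algebra.intro twisted_grading.intro finite_grading.intro
      finite_grading_axioms.intro twisted_grading_axioms.intro twisted_group_algebra_axioms.intro comm fin)
    fix x y assume x: "x \<in> carrier G" and y: "y \<in> carrier G"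
    obtain i where i: "i < n" "x = \<sigma> [^]\<^bsub>G\<^esub> i" using carrierE[OF x] by blast
    obtain j where j: "j < n" "y = \<sigma> [^]\<^bsub>G\<^esub> j" using carrierE[OF y] by blast
    show "F x y \<noteq> 0" using F i j q0 by simp
    show "F \<one>\<^bsub>G\<^esub> x = 1" using F[rule_format, of 0 i] i n by simp
    show "F x \<one>\<^bsub>G\<^esub> = 1" using F[rule_format, of i 0] i n by simp
  next
    show "of_nat (order G) \<noteq> (0 :: 'k)"
      unfolding assms(8) by (rule primitive_root_order_nonzero[OF assms(1-3)])
  qed
  have coproduct: "gmap A.comul (lbasis (Base (\<sigma> [^]\<^bsub>G\<^esub> a))) =
      (1 / of_nat n) *\<^sub>l (\<Sum>l=0..n-1. q powi (((int l - 1) * int l * (int a - int l)) div 2) *\<^sub>l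
        (lbasis (Base (\<sigma> [^]\<^bsub>G\<^esub> l)) \<otimes>\<^sub>l lbasis (Base (\<sigma> [^]\<^bsub>G\<^esub> (int a - int l)))))" for a :: nat
  proof -
    have "A.bas2 (\<sigma> [^]\<^bsub>G\<^esub> l) (inv\<^bsub>G\<^esub> (\<sigma> [^]\<^bsub>G\<^esub> l) \<otimes>\<^bsub>G\<^esub> \<sigma> [^]\<^bsub>G\<^esub> a) =
        q powi (((int l - 1) * int l * (int a - int l)) div 2) *\<^sub>l
        (lbasis (Base (\<sigma> [^]\<^bsub>G\<^esub> l)) \<otimes>\<^sub>l lbasis (Base (\<sigma> [^]\<^bsub>G\<^esub> (int a - int l))))"
      if "l \<in> {0..n-1}" for l :: nat
    proof -
      have "inv\<^bsub>G\<^esub> (\<sigma> [^]\<^bsub>G\<^esub> l) \<otimes>\<^bsub>G\<^esub> \<sigma> [^]\<^bsub>G\<^esub> a = \<sigma> [^]\<^bsub>G\<^esub> (int a - int l)"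
        using \<sigma> by (simp add: int_pow_diff int_pow_int A.m_comm)
      moreover have "inverse (F (\<sigma> [^]\<^bsub>G\<^esub> l) (\<sigma> [^]\<^bsub>G\<^esub> (int a - int l))) =
          q powi (((int l - 1) * int l * (int a - int l)) div 2)"
        using that n by (subst F_int) (simp_all add: power_int_minus)
      ultimately show ?thesis by (simp add: A.twtensor_def)
    qed
    then show ?thesis
      using \<sigma> inj assms(8) by (simp add: A.comul_arr(4)) (simp add: carrier sum.reindex)
  qed
  have counit: "gmap A.counit (lbasis (Base (\<sigma> [^]\<^bsub>G\<^esub> a))) = (if a = 0 then of_nat n else 0) *\<^sub>l lbasis Triv"
    if "a < n" for a :: nat
  proof -
    have "\<sigma> [^]\<^bsub>G\<^esub> a = \<one>\<^bsub>G\<^esub> \<longleftrightarrow> a = 0"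
      using inj_onD[OF inj, of a 0] that by auto
    then show ?thesis using \<sigma> assms(8) by (simp add: A.counit_arr(4))
  qed
  have product: "gmap A.mul (lbasis (Base (\<sigma> [^]\<^bsub>G\<^esub> a)) \<otimes>\<^sub>l lbasis (Base (\<sigma> [^]\<^bsub>G\<^esub> b))) =
      q powi (- (((int a - 1) * int a * int b) div 2)) *\<^sub>l lbasis (Base (\<sigma> [^]\<^bsub>G\<^esub> (a + b)))"
    if "a < n" "b < n" for a b :: nat
    using F \<sigma> that by (simp add: A.mul_arr(5) nat_pow_mult)
  have "smc_data.commutative_mult (Vect_twist G F) (group_alg G) A.mul"
    unfolding smc_data.commutative_mult_def Vect_twist_def smc.simps by (rule A.mul_commutative)
  moreover have "smc_data.cocommutative_comult (Vect_twist G F) (group_alg G) A.comul"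
    unfolding smc_data.cocommutative_comult_def Vect_twist_def smc.simps by (rule A.comul_cocommutative)
  ultimately show ?thesis
    using product A.unit_map_arr(4) coproduct counit A.group_algebra_weak_braided_Hopf
    by (intro exI[of _ A.mul] exI[of _ A.unit_map] exI[of _ A.comul] exI[of _ A.counit] conjI allI impI)
qed

end
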